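(* Let $\hbar>0$, let $A,B$ be real symmetric positive definite $n\times n$ matrices, and let $X=\{x\in\mathbb{R}^n_x: Ax\cdot x\leq\hbar\}$ and $P=\{p\in\mathbb{R}^n_p: Bp\cdot p\leq\hbar\}$ be two ellipsoids such that $X^{\hbar}\subset P$ and $X^{\hbar}\neq P$. (i) The product $X\times P$ contains two quantum blobs, i.e. two (centered) ellipsoids $\Omega_+$ and $\Omega_-$ such that $\Omega_\pm=S_\pm(\mathcal{B}^{2n}(\sqrt{\hbar}))$ for some $S_\pm\in\mathrm{Sp}(n)$ and whose orthogonal projections on $\mathbb{R}^n_x$ and $\mathbb{R}^n_p$ are $X$ and $P$. These ellipsoids are the covariance ellipsoids of two pure Gaussian quantum states explicitly given by the formula $$\psi_\pm(x)=\left(\tfrac{1}{2\pi}\right)^{n/4}(\det\Sigma_{XX})^{-1/4}\exp\left[-\left(\tfrac14\Sigma_{XX}^{-1}\pm\tfrac{i}{2\hbar}\Sigma_{XP}\Sigma_{XX}^{-1}\right)x\cdot x\right]$$ where $\Sigma_{XX}$ and $\Sigma_{XP}$ are the $n\times n$ matrices defined by $$\Sigma_{XX}=\frac{\hbar}{2}A^{-1},\qquad \Sigma_{XP}=\frac{\hbar}{2}\left(B^{-1}A^{-1}-I_{n\times n}\right)^{1/2}.$$ (ii) Let $\Omega=\{z\in\mathbb{R}^{2n}:\frac12\Sigma^{-1}z\cdot z\leq 1\}$ be the ellipsoid with largest volume contained in $X\times P$ and having orthogonal projections $X$ and $P$. The quantum state $\widehat\rho$ with Wigner distribution $$W_{\widehat\rho}(z)=\left(\tfrac{1}{2\pi}\right)^n(\det\Sigma)^{-1/2}e^{-\frac12\Sigma^{-1}z\cdot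 z}$$ is a mixed state with purity $\mu(\widehat\rho)=\lambda_{j_1}^{2}\cdots\lambda_{j_m}^{2}$, where the $\lambda_{j_k}$ are the eigenvalues of $AB$ that are smaller than one.
   Context: Phase space is $\mathbb{R}^{2n}=\mathbb{R}^n_x\times\mathbb{R}^n_p$ with points $z=(x,p)$; the orthogonal projections are $(x,p)\mapsto x$ and $(x,p)\mapsto p$. $\mathcal{B}^{2n}(r)$ is the closed Euclidean ball of radius $r$ centered at $0$ in $\mathbb{R}^{2n}$. $\mathrm{Sp}(n)$ is the group of real $2n\times 2n$ matrices $S$ with $S^TJS=J$, where $J=\begin{pmatrix}0&I_{n\times n}\\-I_{n\times n}&0\end{pmatrix}$. A quantum blob is a set $S(\mathcal{B}^{2n}(\sqrt{\hbar}))$ with $S\in\mathrm{Sp}(n)$. The polar dual of a convex body $X\subset\mathbb{R}^n_x$ containing $0$ in its interior is $X^{\hbar}=\{p\in\mathbb{R}^n_p: p\cdot x\leq\hbar\text{ for all }x\in X\}$. The matrix $B^{-1}A^{-1}$ is similar to a symmetric positive definite matrix; under the hypotheses $B^{-1}A^{-1}-I_{n\times n}$ is diagonalizable with nonnegative eigenvalues, and $(\cdot)^{1/2}$ denotes its diagonalizable square root with nonnegative eigenvalues. For $\psi\in L^2(\mathbb{R}^n)$ the Wigner transform is $W\psi(x,p)=\left(\frac{1}{2\pi\hbar}\right)^n\int_{\mathbb{R}^n} e^{-\frac{i}{\hbar}p\cdot y}\psi(x+\frac12 y)\overline{\psi(x-\frac12 y)}\,dy$. A quantum state $\widehat\rho$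 is a positive semidefinite operator on $L^2(\mathbb{R}^n)$ of trace one; writing $\widehat\rho=\sum_j\mu_j|\psi_j\rangle\langle\psi_j|$ with $\mu_j\geq0$, $\sum_j\mu_j=1$, $\|\psi_j\|_{L^2}=1$, its Wigner distribution is $W_{\widehat\rho}=\sum_j\mu_jW\psi_j$. When first moments vanish, the covariance matrix is $\Sigma=\int zz^TW_{\widehat\rho}(z)\,dz$ and the covariance ellipsoid is $\{z:\frac12\Sigma^{-1}z\cdot z\leq1\}$ (for a pure state $\psi$, use $W\psi$). The purity of $\widehat\rho$ is $\mu(\widehat\rho)=\mathrm{Tr}(\widehat\rho^2)$; a state is mixed if it is not pure.
   Formalization: The purity in (ii) is proved as the product of the square roots of the eigenvalues of AB smaller than one, not of their squares; the printed formula is false (n=1, A=1, B=1/2 has purity 1/√2, not 1/4). *)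

theory Defs
  imports "HOL-Analysis.Analysis"
begin

section \<open>Phase space\<close>

text \<open>
  The phase space $\mathbb{R}^n_x \times \mathbb{R}^n_p$ is \<^typ>\<open>real ^ ('n + 'n)\<close>: the indices
  \<open>Inl i\<close> are the positions and the indices \<open>Inr i\<close> the momenta.  Norm, Lebesgue measure and
  determinants are then the library's.
\<close>

definition xproj :: "real ^ ('n + 'n) \<Rightarrow> real ^ 'n" where
  "xproj z = (\<chi> i. z $ Inl i)"

definition pproj :: "real ^ ('n + 'n) \<Rightarrow> real ^ 'n" where
  "pproj z = (\<chi> i. z $ Inr i)"

definition phase_prod :: "(real ^ 'n) set \<Rightarrow> (real ^ 'n) set \<Rightarrow> (real ^ ('n + 'n)) set" where
  "phase_prod X P = {z. xproj z \<in> X \<and> pproj z \<in> P}"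

definition block_matrix ::
  "real ^ 'n ^ 'n \<Rightarrow> real ^ 'n ^ 'n \<Rightarrow> real ^ 'n ^ 'n \<Rightarrow> real ^ 'n ^ 'n \<Rightarrow>
    real ^ ('n + 'n) ^ ('n + 'n)" where
  "block_matrix a b c d = (\<chi> k l.
     case k of
       Inl i \<Rightarrow> (case l of Inl j \<Rightarrow> a $ i $ j | Inr j \<Rightarrow> b $ i $ j)
     | Inr i \<Rightarrow> (case l of Inl j \<Rightarrow> c $ i $ j | Inr j \<Rightarrow> d $ i $ j))"

definition Jmat :: "real ^ ('n::finite + 'n) ^ ('n + 'n)" where
  "Jmat = block_matrix 0 (mat 1) (- mat 1) 0"

definition Sp :: "(real ^ ('n::finite + 'n) ^ ('n + 'n)) set" where
  "Sp = {S. transpose S ** Jmat ** S = Jmat}"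

definition quantum_blob :: "real \<Rightarrow> (real ^ ('n::finite + 'n)) set \<Rightarrow> bool" where
  "quantum_blob hbar \<Omega> \<longleftrightarrow> (\<exists>S \<in> Sp. \<Omega> = (\<lambda>z. S *v z) ` cball 0 (sqrt hbar))"


section \<open>Matrices, ellipsoids, polar duality\<close>

definition posdef :: "real ^ 'm ^ 'm \<Rightarrow> bool" where
  "posdef M \<longleftrightarrow> transpose M = M \<and> (\<forall>x. x \<noteq> 0 \<longrightarrow> (M *v x) \<bullet> x > 0)"

definition diagonalizable :: "real ^ 'm ^ 'm \<Rightarrow> bool" where
  "diagonalizable M \<longleftrightarrow>
     (\<exists>(Q :: real ^ 'm ^ 'm) (D :: real ^ 'm ^ 'm).
        invertible Q \<and> (\<forall>i j. i \<noteq> j \<longrightarrow> D $ i $ j = 0) \<and> M = Q ** D ** matrix_inv Q)"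

definition is_eigenvalue :: "real ^ 'm ^ 'm \<Rightarrow> real \<Rightarrow> bool" where
  "is_eigenvalue M c \<longleftrightarrow> (\<exists>v. v \<noteq> 0 \<and> M *v v = c *s v)"

text \<open>
  The \<open>THE\<close> is well-defined if \<open>M\<close> is itself diagonalizable with nonnegative eigenvalues.
\<close>

definition diag_sqrt :: "real ^ 'm ^ 'm \<Rightarrow> real ^ 'm ^ 'm" where
  "diag_sqrt M = (THE R. diagonalizable R \<and> (\<forall>c. is_eigenvalue R c \<longrightarrow> c \<ge> 0) \<and> R ** R = M)"

text \<open>
  All eigenvalues of \<open>M\<close>, listed with algebraic multiplicity: the characteristic polynomial of \<open>M\<close>
  is the product of the linear factors given by \<open>ev\<close>.  This determines \<open>ev\<close> up to a permutation.
\<close>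

definition eigenvalues_with_mult :: "real ^ 'm ^ 'm \<Rightarrow> ('m \<Rightarrow> real) \<Rightarrow> bool" where
  "eigenvalues_with_mult M ev \<longleftrightarrow> (\<forall>t. det (mat t - M) = (\<Prod>i\<in>UNIV. t - ev i))"

definition quad_ellipsoid :: "real ^ 'm ^ 'm \<Rightarrow> real \<Rightarrow> (real ^ 'm) set" where
  "quad_ellipsoid M c = {x. (M *v x) \<bullet> x \<le> c}"

definition cov_ellipsoid :: "real ^ 'm ^ 'm \<Rightarrow> (real ^ 'm) set" where
  "cov_ellipsoid \<Sigma> = {z. 1/2 * ((matrix_inv \<Sigma> *v z) \<bullet> z) \<le> 1}"

definition polar_dual :: "real \<Rightarrow> (real ^ 'm) set \<Rightarrow> (real ^ 'm) set" where
  "polar_dual hbar X = {p. \<forall>x\<in>X. p \<bullet> x \<le> hbar}"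

definition ellipsoid :: "(real ^ 'm) set \<Rightarrow> bool" where
  "ellipsoid E \<longleftrightarrow>
     (\<exists>c (M :: real ^ 'm ^ 'm). invertible M \<and> E = (\<lambda>z. c + M *v z) ` cball 0 1)"

definition inscribed_ellipsoid ::
  "(real ^ 'n) set \<Rightarrow> (real ^ 'n) set \<Rightarrow> (real ^ ('n + 'n)) set \<Rightarrow> bool" where
  "inscribed_ellipsoid X P E \<longleftrightarrow>
     ellipsoid E \<and> E \<subseteq> phase_prod X P \<and> xproj ` E = X \<and> pproj ` E = P"

text \<open>The maximum has to be strict, which makes \<open>E\<close> unique.\<close>

definition largest_inscribed_ellipsoid ::
  "(real ^ 'n) set \<Rightarrow> (real ^ 'n) set \<Rightarrow> (real ^ ('n + 'n)) set \<Rightarrow> bool" where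
  "largest_inscribed_ellipsoid X P E \<longleftrightarrow>
     inscribed_ellipsoid X P E \<and>
     (\<forall>E'. inscribed_ellipsoid X P E' \<and> E' \<noteq> E \<longrightarrow> measure lebesgue E' < measure lebesgue E)"


section \<open>The Hilbert space of square integrable functions and its operators\<close>

text \<open>
  Elements of $L^2(\mathbb{R}^n)$ are represented by square integrable Borel functions, and equality
  in $L^2$ is equality almost everywhere.  Operators act on representatives.  The inner product is
  antilinear in its first argument, so that \<open>ketbra \<psi> f\<close> is $|\psi\rangle\langle\psi|f\rangle$.
\<close>

definition L2 :: "('a::euclidean_space \<Rightarrow> complex) set" where
  "L2 = {f. f \<in> borel_measurable lborel \<and> integrable lborel (\<lambda>x. (cmod (f x))\<^sup>2)}"

definition L2_inner :: "('a::euclidean_space \<Rightarrow> complex) \<Rightarrow> ('a \<Rightarrow> complex) \<Rightarrow> complex" where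
  "L2_inner f g = (LINT x|lborel. cnj (f x) * g x)"

definition L2_norm :: "('a::euclidean_space \<Rightarrow> complex) \<Rightarrow> real" where
  "L2_norm f = sqrt (LINT x|lborel. (cmod (f x))\<^sup>2)"

definition unit_L2 :: "('a::euclidean_space \<Rightarrow> complex) \<Rightarrow> bool" where
  "unit_L2 f \<longleftrightarrow> f \<in> L2 \<and> L2_norm f = 1"

type_synonym 'a L2_op = "('a \<Rightarrow> complex) \<Rightarrow> ('a \<Rightarrow> complex)"

text \<open>
  Linearity together with boundedness makes such a map respect equality almost everywhere.
\<close>

definition L2_operator :: "'a::euclidean_space L2_op \<Rightarrow> bool" where
  "L2_operator T \<longleftrightarrow>
     (\<forall>f\<in>L2. T f \<in> L2) \<and>
     (\<forall>f\<in>L2. \<forall>g\<in>L2. \<forall>a b. AE x in lborel. T (\<lambda>y. a * f y + b * g y) x = a * T f x + b * T g x) \<and>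
     (\<exists>C. \<forall>f\<in>L2. L2_norm (T f) \<le> C * L2_norm f)"

definition possemidef_operator :: "'a::euclidean_space L2_op \<Rightarrow> bool" where
  "possemidef_operator T \<longleftrightarrow>
     L2_operator T \<and> (\<forall>f\<in>L2. Im (L2_inner f (T f)) = 0 \<and> Re (L2_inner f (T f)) \<ge> 0)"

definition orthonormal_basis :: "(nat \<Rightarrow> 'a::euclidean_space \<Rightarrow> complex) \<Rightarrow> bool" where
  "orthonormal_basis e \<longleftrightarrow>
     (\<forall>i. e i \<in> L2) \<and>
     (\<forall>i j. L2_inner (e i) (e j) = (if i = j then 1 else 0)) \<and>
     (\<forall>f\<in>L2. (\<lambda>N. L2_norm (\<lambda>x. f x - (\<Sum>i<N. L2_inner (e i) f * e i x))) \<longlonglongrightarrow> 0)"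

text \<open>Summability in every orthonormal basis amounts to being of trace class.\<close>

definition has_trace :: "'a::euclidean_space L2_op \<Rightarrow> complex \<Rightarrow> bool" where
  "has_trace T t \<longleftrightarrow>
     L2_operator T \<and> (\<forall>e. orthonormal_basis e \<longrightarrow> (\<lambda>i. L2_inner (e i) (T (e i))) sums t)"

definition ketbra :: "('a::euclidean_space \<Rightarrow> complex) \<Rightarrow> 'a L2_op" where
  "ketbra \<psi> f = (\<lambda>x. L2_inner \<psi> f * \<psi> x)"


section \<open>Quantum states\<close>

definition quantum_state :: "'a::euclidean_space L2_op \<Rightarrow> bool" where
  "quantum_state \<rho> \<longleftrightarrow> possemidef_operator \<rho> \<and> has_trace \<rho> 1"

definition pure_state :: "'a::euclidean_space L2_op \<Rightarrow> bool" where
  "pure_state \<rho> \<longleftrightarrow>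
     quantum_state \<rho> \<and> (\<exists>\<psi>. unit_L2 \<psi> \<and> (\<forall>f\<in>L2. AE x in lborel. \<rho> f x = ketbra \<psi> f x))"

definition mixed_state :: "'a::euclidean_space L2_op \<Rightarrow> bool" where
  "mixed_state \<rho> \<longleftrightarrow> quantum_state \<rho> \<and> \<not> pure_state \<rho>"

definition has_purity :: "'a::euclidean_space L2_op \<Rightarrow> real \<Rightarrow> bool" where
  "has_purity \<rho> m \<longleftrightarrow> has_trace (\<rho> \<circ> \<rho>) (of_real m)"

text \<open>
  The decomposition $\rho = \sum_j \mu_j |\psi_j\rangle\langle\psi_j|$, as a strongly convergent
  series; finite sums are covered by weights \<open>\<mu> j = 0\<close>.
\<close>

definition state_decomposition ::
  "'a::euclidean_space L2_op \<Rightarrow> (nat \<Rightarrow> real) \<Rightarrow> (nat \<Rightarrow> 'a \<Rightarrow> complex) \<Rightarrow> bool" where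
  "state_decomposition \<rho> \<mu> \<psi> \<longleftrightarrow>
     (\<forall>j. \<mu> j \<ge> 0) \<and> \<mu> sums 1 \<and> (\<forall>j. unit_L2 (\<psi> j)) \<and>
     (\<forall>f\<in>L2. (\<lambda>N. L2_norm (\<lambda>x. \<rho> f x - (\<Sum>j<N. of_real (\<mu> j) * ketbra (\<psi> j) f x))) \<longlonglongrightarrow> 0)"

definition wigner ::
  "real \<Rightarrow> (real ^ 'n \<Rightarrow> complex) \<Rightarrow> real ^ ('n + 'n) \<Rightarrow> complex" where
  "wigner hbar \<psi> z =
     of_real ((1 / (2 * pi * hbar)) ^ CARD('n)) *
     (LINT y|lborel. exp (- (\<i> / of_real hbar) * of_real (pproj z \<bullet> y)) *
        \<psi> (xproj z + (1/2) *\<^sub>R y) * cnj (\<psi> (xproj z - (1/2) *\<^sub>R y)))"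

definition has_wigner_distribution ::
  "real \<Rightarrow> (real ^ 'n) L2_op \<Rightarrow> (real ^ ('n + 'n) \<Rightarrow> complex) \<Rightarrow> bool" where
  "has_wigner_distribution hbar \<rho> W \<longleftrightarrow>
     (\<exists>\<mu> \<psi>. state_decomposition \<rho> \<mu> \<psi> \<and>
        (\<forall>z. (\<lambda>j. of_real (\<mu> j) * wigner hbar (\<psi> j) z) sums W z))"

definition has_covariance_matrix ::
  "(real ^ 'm \<Rightarrow> complex) \<Rightarrow> real ^ 'm ^ 'm \<Rightarrow> bool" where
  "has_covariance_matrix W \<Sigma> \<longleftrightarrow>
     (\<forall>k. has_bochner_integral lborel (\<lambda>z. of_real (z $ k) * W z) 0) \<and>
     (\<forall>k l. has_bochner_integral lborel (\<lambda>z. of_real (z $ k * z $ l) * W z) (of_real (\<Sigma> $ k $ l)))"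

definition has_covariance_ellipsoid ::
  "real \<Rightarrow> (real ^ 'n \<Rightarrow> complex) \<Rightarrow> (real ^ ('n + 'n)) set \<Rightarrow> bool" where
  "has_covariance_ellipsoid hbar \<psi> \<Omega> \<longleftrightarrow>
     (\<exists>\<Sigma>. has_covariance_matrix (wigner hbar \<psi>) \<Sigma> \<and> posdef \<Sigma> \<and> \<Omega> = cov_ellipsoid \<Sigma>)"


section \<open>Gaussian functions\<close>

text \<open>The sign \<open>s\<close> is \<open>1\<close> for $\psi_+$ and \<open>-1\<close> for $\psi_-$.\<close>

definition gaussian_state ::
  "real \<Rightarrow> real \<Rightarrow> real ^ 'n ^ 'n \<Rightarrow> real ^ 'n ^ 'n \<Rightarrow> real ^ 'n \<Rightarrow> complex" where
  "gaussian_state hbar s \<Sigma>XX \<Sigma>XP x =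
     of_real ((1 / (2 * pi)) powr (real CARD('n) / 4) * det \<Sigma>XX powr (- 1/4)) *
     exp (- (of_real (1/4 * ((matrix_inv \<Sigma>XX *v x) \<bullet> x)) +
             of_real s * (\<i> / (2 * of_real hbar)) * of_real (((\<Sigma>XP ** matrix_inv \<Sigma>XX) *v x) \<bullet> x)))"

definition gaussian_density :: "real ^ ('n::finite + 'n) ^ ('n + 'n) \<Rightarrow> real ^ ('n + 'n) \<Rightarrow> real" where
  "gaussian_density \<Sigma> z =
     (1 / (2 * pi)) ^ CARD('n) * det \<Sigma> powr (- 1/2) * exp (- 1/2 * ((matrix_inv \<Sigma> *v z) \<bullet> z))"

text \<open>
  The purity of a state with Wigner distribution \<open>gaussian_density \<Sigma>\<close> is
  $(2\pi\hbar)^n \int W^2 = (\hbar/2)^n (\det\Sigma)^{-1/2}$.  For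
  $\Sigma = \frac{\hbar}{2}(A^{-1} \oplus B^{-1})$ this is $(\det AB)^{1/2}$: each eigenvalue of
  $AB$ enters with exponent $1/2$, and not $2$ (for $n = 1$, $A = 1$, $B = 1/2$ the purity is
  $1/\sqrt{2}$).
\<close>

end

theory Submission
  imports Defs "HOL-Probability.Probability"
begin

text \<open>
  Simultaneous diagonalization gives an invertible $V$ with $A = V^T V$ and $B^{-1} = V^T D V$, $D$
  diagonal; the inclusion $X^\hbar \subset P$ says $D \geq I$, and it is strict iff $D \neq I$.
  With $E = (D - I)^{1/2}$, the two blobs are the images of the ball under the symplectic matrices
  with lower left blocks $\mp V^T E$ and diagonal blocks $V^{-1}$, $V^T$.  The ellipsoid of largest
  volume is found by mapping $X \times P$ linearly onto a product of two unit balls, which lies in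
  the unit cube: by Hadamard's inequality the unit ball is the unique largest ellipsoid in the cube.

  The Gaussian of the largest ellipsoid is the Wigner transform of the integral operator with kernel
  $K(u,v) = f(u) f(v) e^{\sum_i g_i(u) g_i(v)}$, where $g_i = 0$ iff $D_{ii} = 1$.  Expanding the
  exponential over words $w$ in the indices writes $K$ as a sum of terms $h_w(u) h_w(v)$, hence as a
  convex combination of pure states.  Conversely, uniqueness of Fourier transforms in $L^1$ shows
  that every state with this Wigner distribution is this operator.  Its purity is the
  squared Hilbert--Schmidt norm $\int\!\!\int K^2 = \prod_i D_{ii}^{-1/2}$, which is less than one,
  so the state is not pure; the eigenvalues of $AB$ are the $1/D_{ii}$.
\<close>

section \<open>Spectral theorem\<close>

text \<open>The substitution a = V x, w = V^{-T} p is symplectic. It turns X into a ball and P into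
  an ellipsoid with semi-axes sqrt (hbar * d i) along the axes, so every claim splits into problems
  with one degree of freedom and a parameter d i >= 1. Diagonalizing B^{-1} rather than B by the
  same congruence makes B^{-1} A^{-1} = V^T D V^{-T} a similarity, which yields both the root V^T E
  V^{-T} and the eigenvalues of A B. The choice of E is forced: the shear adds E^2 to the momentum
  form, and E^2 + I must be D. The obstacle in the second half is that a Wigner distribution is
  given only as a pointwise convergent series for some decomposition, which is far from unique. For
  fixed x the Wigner transform is a Fourier transform in y of the kernel at the pair with midpoint x
  and difference y; so the kernel is recovered line by line, and a measure preserving change of
  variables passes from lines to almost all pairs. Positivity of the operator rests on d i >= 1: the
  mixed term in the exponent of K then has a nonnegative coefficient, so its exponential expands
  with nonnegative weights.\<close>

lemma self_adjoint_eigenvector: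
  fixes f :: "'a::euclidean_space \<Rightarrow> 'a"
  assumes f: "linear f" and sa: "\<And>x y. f x \<bullet> y = x \<bullet> f y"
    and S: "subspace S" and inv: "\<And>x. x \<in> S \<Longrightarrow> f x \<in> S" and ne: "S \<noteq> {0}"
  obtains v c where "v \<in> S" "norm v = 1" "f v = c *\<^sub>R v"
proof -
  have cont: "continuous_on U f" for U
    using f by (simp add: linear_continuous_on linear_conv_bounded_linear)
  from ne S obtain u where u: "u \<in> S" "u \<noteq> 0"
    using subspace_0 by blast
  then have "(1 / norm u) *\<^sub>R u \<in> S \<inter> sphere 0 1"
    using S by (simp add: subspace_mul)
  moreover have "compact (S \<inter> sphere 0 1)"
    by (simp add: S closed_Int_compact closed_subspace)
  moreover have "continuous_on (S \<inter> sphere 0 1) (\<lambda>x. f x \<bullet> x)"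
    by (intro continuous_on_inner cont continuous_on_id)
  \<comment> \<open>The Rayleigh quotient attains its maximum on the compact unit sphere of
    \<open>S\<close>; a maximizer is the eigenvector sought.\<close>
  ultimately have "\<exists>x\<in>S \<inter> sphere 0 1. \<forall>y\<in>S \<inter> sphere 0 1. f y \<bullet> y \<le> f x \<bullet> x"
    by (intro continuous_attains_sup) auto
  then obtain v where v: "v \<in> S" "norm v = 1"
    and max: "\<And>y. y \<in> S \<Longrightarrow> norm y = 1 \<Longrightarrow> f y \<bullet> y \<le> f v \<bullet> v"
    by auto
  define c where "c = f v \<bullet> v"
  have le: "f y \<bullet> y \<le> c * (y \<bullet> y)" if "y \<in> S" for y
  proof (cases "y = 0")
    case True
    then show ?thesis using f by (simp add: linear_0)
  next
    case False
    let ?y = "(1 / norm y) *\<^sub>R y"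
    have "f ?y \<bullet> ?y \<le> c"
      unfolding c_def using max[of ?y] that False S by (simp add: subspace_mul)
    then have "(f y \<bullet> y) / (norm y)\<^sup>2 \<le> c"
      using f by (simp add: linear_cmul power2_eq_square)
    then show ?thesis
      using False by (simp add: divide_le_eq dot_square_norm)
  qed
  have orth: "f v \<bullet> w = 0" if w: "w \<in> S" "v \<bullet> w = 0" for w
  proof (rule ccontr)
    assume a: "f v \<bullet> w \<noteq> 0"
    define a where "a = f v \<bullet> w"
    define b where "b = c * (w \<bullet> w) - f w \<bullet> w"
    \<comment> \<open>The maximum property along v + t w, where the first order term must vanish: t
      = 1 and t = -1 give b > 0, and then t = a / b contradicts a \<noteq> 0.\<close>
    have quad: "2 * t * a \<le> t\<^sup>2 * b" for t
    proof -
      have "v + t *\<^sub>R w \<in> S"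
        using v w S by (simp add: subspace_add subspace_mul)
      from le[OF this] have "c + 2 * t * a + t\<^sup>2 * (f w \<bullet> w) \<le> c * (1 + t\<^sup>2 * (w \<bullet> w))"
        using v(2) w(2) sa[of w v] f
        by (simp add: linear_add linear_cmul inner_add_left inner_add_right inner_commute a_def
            c_def power2_eq_square norm_eq_1 algebra_simps)
      then show ?thesis by (simp add: b_def algebra_simps)
    qed
    have "b > 0"
      using quad[of 1] quad[of "-1"] a by (auto simp: a_def)
    have "2 * (a / b) * a \<le> (a / b)\<^sup>2 * b" by (rule quad)
    with \<open>b > 0\<close> have "2 * a\<^sup>2 \<le> a\<^sup>2" by (simp add: field_simps power2_eq_square)
    with a show False by (simp add: a_def)
  qed
  have vv: "v \<bullet> v = 1" using v by (simp add: norm_eq_1)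
  \<comment> \<open>The residual is orthogonal to \<open>v\<close>, hence by \<open>orth\<close> to
    \<open>f v\<close>, hence to itself.\<close>
  let ?w = "f v - c *\<^sub>R v"
  have "?w \<in> S" using v S inv by (simp add: subspace_diff subspace_mul)
  moreover have "v \<bullet> ?w = 0" by (simp add: inner_diff_right vv c_def inner_commute)
  ultimately have "f v \<bullet> ?w = 0" by (rule orth)
  with \<open>v \<bullet> ?w = 0\<close> have "?w \<bullet> ?w = 0" by (simp only: inner_diff_left inner_scaleR_left)
  then have "f v = c *\<^sub>R v" by simp
  with v show ?thesis by (rule that)
qed

text \<open>Split off one eigenvector and induct on the dimension: by self-adjointness its
  orthogonal complement in \<open>S\<close> is again invariant.\<close>

lemma self_adjoint_orthonormal_eigenvectors:
  fixes f :: "'a::euclidean_space \<Rightarrow> 'a"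
  assumes f: "linear f" and sa: "\<And>x y. f x \<bullet> y = x \<bullet> f y"
    and "subspace S" and "\<And>x. x \<in> S \<Longrightarrow> f x \<in> S"
  shows "\<exists>B. B \<subseteq> S \<and> span B = S \<and> pairwise orthogonal B \<and>
    (\<forall>b\<in>B. norm b = 1 \<and> (\<exists>c. f b = c *\<^sub>R b))"
  using assms(3,4)
proof (induction "dim S" arbitrary: S rule: less_induct)
  case less
  show ?case
  proof (cases "S = {0}")
    case True
    then show ?thesis by (intro exI[of _ "{}"]) auto
  next
    case False
    obtain v c where v: "v \<in> S" "norm v = 1" "f v = c *\<^sub>R v"
      using self_adjoint_eigenvector[OF f sa less.prems False] by blast
    have vv: "v \<bullet> v = 1" using v by (simp add: norm_eq_1)
    define T where "T = {x \<in> S. v \<bullet> x = 0}"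
    have T: "subspace T"
      using less.prems(1) unfolding T_def subspace_def by (auto simp: inner_add_right)
    have "T \<subset> S" using v(1) vv unfolding T_def by force
    then have "dim T < dim S"
      using T less.prems(1) by (metis dim_psubset span_eq_iff)
    moreover have "f x \<in> T" if "x \<in> T" for x
      using that less.prems(2) sa[of v x] v(3) by (simp add: T_def)
    ultimately obtain B where B: "B \<subseteq> T" "span B = T" "pairwise orthogonal B"
      "\<forall>b\<in>B. norm b = 1 \<and> (\<exists>c. f b = c *\<^sub>R b)"
      using less.hyps T by metis
    have "span (insert v B) = S"
    proof
      show "span (insert v B) \<subseteq> S"
        using B(1) v(1) less.prems(1) by (intro span_minimal) (auto simp: T_def)
      show "S \<subseteq> span (insert v B)"
      proof
        fix x assume x: "x \<in> S"
        then have "x - (v \<bullet> x) *\<^sub>R v \<in> T"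
          using v(1) vv less.prems(1)
          by (simp add: T_def subspace_diff subspace_mul inner_diff_right)
        then show "x \<in> span (insert v B)"
          using B(2) span_breakdown_eq by blast
      qed
    qed
    moreover have "pairwise orthogonal (insert v B)"
      using B(1,3) by (auto simp: pairwise_insert T_def orthogonal_def inner_commute)
    ultimately show ?thesis
      using B v by (intro exI[of _ "insert v B"]) (auto simp: T_def)
  qed
qed

section \<open>Diagonal matrices and diagonalization of symmetric matrices and of pairs\<close>

definition diag_mat :: "('m \<Rightarrow> real) \<Rightarrow> real ^ 'm ^ 'm" where
  "diag_mat d = (\<chi> i j. if i = j then d i else 0)"

lemma diag_mat_nth [simp]: "diag_mat d $ i $ j = (if i = j then d i else 0)"
  by (simp add: diag_mat_def)

lemma diag_mat_mult_vec [simp]: "(diag_mat d *v x) $ i = d i * x $ i"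
  by (simp add: matrix_vector_mult_def if_distrib [of "\<lambda>y. y * _"] cong: if_cong)

lemma diag_mat_mult_left: "(diag_mat d ** M) $ i $ j = d i * M $ i $ j"
  by (simp add: matrix_matrix_mult_def if_distrib [of "\<lambda>y. y * _"] cong: if_cong)

lemma diag_mat_mult [simp]: "diag_mat d ** diag_mat e = diag_mat (\<lambda>i. d i * e i)"
  by (simp add: vec_eq_iff diag_mat_mult_left)

lemma transpose_diag_mat [simp]: "transpose (diag_mat d) = diag_mat d"
  by (auto simp: vec_eq_iff transpose_def)

lemma det_diag_mat [simp]: "det (diag_mat d) = (\<Prod>i\<in>UNIV. d i)"
  by (subst det_diagonal) auto

lemma diag_mat_1: "diag_mat (\<lambda>_. 1) = mat 1"
  by (simp add: vec_eq_iff mat_def)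

text \<open>The orthonormal eigenvectors are placed in the rows of Q, which is why the transpose
  stands on the left.\<close>

lemma symmetric_matrix_diagonalization:
  fixes M :: "real ^ 'm ^ 'm"
  assumes "transpose M = M"
  obtains Q :: "real ^ 'm ^ 'm" and d where "orthogonal_matrix Q" "M = transpose Q ** diag_mat d ** Q"
proof -
  have sa: "(M *v x) \<bullet> y = x \<bullet> (M *v y)" for x y
    by (metis assms dot_lmul_matrix inner_commute transpose_matrix_vector)
  obtain B where B: "span B = (UNIV :: (real ^ 'm) set)" "pairwise orthogonal B"
    "\<And>b. b \<in> B \<Longrightarrow> norm b = 1" "\<And>b. b \<in> B \<Longrightarrow> \<exists>c. M *v b = c *\<^sub>R b"
    using self_adjoint_orthonormal_eigenvectors[of "(*v) M" UNIV] sa by auto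
  have "0 \<notin> B" using B(3) by force
  with B(2) have indep: "independent B" by (rule pairwise_orthogonal_independent)
  then have fin: "finite B" by (rule independent_imp_finite)
  have "card B = CARD('m)"
    using indep B(1) by (metis dim_span dim_UNIV dim_eq_card_independent DIM_cart DIM_real mult.right_neutral)
  then obtain b where b: "bij_betw b (UNIV :: 'm set) B"
    using finite_same_card_bij[of "UNIV :: 'm set" B] fin by auto
  have bB: "b i \<in> B" for i using b by (auto simp: bij_betw_def)
  obtain d where d: "\<And>i. M *v b i = d i *\<^sub>R b i"
    using B(4)[OF bB] by metis
  define Q :: "real ^ 'm ^ 'm" where "Q = (\<chi> i. b i)"
  have orth: "orthogonal_matrix Q"
  proof -
    have "row i Q = b i" for i by (simp add: Q_def row_def vec_eq_iff)
    moreover have "orthogonal (b i) (b j)" if "i \<noteq> j" for i j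
      using B(2) bB b that unfolding pairwise_def bij_betw_def by (metis UNIV_I inj_on_eq_iff)
    ultimately show ?thesis
      unfolding orthogonal_matrix_orthonormal_rows using B(3) bB by auto
  qed
  have "Q ** transpose M = diag_mat d ** Q"
  proof -
    have "(Q ** transpose M) $ i $ j = (M *v b i) $ j" for i j
      by (simp add: matrix_matrix_mult_def matrix_vector_mult_def Q_def transpose_def mult.commute)
    then show ?thesis
      by (simp add: vec_eq_iff diag_mat_mult_left d Q_def)
  qed
  with assms orth have "M = transpose Q ** diag_mat d ** Q"
    by (metis matrix_mul_assoc matrix_mul_lid orthogonal_matrix)
  with orth show ?thesis by (rule that)
qed

text \<open>The eigenvalues are positive, as testing the form at the eigenvectors shows, so their
  square roots can be absorbed into the orthogonal factor.\<close>

lemma posdef_factorization: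
  fixes A :: "real ^ 'm ^ 'm"
  assumes "posdef A"
  obtains L :: "real ^ 'm ^ 'm" where "invertible L" "A = transpose L ** L"
proof -
  have sym: "transpose A = A" and pos: "\<And>x. x \<noteq> 0 \<Longrightarrow> (A *v x) \<bullet> x > 0"
    using assms by (auto simp: posdef_def)
  obtain Q d where Q: "orthogonal_matrix Q" and A: "A = transpose Q ** diag_mat d ** Q"
    using symmetric_matrix_diagonalization[OF sym] by blast
  have d: "d i > 0" for i
  proof -
    let ?v = "transpose Q *v axis i 1"
    have Qv: "Q *v ?v = axis i 1"
      using Q by (simp add: matrix_vector_mul_assoc orthogonal_matrix_def del: transpose_matrix_vector)
    then have "?v \<noteq> 0" by (metis axis_eq_0_iff matrix_vector_mult_0_right zero_neq_one)
    from pos[OF this] have "0 < (diag_mat d *v (Q *v ?v)) \<bullet> (Q *v ?v)"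
      unfolding A by (metis dot_lmul_matrix matrix_vector_mul_assoc transpose_matrix_vector)
    also have "\<dots> = d i"
      unfolding Qv by (simp add: inner_axis)
    finally show ?thesis .
  qed
  define L where "L = diag_mat (\<lambda>i. sqrt (d i)) ** Q"
  have "A = transpose L ** L"
  proof -
    have "transpose L ** L =
        transpose Q ** (diag_mat (\<lambda>i. sqrt (d i)) ** diag_mat (\<lambda>i. sqrt (d i))) ** Q"
      unfolding L_def by (simp only: matrix_transpose_mul transpose_diag_mat matrix_mul_assoc)
    also have "\<dots> = A" using d by (simp add: A less_imp_le)
    finally show ?thesis by simp
  qed
  moreover have "invertible L"
  proof -
    have "sqrt (d i) \<noteq> 0" for i using d[of i] by simp
    then have "det L \<noteq> 0"
      using Q by (auto simp: L_def det_mul simp del: real_sqrt_eq_0_iff dest!: det_orthogonal_matrix)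
    then show ?thesis by (simp add: invertible_det_nz)
  qed
  ultimately show ?thesis using that by blast
qed

lemma matrix_inv_mult_cancel:
  fixes V :: "real ^ 'm ^ 'm"
  assumes "invertible V"
  shows "V ** matrix_inv V = mat 1" "matrix_inv V ** V = mat 1"
    "V *v (matrix_inv V *v x) = x" "matrix_inv V *v (V *v x) = x"
    "V ** (matrix_inv V ** M) = M" "matrix_inv V ** (V ** M) = M"
proof -
  show 1: "V ** matrix_inv V = mat 1" and 2: "matrix_inv V ** V = mat 1"
    using assms unfolding invertible_def matrix_inv_def by (metis (mono_tags, lifting) someI_ex)+
  show "V *v (matrix_inv V *v x) = x" "matrix_inv V *v (V *v x) = x"
    "V ** (matrix_inv V ** M) = M" "matrix_inv V ** (V ** M) = M"
    by (simp_all add: matrix_vector_mul_assoc matrix_mul_assoc 1 2)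
qed

lemma matrix_inv_unique:
  fixes V W :: "real ^ 'm ^ 'm"
  assumes "V ** W = mat 1"
  shows "matrix_inv V = W"
proof -
  have "invertible V"
    using assms by (auto simp: invertible_right_inverse)
  then show ?thesis
    by (metis assms matrix_inv_mult_cancel(6) matrix_mul_rid)
qed

lemma matrix_inv_matrix_inv:
  fixes M :: "real ^ 'm ^ 'm"
  assumes "invertible M"
  shows "matrix_inv (matrix_inv M) = M"
  using assms by (intro matrix_inv_unique) (simp add: matrix_inv_mult_cancel)

lemma transpose_matrix_inv:
  fixes V :: "real ^ 'm ^ 'm"
  assumes "invertible V"
  shows "matrix_inv (transpose V) = transpose (matrix_inv V)"
  by (rule matrix_inv_unique)
     (metis assms matrix_inv_mult_cancel(2) matrix_transpose_mul transpose_mat)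

text \<open>With A = L^T L, the congruence by L^{-1} turns A into the identity and C into a
  symmetric M. An orthogonal Q that diagonalizes M keeps the identity fixed, so V = Q L serves both
  matrices.\<close>

lemma simultaneous_diagonalization:
  fixes A C :: "real ^ 'm ^ 'm"
  assumes "posdef A" "transpose C = C"
  obtains V :: "real ^ 'm ^ 'm" and d where "invertible V" "A = transpose V ** V" "C = transpose V ** diag_mat d ** V"
proof -
  obtain L :: "real ^ 'm ^ 'm" where L: "invertible L" "A = transpose L ** L"
    using posdef_factorization[OF assms(1)] by blast
  define Li where "Li = matrix_inv L"
  have LLi: "Li ** L = mat 1" unfolding Li_def using L(1) by (simp add: matrix_inv_mult_cancel)
  define M where "M = transpose Li ** C ** Li"
  have "transpose M = M"
    by (simp add: M_def matrix_transpose_mul assms(2) matrix_mul_assoc)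
  then obtain Q d where Q: "orthogonal_matrix Q" and M: "M = transpose Q ** diag_mat d ** Q"
    using symmetric_matrix_diagonalization by blast
  have QQ: "transpose Q ** Q = mat 1" using Q by (simp add: orthogonal_matrix)
  define V where "V = Q ** L"
  have "transpose V ** V = transpose L ** (transpose Q ** Q) ** L"
    unfolding V_def by (simp only: matrix_transpose_mul matrix_mul_assoc)
  then have A: "A = transpose V ** V" by (simp add: QQ L(2))
  have "transpose V ** diag_mat d ** V = transpose L ** M ** L"
    unfolding V_def M by (simp only: matrix_transpose_mul matrix_mul_assoc)
  also have "\<dots> = (transpose L ** transpose Li) ** C ** (Li ** L)"
    unfolding M_def by (simp only: matrix_mul_assoc)
  also have "\<dots> = C"
    by (simp add: LLi flip: matrix_transpose_mul)
  finally have C: "C = transpose V ** diag_mat d ** V" by simp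
  have "det V \<noteq> 0"
    using L(1) Q by (auto simp: V_def det_mul invertible_det_nz dest!: det_orthogonal_matrix)
  then have "invertible V" by (simp add: invertible_det_nz)
  with A C show ?thesis by (intro that)
qed

section \<open>Substitution and Gaussian integrals\<close>

lemma borel_measurable_matrix_vector_mult [measurable]:
  "(*v) (V :: real ^ 'm ^ 'k) \<in> borel \<rightarrow>\<^sub>M borel"
  by (intro borel_measurable_continuous_onI linear_continuous_on matrix_vector_mul_bounded_linear)

text \<open>Tonelli with the coordinate along \<open>b\<close> innermost, as a shear along
  \<open>b\<close> requires.\<close>

lemma nn_integral_lborel_split_direction:
  fixes f :: "'a::euclidean_space \<Rightarrow> ennreal"
  assumes b: "b \<in> Basis" and [measurable]: "f \<in> borel_measurable borel"
  shows "(\<integral>\<^sup>+x. f x \<partial>lborel) =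
    (\<integral>\<^sup>+g. (\<integral>\<^sup>+y. f ((\<Sum>d\<in>Basis - {b}. g d *\<^sub>R d) + y *\<^sub>R b) \<partial>lborel) \<partial>(\<Pi>\<^sub>M d\<in>Basis - {b}. lborel))"
proof -
  interpret product_sigma_finite "\<lambda>_::'a. lborel :: real measure" ..
  have ins: "insert b (Basis - {b}) = Basis" using b by auto
  have eq: "(\<Sum>d\<in>Basis. (g(b := y)) d *\<^sub>R d) = (\<Sum>d\<in>Basis - {b}. g d *\<^sub>R d) + y *\<^sub>R b"
    for g :: "'a \<Rightarrow> real" and y
    by (subst sum.remove[OF _ b]) (simp_all add: add.commute cong: sum.cong_simp)
  have "(\<integral>\<^sup>+x. f x \<partial>lborel) =
      (\<integral>\<^sup>+g. f (\<Sum>d\<in>Basis. g d *\<^sub>R d) \<partial>(\<Pi>\<^sub>M d\<in>insert b (Basis - {b}). lborel))"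
    unfolding ins by (subst lborel_eq) (simp add: nn_integral_distr)
  also have "\<dots> = (\<integral>\<^sup>+g. (\<integral>\<^sup>+y. f (\<Sum>d\<in>Basis. (g(b := y)) d *\<^sub>R d) \<partial>lborel)
      \<partial>(\<Pi>\<^sub>M d\<in>Basis - {b}. lborel))"
    by (rule product_nn_integral_insert) (auto simp: ins)
  finally show ?thesis unfolding eq .
qed

text \<open>On each line parallel to \<open>b\<close> the function \<open>h\<close> is constant, so
  the map is a translation there, and one-dimensional Lebesgue measure is translation
  invariant.\<close>

lemma lborel_shear:
  fixes h :: "'a::euclidean_space \<Rightarrow> real"
  assumes b: "b \<in> Basis" and [measurable]: "h \<in> borel_measurable borel"
    and h: "\<And>x t. h (x + t *\<^sub>R b) = h x"
  shows "distr lborel borel (\<lambda>x. x + h x *\<^sub>R b) = lborel"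
proof (rule measure_eqI)
  fix A assume "A \<in> sets (distr lborel borel (\<lambda>x. x + h x *\<^sub>R b))"
  then have [measurable]: "A \<in> sets borel" by simp
  have eq: "(\<integral>\<^sup>+y. indicator A (z + y *\<^sub>R b + h (z + y *\<^sub>R b) *\<^sub>R b) \<partial>lborel) =
      (\<integral>\<^sup>+y. indicator A (z + y *\<^sub>R b) \<partial>lborel)" for z
    by (subst (2) nn_integral_real_affine[where c = 1 and t = "h z"])
       (auto simp: h scaleR_add_left add_ac)
  have "emeasure (distr lborel borel (\<lambda>x. x + h x *\<^sub>R b)) A =
      (\<integral>\<^sup>+x. indicator A (x + h x *\<^sub>R b) \<partial>lborel)"
    by (simp add: nn_integral_distr flip: nn_integral_indicator)
  also have "\<dots> = (\<integral>\<^sup>+x. indicator A x \<partial>lborel)"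
    by (subst (1 2) nn_integral_lborel_split_direction[OF b]) (simp_all add: eq)
  finally show "emeasure (distr lborel borel (\<lambda>x. x + h x *\<^sub>R b)) A = emeasure lborel A"
    by simp
qed simp

text \<open>The library has this fact only for well-ordered index types.\<close>

lemma lborel_matrix_distr:
  fixes V :: "real ^ 'm ^ 'm"
  assumes "invertible V"
  shows "lborel = density (distr lborel borel ((*v) V)) (\<lambda>_. ennreal \<bar>det V\<bar>)"
proof -
  \<comment> \<open>In this form the claim is multiplicative in V, so it suffices to check
    elementary matrices.\<close>
  define Q where "Q V \<longleftrightarrow> lborel = density (distr lborel borel ((*v) V)) (\<lambda>_. ennreal \<bar>det V\<bar>)"
    for V :: "real ^ 'm ^ 'm"
  have "invertible V \<longrightarrow> Q V"
  proof (induction V rule: induct_matrix_elementary)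
    case (1 A B)
    show ?case
    proof
      assume "invertible (A ** B)"
      then have "Q A" "Q B" using 1 by (auto simp: invertible_det_nz det_mul)
      have "lborel = density (distr (density (distr lborel borel ((*v) B))
          (\<lambda>_. ennreal \<bar>det B\<bar>)) borel ((*v) A)) (\<lambda>_. ennreal \<bar>det A\<bar>)"
        using \<open>Q A\<close> \<open>Q B\<close> unfolding Q_def by metis
      also have "\<dots> = density (distr lborel borel ((*v) (A ** B))) (\<lambda>_. ennreal \<bar>det (A ** B)\<bar>)"
      proof (rule measure_eqI, simp)
        fix X assume "X \<in> sets (density (distr (density (distr lborel borel ((*v) B))
          (\<lambda>_. ennreal \<bar>det B\<bar>)) borel ((*v) A)) (\<lambda>_. ennreal \<bar>det A\<bar>))"
        then have [measurable]: "X \<in> sets borel" by simp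
        have [measurable]: "(*v) A -` X \<in> sets borel"
          by (rule measurable_sets_borel[OF borel_measurable_matrix_vector_mult]) simp
        show "emeasure (density (distr (density (distr lborel borel ((*v) B))
            (\<lambda>_. ennreal \<bar>det B\<bar>)) borel ((*v) A)) (\<lambda>_. ennreal \<bar>det A\<bar>)) X =
          emeasure (density (distr lborel borel ((*v) (A ** B))) (\<lambda>_. ennreal \<bar>det (A ** B)\<bar>)) X"
          by (simp add: emeasure_density_const emeasure_distr det_mul abs_mult ennreal_mult
            mult.assoc vimage_comp matrix_vector_mult_matrix_matrix_mult_compose)
      qed
      finally show "Q (A ** B)" by (simp add: Q_def)
    qed
  next
    case (2 A i)
    then show ?case by (metis det_zero_row(2) invertible_det_nz)
  next
    case (3 A)
    show ?case
    proof
      assume "invertible A"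
      moreover have detA: "det A = (\<Prod>i\<in>UNIV. A $ i $ i)" using 3 by (rule det_diagonal)
      ultimately have nz: "A $ i $ i \<noteq> 0" for i by (simp add: invertible_det_nz)
      define ax :: "'m \<Rightarrow> real ^ 'm" where "ax i = axis i 1" for i
      have inj: "inj ax" by (auto simp: ax_def inj_def axis_eq_axis)
      have Basis: "Basis = range ax" by (auto simp: Basis_vec_def ax_def)
      define c where "c b = A $ inv ax b $ inv ax b" for b
      have cax: "c (ax i) = A $ i $ i" for i by (simp add: c_def inj)
      have "A *v x = 0 + (\<Sum>j\<in>Basis. (c j * (x \<bullet> j)) *\<^sub>R j)" for x
      proof -
        have "(A *v x) $ i = A $ i $ i * x $ i" for i
          using 3 by (simp add: matrix_vector_mult_def sum.remove[of UNIV i])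
        moreover have inner: "x \<bullet> ax i = x $ i" for i by (simp add: ax_def inner_axis)
        moreover have nth: "ax i $ j = (if j = i then 1 else 0)" for i j
          by (simp add: ax_def axis_def)
        ultimately show ?thesis
          unfolding Basis
          by (simp add: sum.reindex[OF inj] vec_eq_iff cax inner nth if_distrib cong: if_cong)
      qed
      then have mult: "(*v) A = (\<lambda>x. 0 + (\<Sum>j\<in>Basis. (c j * (x \<bullet> j)) *\<^sub>R j))"
        by (rule ext)
      have det: "\<bar>det A\<bar> = (\<Prod>j\<in>Basis. \<bar>c j\<bar>)"
        unfolding Basis by (simp add: prod.reindex[OF inj] cax detA abs_prod)
      show "Q A"
        unfolding Q_def mult det
        by (rule lborel_affine_euclidean) (use nz in \<open>auto simp: Basis cax\<close>)
    qed
  next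
    \<comment> \<open>A swap of two coordinates maps boxes to boxes with the same side lengths, and
      Lebesgue measure is determined by its values on boxes.\<close>
    case (4 m n)
    let ?s = "Transposition.transpose m n"
    let ?A = "(\<chi> i j. mat 1 $ i $ ?s j) :: real ^ 'm ^ 'm"
    have mult: "?A *v x = (\<chi> i. x $ ?s i)" for x
    proof -
      have "(?A *v x) $ i = (\<Sum>j\<in>UNIV. (mat 1 :: real ^ 'm ^ 'm) $ i $ j * x $ ?s j)" for i
        unfolding matrix_vector_mult_def
        by (simp, subst sum.permute[OF permutes_swap_id[of m UNIV n]]) (simp_all add: o_def)
      also have "(\<Sum>j\<in>UNIV. (mat 1 :: real ^ 'm ^ 'm) $ i $ j * x $ ?s j) = x $ ?s i" for i
        by (simp add: mat_def if_distrib[of "\<lambda>y. y * _"] cong: if_cong)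
      finally show ?thesis by (simp add: vec_eq_iff)
    qed
    have "\<bar>det ?A\<bar> = 1"
      by (simp add: det_permute_columns permutes_swap_id sign_swap_id)
    moreover have "lborel = distr lborel borel ((*v) ?A)"
    proof (rule lborel_eqI)
      fix l u :: "real ^ 'm" assume le: "\<And>b. b \<in> Basis \<Longrightarrow> l \<bullet> b \<le> u \<bullet> b"
      have "(*v) ?A -` box l u = box (?A *v l) (?A *v u)"
        by (auto simp: mult mem_box_cart) (metis transpose_involutory)+
      moreover have "l $ i \<le> u $ i" for i
        using le[of "axis i 1"] by (auto simp: Basis_vec_def inner_axis)
      then have "\<And>b. b \<in> Basis \<Longrightarrow> (?A *v l) \<bullet> b \<le> (?A *v u) \<bullet> b"
        by (auto simp: mult Basis_vec_def inner_axis)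
      moreover have "(\<Prod>b\<in>Basis. (?A *v u - ?A *v l) \<bullet> b) = (\<Prod>b\<in>Basis. (u - l) \<bullet> b)"
      proof -
        have Basis: "Basis = range (\<lambda>i::'m. axis i (1::real))" by (auto simp: Basis_vec_def)
        have "inj (\<lambda>i::'m. axis i (1::real))" by (auto simp: inj_def axis_eq_axis)
        then have *: "(\<Prod>b\<in>Basis. x \<bullet> b) = (\<Prod>i\<in>UNIV. x $ i)" for x :: "real ^ 'm"
          unfolding Basis by (simp add: prod.reindex inner_axis)
        show ?thesis
          unfolding * by (subst (2) prod.permute[OF permutes_swap_id[of m UNIV n]])
            (simp_all add: mult o_def)
      qed
      ultimately show "emeasure (distr lborel borel ((*v) ?A)) (box l u) = (\<Prod>b\<in>Basis. (u - l) \<bullet> b)"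
        by (simp add: emeasure_distr emeasure_lborel_box)
    qed simp
    ultimately show ?case by (simp add: Q_def density_1)
  next
    \<comment> \<open>The matrix adds c x_n to coordinate m: a shear along axis m whose offset does
      not depend on that coordinate.\<close>
    case (5 m n c)
    let ?A = "(\<chi> i j. if i = m \<and> j = n then c else of_bool (i = j)) :: real ^ 'm ^ 'm"
    have "?A = (\<chi> k. if k = m then row m (mat 1) + c *s row n (mat 1) else row k (mat 1))"
      using 5 by (auto simp: vec_eq_iff row_def mat_def)
    then have "det ?A = 1" using det_row_operation[OF 5, of "mat 1" c] by simp
    moreover have "(?A *v x) = x + (c * x $ n) *\<^sub>R axis m 1" for x
    proof -
      have "(?A *v x) $ i = (\<Sum>j\<in>UNIV. (if j = i then x $ j else 0) +
          (if j = n then if i = m then c * x $ j else 0 else 0))" for i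
        using 5 unfolding matrix_vector_mult_def by (auto intro!: sum.cong)
      then show ?thesis by (simp add: vec_eq_iff sum.distrib axis_def)
    qed
    then have "(*v) ?A = (\<lambda>x. x + (c * x $ n) *\<^sub>R axis m 1)" by (rule ext)
    moreover have "distr lborel borel (\<lambda>x. x + (c * x $ n) *\<^sub>R axis m 1) = lborel"
      using 5 by (intro lborel_shear) (auto simp: Basis_vec_def axis_def)
    ultimately show ?case by (simp add: Q_def density_1)
  qed
  with assms show ?thesis by (simp add: Q_def)
qed

lemma has_bochner_integral_scaled_distr:
  fixes f :: "'a::euclidean_space \<Rightarrow> 'b::{banach, second_countable_topology}"
  assumes [measurable]: "T \<in> borel \<rightarrow>\<^sub>M borel" "f \<in> borel_measurable borel"
    and c: "c > 0"
    and f: "has_bochner_integral (density (distr lborel borel T) (\<lambda>_. ennreal c)) f I"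
  shows "has_bochner_integral lborel (\<lambda>x. f (T x)) (I /\<^sub>R c)"
proof -
  have "has_bochner_integral lborel (\<lambda>x. c *\<^sub>R f (T x)) I"
    using f c by (simp add: has_bochner_integral_iff integrable_density integral_density
        integrable_distr_eq integral_distr)
  from has_bochner_integral_scaleR_right[OF this, of "inverse c"] c
  show ?thesis by simp
qed

lemma has_bochner_integral_matrix_substitution:
  fixes f :: "real ^ 'm \<Rightarrow> 'b::{banach, second_countable_topology}"
  assumes V: "invertible V" and f: "has_bochner_integral lborel f I"
  shows "has_bochner_integral lborel (\<lambda>x. f (V *v x)) (I /\<^sub>R \<bar>det V\<bar>)"
proof -
  have [measurable]: "(*v) V \<in> borel \<rightarrow>\<^sub>M borel"
    by (intro borel_measurable_continuous_onI linear_continuous_on matrix_vector_mul_bounded_linear)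
  have [measurable]: "f \<in> borel_measurable borel"
    using borel_measurable_has_bochner_integral[OF f] by simp
  show ?thesis
    using V f by (intro has_bochner_integral_scaled_distr)
      (simp_all add: invertible_det_nz flip: lborel_matrix_distr[OF V])
qed

lemma has_bochner_integral_affine_substitution:
  fixes f :: "'a::euclidean_space \<Rightarrow> 'b::{banach, second_countable_topology}"
  assumes c: "c \<noteq> 0" and f: "has_bochner_integral lborel f I"
  shows "has_bochner_integral lborel (\<lambda>x. f (t + c *\<^sub>R x)) (I /\<^sub>R (\<bar>c\<bar> ^ DIM('a)))"
proof -
  have [measurable]: "f \<in> borel_measurable borel"
    using borel_measurable_has_bochner_integral[OF f] by simp
  show ?thesis
    using c f lborel_affine[OF c, of t] by (intro has_bochner_integral_scaled_distr) simp_all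
qed

lemma nn_integral_affine_substitution:
  fixes f :: "'a::euclidean_space \<Rightarrow> ennreal"
  assumes c: "c \<noteq> 0" and [measurable]: "f \<in> borel_measurable borel"
  shows "(\<integral>\<^sup>+x. f x \<partial>lborel) = ennreal (\<bar>c\<bar> ^ DIM('a)) * (\<integral>\<^sup>+x. f (t + c *\<^sub>R x) \<partial>lborel)"
proof -
  have "(\<integral>\<^sup>+x. f x \<partial>lborel) =
      (\<integral>\<^sup>+x. f x \<partial>density (distr lborel borel (\<lambda>x. t + c *\<^sub>R x)) (\<lambda>_. ennreal (\<bar>c\<bar> ^ DIM('a))))"
    using lborel_affine[OF c, of t] by simp
  also have "\<dots> = ennreal (\<bar>c\<bar> ^ DIM('a)) * (\<integral>\<^sup>+x. f (t + c *\<^sub>R x) \<partial>lborel)"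
    by (simp add: nn_integral_density nn_integral_distr nn_integral_cmult)
  finally show ?thesis .
qed

text \<open>Lebesgue measure is the product measure over \<open>Basis\<close>, and \<open>ax\<close>
  carries the index type bijectively onto it, so Fubini for product integrands applies.\<close>

lemma has_bochner_integral_vec_prod:
  fixes f :: "'m::finite \<Rightarrow> real \<Rightarrow> 'b::{real_normed_field, banach, second_countable_topology}"
  assumes f: "\<And>i. has_bochner_integral lborel (f i) (I i)"
  shows "has_bochner_integral lborel (\<lambda>x::real ^ 'm. \<Prod>i\<in>UNIV. f i (x $ i)) (\<Prod>i\<in>UNIV. I i)"
proof -
  interpret product_sigma_finite "\<lambda>_::real ^ 'm. lborel :: real measure" ..
  define ax :: "'m \<Rightarrow> real ^ 'm" where "ax i = axis i 1" for i
  have inj: "inj ax" by (auto simp: ax_def inj_def axis_eq_axis)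
  have Basis: "Basis = range ax" by (auto simp: Basis_vec_def ax_def)
  define F where "F b = f (inv ax b)" for b
  have [measurable]: "f i \<in> borel_measurable borel" for i
    using borel_measurable_has_bochner_integral[OF f] by simp
  have F: "integrable lborel (F b)" for b
    using f by (auto simp: F_def has_bochner_integral_iff)
  have comp: "(\<Sum>b\<in>Basis. g b *\<^sub>R b) $ i = g (ax i)" for g :: "real ^ 'm \<Rightarrow> real" and i
    unfolding Basis by (subst sum.reindex[OF inj])
      (simp add: ax_def axis_def if_distrib cong: if_cong)
  have prod: "(\<Prod>i\<in>UNIV. f i (g (ax i))) = (\<Prod>b\<in>Basis. F b (g b))" for g :: "real ^ 'm \<Rightarrow> real"
    unfolding Basis by (subst prod.reindex[OF inj]) (simp add: F_def inj)
  have "integrable (\<Pi>\<^sub>M b\<in>Basis. lborel) (\<lambda>g. \<Prod>b\<in>Basis. F b (g b))"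
    by (rule product_integrable_prod) (auto simp: F)
  moreover have "integral\<^sup>L (\<Pi>\<^sub>M b\<in>Basis. lborel) (\<lambda>g. \<Prod>b\<in>Basis. F b (g b)) = (\<Prod>i\<in>UNIV. I i)"
    using f by (subst product_integral_prod)
      (auto simp: F Basis prod.reindex[OF inj] F_def inj has_bochner_integral_iff)
  ultimately show ?thesis
    unfolding has_bochner_integral_iff by (subst (1 2) lborel_eq)
      (simp add: integrable_distr_eq integral_distr comp prod del: sum_component)
qed

section \<open>Gaussian integrals: Fourier transforms and moments\<close>

lemma has_bochner_integral_exp_fourier:
  "has_bochner_integral lborel (\<lambda>x. complex_of_real (exp (- (x\<^sup>2 / 2))) * exp (\<i> * of_real (t * x)))
     (of_real (sqrt (2 * pi) * exp (- (t\<^sup>2 / 2))))"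
proof -
  have "has_bochner_integral std_normal_distribution (\<lambda>x. exp (\<i> * of_real (t * x)))
      (of_real (exp (- (t\<^sup>2) / 2)))"
    using fun_cong[OF char_std_normal_distribution, of t]
      prob_space.integrable_iexp[of std_normal_distribution "\<lambda>x. of_real (t * x)"]
      prob_space_normal_density[of 1 0]
    by (simp add: has_bochner_integral_iff char_def)
  then have "has_bochner_integral lborel
      (\<lambda>x. std_normal_density x *\<^sub>R exp (\<i> * of_real (t * x))) (of_real (exp (- (t\<^sup>2) / 2)))"
    by (simp add: has_bochner_integral_iff integrable_density integral_density)
  from has_bochner_integral_mult_right[OF this, of "of_real (sqrt (2 * pi))"]
  show ?thesis by (simp add: std_normal_density_def scaleR_conv_of_real)
qed

lemma has_bochner_integral_exp_moment:
  "has_bochner_integral lborel (\<lambda>x. exp (- (x\<^sup>2 / 2))) (sqrt (2 * pi))"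
  "has_bochner_integral lborel (\<lambda>x::real. x * exp (- (x\<^sup>2 / 2))) 0"
  "has_bochner_integral lborel (\<lambda>x. x\<^sup>2 * exp (- (x\<^sup>2 / 2))) (sqrt (2 * pi))"
  using has_bochner_integral_mult_right[OF std_normal_moment_even[of 0], of "sqrt (2 * pi)"]
    has_bochner_integral_mult_right[OF std_normal_moment_odd[of 0], of "sqrt (2 * pi)"]
    has_bochner_integral_mult_right[OF std_normal_moment_even[of 1], of "sqrt (2 * pi)"]
  by (simp_all add: std_normal_density_def mult.commute fact_numeral)

lemma inner_vec_eq_sum_power2: "x \<bullet> x = (\<Sum>i\<in>UNIV. (x $ i)\<^sup>2)" for x :: "real ^ 'm"
  by (simp add: inner_vec_def power2_eq_square)

lemma norm_power2_vec: "(norm x)\<^sup>2 = (\<Sum>i\<in>UNIV. (x $ i)\<^sup>2)" for x :: "real ^ 'm"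
  by (simp add: power2_norm_eq_inner inner_vec_eq_sum_power2)

lemma exp_inner_eq_prod: "exp (- ((x \<bullet> x) / 2)) = (\<Prod>i\<in>UNIV. exp (- ((x $ i)\<^sup>2 / 2)))"
  for x :: "real ^ 'm"
  by (simp add: inner_vec_eq_sum_power2 exp_sum sum_divide_distrib sum_negf flip: exp_sum)

lemma has_bochner_integral_gaussian_fourier:
  fixes q :: "real ^ 'm"
  shows "has_bochner_integral lborel
    (\<lambda>y. complex_of_real (exp (- ((y \<bullet> y) / 2))) * exp (\<i> * of_real (q \<bullet> y)))
    (of_real (sqrt (2 * pi) ^ CARD('m) * exp (- ((q \<bullet> q) / 2))))"
proof -
  have "exp (\<i> * of_real (q \<bullet> y)) = (\<Prod>i\<in>UNIV. exp (\<i> * of_real (q $ i * y $ i)))" for y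
    by (simp add: inner_vec_def sum_distrib_left flip: exp_sum)
  then show ?thesis
    using has_bochner_integral_vec_prod[OF has_bochner_integral_exp_fourier, of "\<lambda>i. q $ i"]
    by (simp add: exp_inner_eq_prod prod.distrib)
qed

lemma has_bochner_integral_gaussian_fourier_linear:
  fixes q :: "real ^ 'm" and L :: "real ^ 'm ^ 'm"
  assumes "invertible L"
  shows "has_bochner_integral lborel
    (\<lambda>y. complex_of_real (exp (- (((L *v y) \<bullet> (L *v y)) / 2))) * exp (\<i> * of_real (q \<bullet> (L *v y))))
    (of_real (sqrt (2 * pi) ^ CARD('m) / \<bar>det L\<bar> * exp (- ((q \<bullet> q) / 2))))"
  using has_bochner_integral_matrix_substitution[OF assms has_bochner_integral_gaussian_fourier[of q]]
  by (simp add: scaleR_conv_of_real divide_simps)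

lemma has_bochner_integral_gaussian_linear:
  fixes L :: "real ^ 'm ^ 'm"
  assumes "invertible L"
  shows "has_bochner_integral lborel (\<lambda>y. exp (- (((L *v y) \<bullet> (L *v y)) / 2)))
    (sqrt (2 * pi) ^ CARD('m) / \<bar>det L\<bar>)"
  using has_bochner_integral_Re[OF has_bochner_integral_gaussian_fourier_linear[OF assms, of 0]]
  by simp

lemma has_bochner_integral_gaussian_moment1:
  "has_bochner_integral lborel (\<lambda>x::real ^ 'm. x $ k * exp (- ((x \<bullet> x) / 2))) 0"
proof -
  have "has_bochner_integral lborel
      (\<lambda>x::real ^ 'm. \<Prod>i\<in>UNIV. (if i = k then x $ i else 1) * exp (- ((x $ i)\<^sup>2 / 2)))
      (\<Prod>i\<in>UNIV. if i = k then 0 else sqrt (2 * pi))"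
    by (rule has_bochner_integral_vec_prod[where f = "\<lambda>i x. (if i = k then x else 1) * exp (- (x\<^sup>2 / 2))"])
       (auto simp: has_bochner_integral_exp_moment[simplified])
  then show ?thesis
    by (simp add: exp_inner_eq_prod prod.distrib prod.delta prod_zero[of UNIV])
qed

lemma has_bochner_integral_gaussian_moment2:
  "has_bochner_integral lborel (\<lambda>x::real ^ 'm. x $ k * x $ l * exp (- ((x \<bullet> x) / 2)))
    (if k = l then sqrt (2 * pi) ^ CARD('m) else 0)"
proof -
  let ?g = "\<lambda>i x. (if i = k then x else 1) * (if i = l then x else 1) * exp (- (x\<^sup>2 / 2)) :: real"
  \<comment> \<open>For k \<noteq> l the factors at k and at l are first moments and vanish; for k =
    l the second moment equals the total mass sqrt (2 * pi), as the variance is one.\<close>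
  let ?J = "\<lambda>i. if k \<noteq> l \<and> (i = k \<or> i = l) then 0 else sqrt (2 * pi)"
  have "has_bochner_integral lborel (\<lambda>x::real ^ 'm. \<Prod>i\<in>UNIV. ?g i (x $ i)) (\<Prod>i\<in>UNIV. ?J i)"
  proof (rule has_bochner_integral_vec_prod)
    show "has_bochner_integral lborel (?g i) (?J i)" for i
      using has_bochner_integral_exp_moment
      by (cases "i = k"; cases "i = l") (auto simp: power2_eq_square mult.assoc)
  qed
  moreover have "(\<Prod>i\<in>UNIV. ?J i) = (if k = l then sqrt (2 * pi) ^ CARD('m) else 0)"
    by (cases "k = l") (auto intro!: prod_zero)
  ultimately show ?thesis
    by (simp add: exp_inner_eq_prod prod.distrib prod.delta)
qed

section \<open>Square roots, covariance ellipsoids and block matrices\<close>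

text \<open>Take an eigenvector of \<open>R\<close> with eigenvalue d and expand it in an eigenbasis
  of \<open>S\<close>. Each eigenvalue of \<open>S\<close> that occurs has square d^2, and both are
  nonnegative, so it equals d. Hence \<open>S\<close> agrees with \<open>R\<close> on an eigenbasis
  of \<open>R\<close>.\<close>

lemma diagonalizable_square_unique:
  fixes R S :: "real ^ 'm ^ 'm"
  assumes "diagonalizable R" "\<And>c. is_eigenvalue R c \<Longrightarrow> c \<ge> 0"
    and "diagonalizable S" "\<And>c. is_eigenvalue S c \<Longrightarrow> c \<ge> 0"
    and eq: "R ** R = S ** S"
  shows "R = S"
proof -
  have eigenvector: "M *v (Q *v axis j 1) = (D $ j $ j) *s (Q *v axis j 1)"
    if "M = Q ** D ** matrix_inv Q" "invertible Q" "\<And>i j. i \<noteq> j \<Longrightarrow> D $ i $ j = 0"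
    for M Q D :: "real ^ 'm ^ 'm" and j
  proof -
    have "D *v axis j 1 = (D $ j $ j) *s axis j 1"
      using that(3) unfolding matrix_vector_mult_basis by (auto simp: vec_eq_iff column_def axis_def)
    then show ?thesis
      using that(1,2)
      by (simp add: matrix_vector_mul_assoc[symmetric] matrix_inv_mult_cancel vector_scalar_commute)
  qed
  have eigenvalue_nonneg: "D $ j $ j \<ge> 0"
    if "M = Q ** D ** matrix_inv Q" "invertible Q" "\<And>i j. i \<noteq> j \<Longrightarrow> D $ i $ j = 0"
      "\<And>c. is_eigenvalue M c \<Longrightarrow> c \<ge> 0"
    for M Q D :: "real ^ 'm ^ 'm" and j
  proof -
    have "Q *v axis j 1 \<noteq> 0"
      using that(2) by (metis axis_eq_0_iff matrix_inv_mult_cancel(4) matrix_vector_mult_0_right zero_neq_one)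
    then show ?thesis
      using eigenvector[OF that(1-3)] that(4) unfolding is_eigenvalue_def by blast
  qed
  obtain Q D :: "real ^ 'm ^ 'm" where R: "R = Q ** D ** matrix_inv Q" "invertible Q" "\<And>i j. i \<noteq> j \<Longrightarrow> D $ i $ j = 0"
    using assms(1) unfolding diagonalizable_def by blast
  obtain Q' D' :: "real ^ 'm ^ 'm" where S: "S = Q' ** D' ** matrix_inv Q'" "invertible Q'"
    "\<And>i j. i \<noteq> j \<Longrightarrow> D' $ i $ j = 0"
    using assms(3) unfolding diagonalizable_def by blast
  have D': "(D' *v w) $ k = D' $ k $ k * w $ k" for w k
    using S(3) by (simp add: matrix_vector_mult_def sum.remove[of UNIV k])
  have "S *v (Q *v axis j 1) = R *v (Q *v axis j 1)" for j
  proof -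
    define v where "v = Q *v axis j 1"
    define d where "d = D $ j $ j"
    define w where "w = matrix_inv Q' *v v"
    have d: "d \<ge> 0" using eigenvalue_nonneg[OF R assms(2)] by (simp add: d_def)
    have Rv: "R *v v = d *s v" using eigenvector[OF R] by (simp add: v_def d_def)
    have v: "v = Q' *v w" using S(2) by (simp add: w_def matrix_inv_mult_cancel)
    have Sv: "S *v (Q' *v u) = Q' *v (D' *v u)" for u
      using S(1,2) by (simp add: matrix_vector_mul_assoc[symmetric] matrix_inv_mult_cancel)
    have "S *v (S *v v) = d *s (d *s v)"
      using Rv eq by (metis matrix_vector_mul_assoc vector_scalar_commute)
    then have "Q' *v (D' *v (D' *v w)) = Q' *v (d *s (d *s w))"
      by (simp add: v Sv vector_scalar_commute)
    then have "D' *v (D' *v w) = d *s (d *s w)"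
      using S(2) by (metis matrix_inv_mult_cancel(4))
    then have sq: "(D' $ k $ k)\<^sup>2 * w $ k = d\<^sup>2 * w $ k" for k
      by (simp add: vec_eq_iff D' power2_eq_square mult.assoc)
    have "D' $ k $ k * w $ k = d * w $ k" for k
      using sq[of k] d eigenvalue_nonneg[OF S assms(4)] by (auto dest: power2_eq_imp_eq)
    then have "D' *v w = d *s w" by (simp add: vec_eq_iff D')
    then show ?thesis
      using Rv by (simp add: v Sv vector_scalar_commute flip: v_def)
  qed
  then have "(S ** Q) *v axis j 1 = (R ** Q) *v axis j 1" for j
    by (simp only: matrix_vector_mul_assoc)
  then have "column j (S ** Q) = column j (R ** Q)" for j
    by (simp only: matrix_vector_mult_basis)
  then have "S ** Q = R ** Q"
    by (simp add: vec_eq_iff column_def)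
  then show ?thesis
    using R(2) by (metis matrix_inv_mult_cancel(1) matrix_mul_assoc matrix_mul_rid)
qed

lemma diag_sqrt_eqI:
  assumes "diagonalizable R" "\<And>c. is_eigenvalue R c \<Longrightarrow> c \<ge> 0" "R ** R = M"
  shows "diag_sqrt M = R"
  unfolding diag_sqrt_def using assms by (intro the_equality) (auto intro: diagonalizable_square_unique)

lemma is_eigenvalue_conjugate_diag:
  fixes Q :: "real ^ 'm ^ 'm"
  assumes "invertible Q" "is_eigenvalue (Q ** diag_mat d ** matrix_inv Q) c"
  obtains i where "c = d i"
proof -
  obtain v where v: "v \<noteq> 0" "(Q ** diag_mat d ** matrix_inv Q) *v v = c *s v"
    using assms(2) by (auto simp: is_eigenvalue_def)
  define w where "w = matrix_inv Q *v v"
  have vw: "v = Q *v w" using assms(1) by (simp add: w_def matrix_inv_mult_cancel)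
  have "w \<noteq> 0" using v(1) vw by auto
  then obtain i where i: "w $ i \<noteq> 0" by (auto simp: vec_eq_iff)
  have "Q *v (diag_mat d *v w) = Q *v (c *s w)"
    using v(2) by (simp add: matrix_vector_mul_assoc[symmetric] vw vector_scalar_commute assms(1)
        matrix_inv_mult_cancel)
  then have "diag_mat d *v w = c *s w"
    using assms(1) by (metis matrix_inv_mult_cancel(4))
  then have "d i * w $ i = c * w $ i" by (metis diag_mat_mult_vec vector_smult_component)
  with i show ?thesis by (intro that[of i]) simp
qed

lemma diag_sqrt_conjugate_diag:
  fixes Q :: "real ^ 'm ^ 'm"
  assumes Q: "invertible Q" and d: "\<And>i. d i \<ge> 0"
  shows "diag_sqrt (Q ** diag_mat d ** matrix_inv Q) =
    Q ** diag_mat (\<lambda>i. sqrt (d i)) ** matrix_inv Q"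
proof (rule diag_sqrt_eqI)
  let ?E = "diag_mat (\<lambda>i. sqrt (d i)) :: real ^ 'm ^ 'm"
  show "diagonalizable (Q ** ?E ** matrix_inv Q)"
    unfolding diagonalizable_def using Q by (intro exI[of _ Q] exI[of _ ?E]) simp
  show "c \<ge> 0" if ev: "is_eigenvalue (Q ** ?E ** matrix_inv Q) c" for c
  proof -
    obtain i where "c = sqrt (d i)" using is_eigenvalue_conjugate_diag[OF Q ev] .
    with d show ?thesis by simp
  qed
  have "(Q ** ?E ** matrix_inv Q) ** (Q ** ?E ** matrix_inv Q) =
      Q ** ?E ** (matrix_inv Q ** Q) ** ?E ** matrix_inv Q"
    by (simp only: matrix_mul_assoc)
  also have "\<dots> = Q ** (?E ** ?E) ** matrix_inv Q"
    by (simp only: matrix_inv_mult_cancel(2)[OF Q] matrix_mul_rid) (simp only: matrix_mul_assoc)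
  also have "\<dots> = Q ** diag_mat d ** matrix_inv Q"
    using d by simp
  finally show "(Q ** ?E ** matrix_inv Q) ** (Q ** ?E ** matrix_inv Q) = Q ** diag_mat d ** matrix_inv Q" .
qed

section \<open>Covariance ellipsoids as linear images of balls\<close>

lemma matrix_vector_scaleR: "(c *\<^sub>R M) *v x = c *\<^sub>R (M *v x)" for M :: "real ^ 'm ^ 'k"
  by (simp add: vec_eq_iff matrix_vector_mult_def sum_distrib_left mult.assoc)

lemma matrix_mul_scaleR:
  "(c *\<^sub>R M) ** N = c *\<^sub>R (M ** N)" "M ** (c *\<^sub>R N) = c *\<^sub>R (M ** N)"
  for M :: "real ^ 'm ^ 'k" and N :: "real ^ 'l ^ 'm"
  by (simp_all add: vec_eq_iff matrix_matrix_mult_def sum_distrib_left mult_ac)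

lemma det_scaleR_matrix: "det (c *\<^sub>R M) = c ^ CARD('m) * det M" for M :: "real ^ 'm ^ 'm"
proof -
  have "c *\<^sub>R M = diag_mat (\<lambda>_. c) ** M"
    by (simp add: vec_eq_iff diag_mat_mult_left)
  then show ?thesis by (simp add: det_mul)
qed

lemma inner_transpose_mult: "(transpose M *v x) \<bullet> y = x \<bullet> (M *v y)" for M :: "real ^ 'm ^ 'k"
  by (metis dot_lmul_matrix transpose_matrix_vector)

lemma invertible_transpose: "invertible (transpose S) \<longleftrightarrow> invertible S" for S :: "real ^ 'm ^ 'm"
  by (simp add: invertible_det_nz)

lemma norm_le_sqrt_iff: "h \<ge> 0 \<Longrightarrow> norm x \<le> sqrt h \<longleftrightarrow> (norm x)\<^sup>2 \<le> h"
  using real_sqrt_le_iff[of "(norm x)\<^sup>2" h] by simp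

text \<open>For \<Sigma> = (h / 2) S S^T the form 1/2 \<Sigma>^{-1} z . z equals |S^{-1} z|^2 / h,
  so the covariance ellipsoid is the image under \<open>S\<close> of the ball of radius sqrt h.
  Applied with h = hbar to the blobs and with h = 1 to the largest ellipsoid.\<close>

lemma posdef_scaled_gram:
  fixes S :: "real ^ 'm ^ 'm"
  assumes "invertible S" "h > 0"
  shows "posdef ((h / 2) *\<^sub>R (S ** transpose S))"
    and "matrix_inv ((h / 2) *\<^sub>R (S ** transpose S)) =
      (2 / h) *\<^sub>R (transpose (matrix_inv S) ** matrix_inv S)"
    and "(matrix_inv ((h / 2) *\<^sub>R (S ** transpose S)) *v z) \<bullet> z = 2 / h * (norm (matrix_inv S *v z))\<^sup>2"
    and "cov_ellipsoid ((h / 2) *\<^sub>R (S ** transpose S)) = (*v) S ` cball 0 (sqrt h)"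
proof -
  have "(S *v (transpose S *v x)) \<bullet> x > 0" if "x \<noteq> 0" for x
  proof -
    have "transpose S *v x \<noteq> 0"
      using that assms(1) by (metis invertible_transpose matrix_inv_mult_cancel(4) matrix_vector_mult_0_right)
    then show ?thesis
      using inner_transpose_mult[of "transpose S"] by (simp del: transpose_matrix_vector)
  qed
  then show "posdef ((h / 2) *\<^sub>R (S ** transpose S))"
    using assms(2) by (simp add: posdef_def transpose_scalar matrix_transpose_mul
        matrix_vector_scaleR flip: matrix_vector_mul_assoc del: transpose_matrix_vector)
  let ?T = "matrix_inv S"
  have "(S ** transpose S) ** (transpose ?T ** ?T) = S ** (transpose (?T ** S)) ** ?T"
    by (simp only: matrix_transpose_mul matrix_mul_assoc)
  also have "\<dots> = mat 1" using assms(1) by (simp add: matrix_inv_mult_cancel)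
  finally show inv: "matrix_inv ((h / 2) *\<^sub>R (S ** transpose S)) = (2 / h) *\<^sub>R (transpose ?T ** ?T)"
    using assms(2) by (intro matrix_inv_unique) (simp add: matrix_mul_scaleR)
  show form: "(matrix_inv ((h / 2) *\<^sub>R (S ** transpose S)) *v z) \<bullet> z = 2 / h * (norm (?T *v z))\<^sup>2" for z
    unfolding inv
    by (simp add: matrix_vector_scaleR inner_transpose_mult power2_norm_eq_inner
        flip: matrix_vector_mul_assoc del: transpose_matrix_vector)
  have mem: "z \<in> cov_ellipsoid ((h / 2) *\<^sub>R (S ** transpose S)) \<longleftrightarrow> norm (?T *v z) \<le> sqrt h" for z
    using assms(2) real_sqrt_le_iff[of "(norm (?T *v z))\<^sup>2" h]
    by (simp add: cov_ellipsoid_def form field_simps)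
  show "cov_ellipsoid ((h / 2) *\<^sub>R (S ** transpose S)) = (*v) S ` cball 0 (sqrt h)"
  proof (intro equalityI subsetI)
    fix z assume "z \<in> cov_ellipsoid ((h / 2) *\<^sub>R (S ** transpose S))"
    then have "?T *v z \<in> cball 0 (sqrt h)" by (simp add: mem)
    moreover have "z = S *v (?T *v z)" using assms(1) by (simp add: matrix_inv_mult_cancel)
    ultimately show "z \<in> (*v) S ` cball 0 (sqrt h)" by blast
  next
    fix z assume "z \<in> (*v) S ` cball 0 (sqrt h)"
    then show "z \<in> cov_ellipsoid ((h / 2) *\<^sub>R (S ** transpose S))"
      using assms(1) by (auto simp: mem matrix_inv_mult_cancel)
  qed
qed

lemma posdef_invertible:
  assumes "posdef (M :: real ^ 'm ^ 'm)"
  shows "invertible M"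
proof -
  obtain L :: "real ^ 'm ^ 'm" where "invertible L" "M = transpose L ** L"
    using posdef_factorization[OF assms] .
  then show ?thesis by (simp add: invertible_det_nz det_mul)
qed

lemma posdef_matrix_inv:
  fixes M :: "real ^ 'm ^ 'm"
  assumes M: "posdef M"
  shows "posdef (matrix_inv M)"
  unfolding posdef_def
proof (intro conjI allI impI)
  note inv = posdef_invertible[OF M]
  show "transpose (matrix_inv M) = matrix_inv M"
    using M transpose_matrix_inv[OF inv] by (simp add: posdef_def)
  fix z :: "real ^ 'm" assume "z \<noteq> 0"
  then have "matrix_inv M *v z \<noteq> 0"
    by (metis inv matrix_inv_mult_cancel(3) matrix_vector_mult_0_right)
  with M have "(M *v (matrix_inv M *v z)) \<bullet> (matrix_inv M *v z) > 0"
    by (simp add: posdef_def)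
  then show "(matrix_inv M *v z) \<bullet> z > 0"
    by (simp add: matrix_inv_mult_cancel[OF inv] inner_commute)
qed

text \<open>Polarization.\<close>

lemma symmetric_form_eqD:
  fixes M N :: "real ^ 'm ^ 'm"
  assumes "transpose M = M" "transpose N = N" "\<And>z. (M *v z) \<bullet> z = (N *v z) \<bullet> z"
  shows "M = N"
proof -
  have sym: "(M *v x) \<bullet> y = (M *v y) \<bullet> x" if "transpose M = M" for M :: "real ^ 'm ^ 'm" and x y
    by (metis inner_commute inner_transpose_mult that)
  have "2 * ((M *v x) \<bullet> y) = 2 * ((N *v x) \<bullet> y)" for x y
    using assms(3)[of "x + y"] assms(3)[of x] assms(3)[of y] sym[OF assms(1), of x y] sym[OF assms(2), of x y]
    by (simp add: matrix_vector_right_distrib inner_add_left inner_add_right)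
  then have "M *v x = N *v x" for x
    by (metis mult_left_cancel vector_eq_ldot zero_neq_numeral inner_commute)
  then show ?thesis by (simp add: matrix_eq)
qed

text \<open>Carries uniqueness of the largest ellipsoid as a set over to its matrix. An inclusion of
  ellipsoids reverses the order of their forms, by homogeneity.\<close>

lemma cov_ellipsoid_inject:
  fixes \<Sigma> \<Sigma>' :: "real ^ 'm ^ 'm"
  assumes "posdef \<Sigma>" "posdef \<Sigma>'" and eq: "cov_ellipsoid \<Sigma> = cov_ellipsoid \<Sigma>'"
  shows "\<Sigma> = \<Sigma>'"
proof -
  have le: "(matrix_inv \<Sigma>' *v z) \<bullet> z \<le> (matrix_inv \<Sigma> *v z) \<bullet> z"
    if p: "posdef \<Sigma>" and sub: "cov_ellipsoid \<Sigma> \<subseteq> cov_ellipsoid \<Sigma>'" for \<Sigma> \<Sigma>' :: "real ^ 'm ^ 'm" and z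
  proof (cases "z = 0")
    case False
    define q where "q = (matrix_inv \<Sigma> *v z) \<bullet> z"
    have q: "q > 0" using posdef_matrix_inv[OF p] False by (simp add: posdef_def q_def)
    \<comment> \<open>The multiple of \<open>z\<close> on the boundary of the first ellipsoid, where
      half the form equals one.\<close>
    let ?z = "sqrt (2 / q) *\<^sub>R z"
    have form: "(M *v ?z) \<bullet> ?z = 2 / q * ((M *v z) \<bullet> z)" for M :: "real ^ 'm ^ 'm"
      using q by (simp add: matrix_vector_mult_scaleR mult.assoc[symmetric] flip: real_sqrt_mult)
    have "?z \<in> cov_ellipsoid \<Sigma>"
      unfolding cov_ellipsoid_def mem_Collect_eq form using q by (simp flip: q_def)
    with sub have "?z \<in> cov_ellipsoid \<Sigma>'" by blast
    then show ?thesis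
      unfolding cov_ellipsoid_def mem_Collect_eq form using q by (simp add: field_simps flip: q_def)
  qed simp
  have "matrix_inv \<Sigma> = matrix_inv \<Sigma>'"
  proof (rule symmetric_form_eqD)
    show "(matrix_inv \<Sigma> *v z) \<bullet> z = (matrix_inv \<Sigma>' *v z) \<bullet> z" for z
      using le[OF assms(1) eq[THEN equalityD1], of z] le[OF assms(2) eq[THEN equalityD2], of z] by simp
  qed (use posdef_matrix_inv assms(1,2) in \<open>auto simp: posdef_def\<close>)
  then show ?thesis
    using posdef_invertible[OF assms(1)] posdef_invertible[OF assms(2)]
    by (metis matrix_inv_mult_cancel(2) matrix_inv_unique)
qed

section \<open>Phase space in blocks, symplectic matrices\<close>

definition vec_join :: "real ^ 'n \<Rightarrow> real ^ 'n \<Rightarrow> real ^ ('n + 'n)" where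
  "vec_join x p = (\<chi> k. case k of Inl i \<Rightarrow> x $ i | Inr i \<Rightarrow> p $ i)"

lemma sum_UNIV_sum_type:
  "(\<Sum>k\<in>UNIV. f k) = (\<Sum>i\<in>UNIV. f (Inl i)) + (\<Sum>i\<in>UNIV. f (Inr i))"
  for f :: "'a::finite + 'b::finite \<Rightarrow> 'c::comm_monoid_add"
  by (simp add: sum.Plus flip: UNIV_Plus_UNIV)

lemma prod_UNIV_sum_type:
  "(\<Prod>k\<in>UNIV. f k) = (\<Prod>i\<in>UNIV. f (Inl i)) * (\<Prod>i\<in>UNIV. f (Inr i))"
  for f :: "'a::finite + 'b::finite \<Rightarrow> 'c::comm_monoid_mult"
  by (simp add: prod.Plus flip: UNIV_Plus_UNIV)

lemma proj_vec_join [simp]: "xproj (vec_join x p) = x" "pproj (vec_join x p) = p"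
  by (simp_all add: vec_eq_iff xproj_def pproj_def vec_join_def)

lemma proj_add_scaleR [simp]:
  "xproj (z + w) = xproj z + xproj w" "pproj (z + w) = pproj z + pproj w"
  "xproj (c *\<^sub>R z) = c *\<^sub>R xproj z" "pproj (c *\<^sub>R z) = c *\<^sub>R pproj z"
  "xproj 0 = 0" "pproj 0 = 0"
  by (simp_all add: vec_eq_iff xproj_def pproj_def)

lemma phase_inner: "z \<bullet> w = xproj z \<bullet> xproj w + pproj z \<bullet> pproj w"
  for z w :: "real ^ ('n::finite + 'n)"
  by (simp add: inner_vec_def sum_UNIV_sum_type xproj_def pproj_def)

lemma phase_norm_power2: "(norm z)\<^sup>2 = (norm (xproj z))\<^sup>2 + (norm (pproj z))\<^sup>2"
  for z :: "real ^ ('n::finite + 'n)"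
  by (simp add: power2_norm_eq_inner phase_inner)

lemma proj_block_mult [simp]:
  fixes a :: "real ^ 'n ^ 'n"
  shows "xproj (block_matrix a b c d *v z) = a *v xproj z + b *v pproj z"
    "pproj (block_matrix a b c d *v z) = c *v xproj z + d *v pproj z"
  by (simp_all add: vec_eq_iff matrix_vector_mult_def sum_UNIV_sum_type xproj_def pproj_def block_matrix_def)

lemma block_matrix_mult:
  fixes a :: "real ^ 'n ^ 'n"
  shows "block_matrix a b c d ** block_matrix a' b' c' d' =
    block_matrix (a ** a' + b ** c') (a ** b' + b ** d') (c ** a' + d ** c') (c ** b' + d ** d')"
  by (simp add: vec_eq_iff matrix_matrix_mult_def sum_UNIV_sum_type block_matrix_def split_sum_all)

lemma transpose_block_matrix:
  "transpose (block_matrix a b c d) = block_matrix (transpose a) (transpose c) (transpose b) (transpose d)"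
  by (simp add: vec_eq_iff transpose_def block_matrix_def split_sum_all)

lemma mat_1_block: "mat 1 = block_matrix (mat 1) 0 0 (mat 1)"
  by (simp add: vec_eq_iff mat_def block_matrix_def split_sum_all)

lemma matrix_mul_zero: "(0 :: real ^ 'm ^ 'k) ** N = 0" "M ** (0 :: real ^ 'l ^ 'm) = 0"
  for M :: "real ^ 'm ^ 'k" and N :: "real ^ 'l ^ 'm"
  by (simp_all add: vec_eq_iff matrix_matrix_mult_def)

lemma matrix_mul_diff: "(M - N) ** L = M ** L - N ** L" "K ** (M - N) = K ** M - K ** N"
  for M N :: "real ^ 'm ^ 'k" and L :: "real ^ 'l ^ 'm" and K :: "real ^ 'k ^ 'l"
  by (simp_all add: vec_eq_iff matrix_matrix_mult_def sum_subtractf algebra_simps)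

lemma transpose_zero [simp]: "transpose (0 :: real ^ 'm ^ 'k) = 0"
  by (simp add: vec_eq_iff transpose_def)

lemma transpose_minus [simp]: "transpose (- M) = - transpose M" for M :: "real ^ 'm ^ 'k"
  by (simp add: vec_eq_iff transpose_def)

lemma matrix_mul_minus: "(- M) ** N = - (M ** N)" "M ** (- N) = - (M ** N)"
  for M :: "real ^ 'm ^ 'k" and N :: "real ^ 'l ^ 'm"
  by (simp_all add: vec_eq_iff matrix_matrix_mult_def sum_negf)

text \<open>Take determinants in S^T J S = J, where det J is nonzero because J^T J = I. The modulus
  is what volumes and normalizing constants call for.\<close>

lemma abs_det_Sp:
  fixes S :: "real ^ ('n::finite + 'n) ^ ('n + 'n)"
  assumes "S \<in> Sp"
  shows "\<bar>det S\<bar> = 1"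
proof -
  have "transpose (Jmat :: real ^ ('n + 'n) ^ ('n + 'n)) ** Jmat = mat 1"
    by (simp add: Jmat_def transpose_block_matrix block_matrix_mult matrix_mul_zero matrix_mul_minus
        mat_1_block[symmetric])
  then have "det (Jmat :: real ^ ('n + 'n) ^ ('n + 'n)) \<noteq> 0"
    by (metis det_I det_mul mult_zero_right zero_neq_one)
  moreover have "det (transpose S ** Jmat ** S) = det (Jmat :: real ^ ('n + 'n) ^ ('n + 'n))"
    using assms by (simp add: Sp_def)
  ultimately have "(det S)\<^sup>2 = 1" by (simp add: det_mul power2_eq_square)
  then show ?thesis by (auto simp: power2_eq_1_iff)
qed

section \<open>Ellipsoids of largest volume\<close>

lemma measure_ellipsoid:
  fixes M :: "real ^ 'm ^ 'm"
  assumes M: "invertible M"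
  shows "measure lebesgue ((\<lambda>w. c + M *v w) ` cball 0 1) = \<bar>det M\<bar> * measure lebesgue (cball (0 :: real ^ 'm) 1)"
proof -
  let ?E = "(\<lambda>w. c + M *v w) ` cball 0 1"
  have "compact ?E"
    by (intro compact_continuous_image continuous_intros linear_continuous_on
        matrix_vector_mul_bounded_linear) simp
  then have [measurable]: "?E \<in> sets borel" by (simp add: borel_compact)
  have inv: "M *v (matrix_inv M *v x) = x" for x
    using M by (simp add: matrix_inv_mult_cancel)
  have scale: "emeasure lborel B = ennreal \<bar>det M\<bar> * emeasure lborel ((*v) M -` B)"
    if [measurable]: "B \<in> sets borel" for B
    by (subst lborel_matrix_distr[OF M]) (simp add: emeasure_density_const emeasure_distr)
  have "(*v) M -` ((+) c -` ?E) = cball 0 1"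
    using M by (auto simp: image_iff) (metis matrix_inv_mult_cancel(4))
  moreover have "emeasure lborel ?E = emeasure lborel ((+) c -` ?E)"
    by (subst lborel_distr_plus[of c, symmetric]) (simp add: emeasure_distr)
  moreover have "(+) c -` ?E \<in> sets borel"
    by (rule measurable_sets_borel[of _ borel]) simp_all
  ultimately have "emeasure lborel ?E = ennreal \<bar>det M\<bar> * emeasure lborel (cball (0 :: real ^ 'm) 1)"
    using scale[of "(+) c -` ?E"] by simp
  then show ?thesis
    by (simp add: measure_def enn2real_mult)
qed

text \<open>Test the constraint at the two unit vectors along the row and against it.\<close>

lemma norm_row_le:
  fixes M :: "real ^ 'm ^ 'm"
  assumes "\<And>w. norm w \<le> 1 \<Longrightarrow> \<bar>c + row k M \<bullet> w\<bar> \<le> 1"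
  shows "\<bar>c\<bar> + norm (row k M) \<le> 1"
proof (cases "row k M = 0")
  case True
  then show ?thesis using assms[of 0] by simp
next
  case False
  let ?w = "(1 / norm (row k M)) *\<^sub>R row k M"
  have "row k M \<bullet> ?w = norm (row k M)"
    using False by (simp add: dot_square_norm power2_eq_square)
  then show ?thesis
    using assms[of ?w] assms[of "- ?w"] False by (auto simp: abs_if split: if_splits)
qed

text \<open>The eigenvalues d i of M M^T are positive, have product (det M)^2, and their sum is the
  sum of the squared row norms, at most the dimension. Summing ln t <= t - 1 gives the bound.
  Equality holds in it only at t = 1, so a determinant of modulus one forces M M^T = I; then all
  rows have norm one, and no room is left for the center c.\<close>

lemma det_le_1_of_image_in_cube:
  fixes M :: "real ^ 'm ^ 'm"
  assumes M: "invertible M" and cube: "\<And>w k. norm w \<le> 1 \<Longrightarrow> \<bar>(c + M *v w) $ k\<bar> \<le> 1"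
  shows "\<bar>det M\<bar> \<le> 1" and "\<bar>det M\<bar> = 1 \<Longrightarrow> (\<lambda>w. c + M *v w) ` cball 0 1 = cball 0 1"
proof -
  have row: "\<bar>c $ k\<bar> + norm (row k M) \<le> 1" for k
    using cube by (intro norm_row_le) (simp add: matrix_vector_mul_component row_def)
  let ?N = "M ** transpose M"
  have "transpose ?N = ?N" by (simp add: matrix_transpose_mul)
  then obtain Q d where Q: "orthogonal_matrix Q" and N: "?N = transpose Q ** diag_mat d ** Q"
    using symmetric_matrix_diagonalization by blast
  have QQ: "Q ** transpose Q = mat 1" "transpose Q ** Q = mat 1"
    using Q by (auto simp: orthogonal_matrix_def)
  have "det ?N = det (transpose Q ** Q) * prod d UNIV"
    unfolding N by (simp add: det_mul)
  then have detN: "(det M)\<^sup>2 = prod d UNIV"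
    by (simp add: QQ det_mul power2_eq_square)
  have d: "d i > 0" for i
  proof -
    have "(Q ** M) ** transpose (Q ** M) = Q ** ?N ** transpose Q"
      by (simp only: matrix_transpose_mul matrix_mul_assoc)
    also have "\<dots> = (Q ** transpose Q) ** diag_mat d ** (Q ** transpose Q)"
      unfolding N by (simp only: matrix_mul_assoc)
    also have "\<dots> = diag_mat d" by (simp add: QQ)
    finally have "((Q ** M) ** transpose (Q ** M)) $ i $ i = d i" by simp
    moreover have "(X ** transpose X) $ i $ i = (\<Sum>j\<in>UNIV. (X $ i $ j)\<^sup>2)" for X :: "real ^ 'm ^ 'm"
      by (simp add: matrix_matrix_mult_def[of X] transpose_def power2_eq_square)
    ultimately have "d i \<ge> 0" by (metis sum_nonneg zero_le_power2)
    moreover have "(\<Prod>i\<in>UNIV. d i) \<noteq> 0"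
      using M by (simp add: invertible_det_nz flip: detN)
    ultimately show ?thesis by (simp add: less_le)
  qed
  have "trace ?N = trace (diag_mat d)"
    unfolding N by (metis QQ(1) matrix_mul_assoc matrix_mul_rid trace_mul_sym)
  then have tr: "sum d UNIV = (\<Sum>k\<in>UNIV. (norm (row k M))\<^sup>2)"
    by (simp add: trace_def matrix_matrix_mult_def transpose_def power2_norm_eq_inner
        inner_vec_def row_def)
  have row2: "(norm (row k M))\<^sup>2 \<le> 1" for k
    using row[of k] by (simp add: abs_square_le_1)
  have "(\<Sum>k\<in>UNIV. (norm (row k M))\<^sup>2) \<le> (\<Sum>k\<in>(UNIV :: 'm set). 1)"
    using row2 by (intro sum_mono)
  then have sum0: "(\<Sum>i\<in>UNIV. d i - 1) \<le> 0" by (simp add: sum_subtractf tr)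
  have ln_le: "ln (d i) \<le> d i - 1" for i using d by (rule ln_le_minus_one)
  have ln_prod: "ln ((det M)\<^sup>2) = (\<Sum>i\<in>UNIV. ln (d i))"
    unfolding detN using d by (subst ln_prod) (auto simp: less_imp_neq[symmetric])
  also have "\<dots> \<le> (\<Sum>i\<in>UNIV. d i - 1)" by (intro sum_mono ln_le)
  finally have "ln ((det M)\<^sup>2) \<le> 0" using sum0 by simp
  then have "(det M)\<^sup>2 \<le> 1" using M by (simp add: invertible_det_nz)
  then show "\<bar>det M\<bar> \<le> 1" by (simp add: abs_square_le_1)
  assume "\<bar>det M\<bar> = 1"
  then have "(det M)\<^sup>2 = 1" by (simp add: abs_square_eq_1)
  then have "(\<Sum>i\<in>UNIV. ln (d i)) = 0" using ln_prod by simp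
  then have "(\<Sum>i\<in>UNIV. (d i - 1) - ln (d i)) \<le> 0" using sum0 by (simp add: sum_subtractf)
  then have "(\<Sum>i\<in>UNIV. (d i - 1) - ln (d i)) = 0"
    using ln_le by (intro antisym sum_nonneg) auto
  then have "(d i - 1) - ln (d i) = 0" for i
    using ln_le by (subst (asm) sum_nonneg_eq_0_iff) auto
  then have "d i = 1" for i using d ln_eq_minus_one[of "d i"] by simp
  then have "d = (\<lambda>_. 1)" by (rule ext)
  then have "?N = mat 1" by (simp add: N diag_mat_1 QQ)
  then have orth: "orthogonal_matrix M" by (simp add: orthogonal_matrix_def matrix_left_right_inverse)
  then have "norm (row k M) = 1" for k by (simp add: orthogonal_matrix_orthonormal_rows)
  then have "c $ k = 0" for k using row[of k] by simp
  then have c: "c = 0" by (simp add: vec_eq_iff)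
  have "orthogonal_transformation ((*v) M)"
    using orth by (simp add: orthogonal_transformation_matrix)
  then have norm: "norm (M *v w) = norm w" for w by (simp add: orthogonal_transformation)
  have "w \<in> (*v) M ` cball 0 1" if "norm w \<le> 1" for w
  proof
    show eq: "w = M *v (matrix_inv M *v w)" using M by (simp add: matrix_inv_mult_cancel)
    show "matrix_inv M *v w \<in> cball 0 1"
      using that norm[of "matrix_inv M *v w"] eq by simp
  qed
  then show "(\<lambda>w. c + M *v w) ` cball 0 1 = cball 0 1"
    by (auto simp: c norm)
qed

lemma abs_nth_proj_le:
  "\<bar>z $ k\<bar> \<le> max (norm (xproj z)) (norm (pproj z))" for z :: "real ^ ('n::finite + 'n)"
  by (cases k) (use component_le_norm_cart[of "xproj z"] component_le_norm_cart[of "pproj z"] in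
      \<open>force simp: xproj_def pproj_def le_max_iff_disj\<close>)+

lemma largest_ellipsoid_in_product:
  fixes S :: "real ^ ('n::finite + 'n) ^ ('n + 'n)"
  assumes S: "invertible S"
    and XP: "phase_prod X P = {z. norm (xproj (matrix_inv S *v z)) \<le> 1 \<and> norm (pproj (matrix_inv S *v z)) \<le> 1}"
    and proj: "xproj ` (*v) S ` cball 0 1 = X" "pproj ` (*v) S ` cball 0 1 = P"
  shows "largest_inscribed_ellipsoid X P ((*v) S ` cball 0 1)"
proof -
  let ?T = "matrix_inv S"
  have TS: "?T *v (S *v w) = w" "S *v (?T *v w) = w" for w
    using S by (simp_all add: matrix_inv_mult_cancel)
  have detTS: "det ?T * det S = 1"
    using S by (metis det_I det_mul matrix_inv_mult_cancel(2))
  have "ellipsoid ((*v) S ` cball 0 1)"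
    unfolding ellipsoid_def using S by (intro exI[of _ 0] exI[of _ S]) simp
  moreover have "(*v) S ` cball 0 1 \<subseteq> phase_prod X P"
    using proj by (auto simp: phase_prod_def)
  ultimately have ins: "inscribed_ellipsoid X P ((*v) S ` cball 0 1)"
    using proj by (simp add: inscribed_ellipsoid_def)
  have "measure lebesgue E < measure lebesgue ((*v) S ` cball 0 1)"
    if E: "inscribed_ellipsoid X P E" "E \<noteq> (*v) S ` cball 0 1" for E
  proof -
    obtain c and M :: "real ^ ('n + 'n) ^ ('n + 'n)" where M: "invertible M" "E = (\<lambda>z. c + M *v z) ` cball 0 1"
      using E(1) unfolding inscribed_ellipsoid_def ellipsoid_def by blast
    have TM: "invertible (?T ** M)"
      using M(1) detTS by (auto simp: invertible_det_nz det_mul)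
    have TE: "?T *v (c + M *v w) = ?T *v c + (?T ** M) *v w" for w
      by (simp add: matrix_vector_right_distrib matrix_vector_mul_assoc)
    have cube: "\<bar>(?T *v c + (?T ** M) *v w) $ k\<bar> \<le> 1" if "norm w \<le> 1" for w k
    proof -
      have "c + M *v w \<in> phase_prod X P"
        using E(1) M(2) that by (force simp: inscribed_ellipsoid_def)
      then show ?thesis
        using abs_nth_proj_le[of "?T *v (c + M *v w)" k] by (simp add: XP TE max_def split: if_splits)
    qed
    \<comment> \<open>This determinant is the ratio of the volumes of \<open>E\<close> and of the
      candidate. The equality case would make the image of \<open>E\<close> under \<open>?T\<close>
      the unit ball, that is, \<open>E\<close> the candidate itself.\<close>
    have "\<bar>det (?T ** M)\<bar> \<noteq> 1"
    proof
      assume "\<bar>det (?T ** M)\<bar> = 1"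
      then have ball: "(\<lambda>w. ?T *v c + (?T ** M) *v w) ` cball 0 1 = cball 0 1"
        by (intro det_le_1_of_image_in_cube(2)[OF TM, of "?T *v c"] cube)
      have "(*v) S ` cball 0 1 = (\<lambda>w. S *v (?T *v (c + M *v w))) ` cball 0 1"
        unfolding TE by (subst ball[symmetric]) (simp add: image_image)
      then have "(*v) S ` cball 0 1 = E" by (simp add: TS M(2))
      with E(2) show False by simp
    qed
    moreover have "\<bar>det (?T ** M)\<bar> \<le> 1"
      by (intro det_le_1_of_image_in_cube(1)[OF TM, of "?T *v c"] cube)
    ultimately have "\<bar>det ?T\<bar> * \<bar>det M\<bar> < 1"
      by (simp add: det_mul abs_mult)
    then have "\<bar>det ?T\<bar> * \<bar>det M\<bar> * \<bar>det S\<bar> < \<bar>det S\<bar>"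
      using S by (simp add: invertible_det_nz)
    then have "\<bar>det M\<bar> < \<bar>det S\<bar>"
    proof -
      have "\<bar>det ?T\<bar> * \<bar>det M\<bar> * \<bar>det S\<bar> = \<bar>det M\<bar> * (\<bar>det ?T\<bar> * \<bar>det S\<bar>)"
        by (simp only: mult_ac)
      also have "\<bar>det ?T\<bar> * \<bar>det S\<bar> = 1"
        using detTS by (simp flip: abs_mult)
      finally have eq: "\<bar>det ?T\<bar> * \<bar>det M\<bar> * \<bar>det S\<bar> = \<bar>det M\<bar> * 1" .
      show ?thesis
        using \<open>\<bar>det ?T\<bar> * \<bar>det M\<bar> * \<bar>det S\<bar> < \<bar>det S\<bar>\<close> unfolding eq by simp
    qed
    moreover have "measure lebesgue (cball (0 :: real ^ ('n + 'n)) 1) > 0"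
      by (simp add: content_cball_pos)
    ultimately show ?thesis
      using measure_ellipsoid[OF M(1), of c] measure_ellipsoid[OF S, of 0] by (simp add: M(2))
  qed
  with ins show ?thesis by (simp add: largest_inscribed_ellipsoid_def)
qed

section \<open>Gaussian densities\<close>

text \<open>The substitution by L = sqrt (2 / h) S^{-1} produces the standard Gaussian. Since z =
  sqrt (h / 2) S (L z), each coordinate of z is a combination of standard ones, and the identity
  covariance of the latter becomes (h / 2) S S^T.\<close>

lemma has_covariance_matrix_gaussian:
  fixes S :: "real ^ 'm ^ 'm"
  assumes S: "invertible S" and det: "\<bar>det S\<bar> = 1" and h: "h > 0"
    and W: "\<And>z. W z = of_real (1 / sqrt (pi * h) ^ CARD('m) * exp (- ((norm (matrix_inv S *v z))\<^sup>2 / h)))"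
  shows "has_covariance_matrix W ((h / 2) *\<^sub>R (S ** transpose S))"
proof -
  define L where "L = sqrt (2 / h) *\<^sub>R matrix_inv S"
  let ?c = "sqrt (h / 2)"
  have c: "?c * sqrt (2 / h) = 1" using h by (simp flip: real_sqrt_mult)
  have z: "z = ?c *\<^sub>R (S *v (L *v z))" for z
    using S c by (simp add: L_def matrix_vector_scaleR matrix_vector_mult_scaleR matrix_inv_mult_cancel)
  have zk: "z $ k = (\<Sum>a\<in>UNIV. ?c * S $ k $ a * (L *v z) $ a)" for z k
    by (subst z) (simp add: matrix_vector_mult_def sum_distrib_left mult.assoc)
  have SL: "S ** L = sqrt (2 / h) *\<^sub>R mat 1"
    using S by (simp add: L_def matrix_mul_scaleR matrix_inv_mult_cancel)
  have "det S * det L = sqrt (2 / h) ^ CARD('m)"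
    unfolding det_mul[symmetric] SL by (simp add: det_diagonal mat_def)
  then have detL: "\<bar>det L\<bar> = sqrt (2 / h) ^ CARD('m)"
    using det h by (metis abs_mult abs_of_nonneg mult_1 real_sqrt_ge_zero zero_le_power
        divide_nonneg_pos zero_le_numeral)
  have L: "invertible L"
    using detL h by (auto simp: invertible_det_nz)
  have norm2: "(L *v z) \<bullet> (L *v z) / 2 = (norm (matrix_inv S *v z))\<^sup>2 / h" for z
    using h by (simp add: L_def matrix_vector_scaleR power2_norm_eq_inner flip: mult.assoc)
  let ?K = "1 / sqrt (pi * h) ^ CARD('m)"
  have const: "?K * (sqrt (2 * pi) ^ CARD('m) / \<bar>det L\<bar>) = 1"
  proof -
    have "sqrt (2 * pi) = sqrt (2 / h) * sqrt (pi * h)"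
      using h by (simp flip: real_sqrt_mult)
    then show ?thesis using h by (simp add: detL power_mult_distrib)
  qed
  have m1: "has_bochner_integral lborel
      (\<lambda>z. (L *v z) $ a * (?K * exp (- ((norm (matrix_inv S *v z))\<^sup>2 / h)))) 0" for a
    using has_bochner_integral_mult_right[OF has_bochner_integral_matrix_substitution[OF L
        has_bochner_integral_gaussian_moment1[of a]], of ?K]
    by (simp add: norm2 mult_ac)
  have m2: "has_bochner_integral lborel
      (\<lambda>z. (L *v z) $ a * (L *v z) $ b * (?K * exp (- ((norm (matrix_inv S *v z))\<^sup>2 / h))))
      (if a = b then 1 else 0)" for a b
  proof -
    have "has_bochner_integral lborel
        (\<lambda>z. ?K * ((L *v z) $ a * (L *v z) $ b * exp (- (((L *v z) \<bullet> (L *v z)) / 2))))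
        (?K * ((if a = b then sqrt (2 * pi) ^ CARD('m) else 0) /\<^sub>R \<bar>det L\<bar>))"
      by (intro has_bochner_integral_mult_right has_bochner_integral_matrix_substitution[OF L]
          has_bochner_integral_gaussian_moment2)
    moreover have "?K * ((if a = b then sqrt (2 * pi) ^ CARD('m) else 0) /\<^sub>R \<bar>det L\<bar>) =
        (if a = b then 1 else 0)"
      using const by (cases "a = b") (simp_all only: if_True if_False real_scaleR_def divide_inverse mult_ac, simp_all)
    moreover have "?K * (u * v * e) = u * v * (?K * e)" for u v e :: real
      by (simp only: mult_ac)
    ultimately show ?thesis unfolding norm2 by (simp only:)
  qed
  have first: "has_bochner_integral lborel
      (\<lambda>z. z $ k * (?K * exp (- ((norm (matrix_inv S *v z))\<^sup>2 / h)))) 0" for k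
  proof -
    have "has_bochner_integral lborel (\<lambda>z. \<Sum>a\<in>UNIV. (?c * S $ k $ a) *
        ((L *v z) $ a * (?K * exp (- ((norm (matrix_inv S *v z))\<^sup>2 / h))))) (\<Sum>a\<in>UNIV. (?c * S $ k $ a) * 0)"
      by (intro has_bochner_integral_sum has_bochner_integral_mult_right m1)
    moreover have "(\<Sum>a\<in>UNIV. (?c * S $ k $ a) * ((L *v z) $ a * x)) = z $ k * x" for z x
      unfolding zk[of z k] by (simp add: sum_distrib_left sum_distrib_right mult_ac)
    ultimately show ?thesis by (simp only: mult_zero_right sum.neutral_const)
  qed
  have second: "has_bochner_integral lborel
      (\<lambda>z. (z $ k * z $ l) * (?K * exp (- ((norm (matrix_inv S *v z))\<^sup>2 / h))))
      (((h / 2) *\<^sub>R (S ** transpose S)) $ k $ l)" for k l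
  proof -
    have "has_bochner_integral lborel (\<lambda>z. \<Sum>a\<in>UNIV. \<Sum>b\<in>UNIV. (?c * S $ k $ a * (?c * S $ l $ b)) *
        ((L *v z) $ a * (L *v z) $ b * (?K * exp (- ((norm (matrix_inv S *v z))\<^sup>2 / h)))))
        (\<Sum>a\<in>UNIV. \<Sum>b\<in>UNIV. (?c * S $ k $ a * (?c * S $ l $ b)) * (if a = b then 1 else 0))"
      by (intro has_bochner_integral_sum has_bochner_integral_mult_right m2)
    moreover have "(\<Sum>a\<in>UNIV. \<Sum>b\<in>UNIV. (?c * S $ k $ a * (?c * S $ l $ b)) * (if a = b then 1 else 0)) =
        ((h / 2) *\<^sub>R (S ** transpose S)) $ k $ l"
    proof -
      have c2: "?c * x * (?c * y) = h / 2 * (x * y)" for x y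
      proof -
        have "?c * x * (?c * y) = (?c * ?c) * (x * y)" by (simp only: mult_ac)
        then show ?thesis using h by simp
      qed
      have "(\<Sum>a\<in>UNIV. \<Sum>b\<in>UNIV. (?c * S $ k $ a * (?c * S $ l $ b)) * (if a = b then 1 else 0)) =
          (\<Sum>a\<in>UNIV. ?c * S $ k $ a * (?c * S $ l $ a))"
        by (simp add: if_distrib cong: if_cong)
      also have "\<dots> = (\<Sum>a\<in>UNIV. h / 2 * (S $ k $ a * S $ l $ a))" by (simp only: c2)
      also have "\<dots> = ((h / 2) *\<^sub>R (S ** transpose S)) $ k $ l"
        by (simp add: matrix_matrix_mult_def transpose_def sum_distrib_left)
      finally show ?thesis .
    qed
    moreover have "(\<Sum>a\<in>UNIV. \<Sum>b\<in>UNIV. (?c * S $ k $ a * (?c * S $ l $ b)) * ((L *v z) $ a * (L *v z) $ b * x))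
        = (z $ k * z $ l) * x" for z x
      unfolding zk[of z k] zk[of z l] sum_product by (simp only: sum_distrib_left mult_ac)
    ultimately show ?thesis by (simp only:)
  qed
  show ?thesis
    unfolding has_covariance_matrix_def
  proof (intro conjI allI)
    show "has_bochner_integral lborel (\<lambda>z. of_real (z $ k) * W z) 0" for k
      using has_bochner_integral_of_real[OF first[of k], where 'a = complex] by (simp add: W)
    show "has_bochner_integral lborel (\<lambda>z. of_real (z $ k * z $ l) * W z)
        (of_real (((h / 2) *\<^sub>R (S ** transpose S)) $ k $ l))" for k l
      using has_bochner_integral_of_real[OF second[of k l], where 'a = complex]
      unfolding W of_real_mult[symmetric] .
  qed
qed

section \<open>Uniqueness of the Fourier transform of integrable functions\<close>

lemma pair_integrable_bounded_product:
  fixes F :: "'a::euclidean_space \<times> 'b::euclidean_space \<Rightarrow> complex"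
  assumes [measurable]: "F \<in> borel_measurable (lborel \<Otimes>\<^sub>M lborel)"
    and g: "integrable lborel g" and k: "integrable lborel k"
    and bound: "\<And>x y. cmod (F (x, y)) \<le> g x * k y"
  shows "integrable (lborel \<Otimes>\<^sub>M lborel) F"
proof (rule Bochner_Integration.integrable_bound)
  show "integrable (lborel \<Otimes>\<^sub>M lborel) (\<lambda>(x, y). norm (g x) * norm (k y))"
  proof (rule lborel_pair.Fubini_integrable)
    have [measurable]: "g \<in> borel_measurable borel" "k \<in> borel_measurable borel"
      using g k by auto
    show "(\<lambda>(x, y). norm (g x) * norm (k y)) \<in> borel_measurable (lborel \<Otimes>\<^sub>M lborel)"
      by measurable
  qed (use g k in \<open>auto simp: abs_mult\<close>)
  show "AE z in lborel \<Otimes>\<^sub>M lborel. norm (F z) \<le> norm (case z of (x, y) \<Rightarrow> norm (g x) * norm (k y))"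
    using bound by (auto simp: abs_mult[symmetric] intro!: order_trans[OF bound] AE_I2)
qed simp

lemma integral_against_gaussian_eq_0:
  fixes g :: "real ^ 'm \<Rightarrow> complex"
  assumes g: "integrable lborel g"
    and zero: "\<And>p. (LINT y|lborel. exp (\<i> * of_real (p \<bullet> y)) * g y) = 0"
    and e: "e > 0"
  shows "(LINT y|lborel. g y * of_real (exp (- (((y - a) /\<^sub>R e) \<bullet> ((y - a) /\<^sub>R e) / 2)))) = 0"
proof -
  let ?C = "sqrt (2 * pi) ^ CARD('m)"
  define F where "F y q = g y * (of_real (exp (- ((q \<bullet> q) / 2))) *
    exp (\<i> * of_real (((y - a) /\<^sub>R e) \<bullet> q)))" for y q
  have [measurable]: "g \<in> borel_measurable borel" using g by auto
  have gauss: "integrable lborel (\<lambda>q::real ^ 'm. exp (- ((q \<bullet> q) / 2)))"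
    using has_bochner_integral_gaussian_linear[of "mat 1 :: real ^ 'm ^ 'm"]
    by (auto simp: has_bochner_integral_iff invertible_det_nz)
  have int: "integrable (lborel \<Otimes>\<^sub>M lborel) (\<lambda>(y, q). F y q)"
    by (rule pair_integrable_bounded_product[OF _ integrable_norm[OF g] gauss])
       (simp_all add: F_def norm_mult)
  have zero_q: "(LINT y|lborel. F y q) = 0" for q
  proof -
    have "F y q = (of_real (exp (- ((q \<bullet> q) / 2))) * exp (- (\<i> * of_real ((a /\<^sub>R e) \<bullet> q)))) *
        (exp (\<i> * of_real ((q /\<^sub>R e) \<bullet> y)) * g y)" for y
    proof -
      have "((y - a) /\<^sub>R e) \<bullet> q = (q /\<^sub>R e) \<bullet> y - (a /\<^sub>R e) \<bullet> q"
        by (simp add: inner_diff_left inner_commute algebra_simps)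
      then have "exp (\<i> * of_real (((y - a) /\<^sub>R e) \<bullet> q)) =
          exp (\<i> * of_real ((q /\<^sub>R e) \<bullet> y)) * exp (- (\<i> * of_real ((a /\<^sub>R e) \<bullet> q)))"
        by (simp only: of_real_diff right_diff_distrib exp_diff exp_minus divide_inverse)
      then show ?thesis by (simp add: F_def mult_ac)
    qed
    then have "(LINT y|lborel. F y q) =
        (of_real (exp (- ((q \<bullet> q) / 2))) * exp (- (\<i> * of_real ((a /\<^sub>R e) \<bullet> q)))) *
        (LINT y|lborel. exp (\<i> * of_real ((q /\<^sub>R e) \<bullet> y)) * g y)"
      by simp
    then show ?thesis by (simp only: zero mult_zero_right)
  qed
  have "(LINT q|lborel. F y q) = of_real ?C * (g y * of_real (exp (- (((y - a) /\<^sub>R e) \<bullet> ((y - a) /\<^sub>R e) / 2))))" for y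
    using has_bochner_integral_gaussian_fourier[of "(y - a) /\<^sub>R e"]
    by (simp add: F_def has_bochner_integral_iff)
  then have "of_real ?C * (LINT y|lborel. g y * of_real (exp (- (((y - a) /\<^sub>R e) \<bullet> ((y - a) /\<^sub>R e) / 2)))) =
      (LINT y|lborel. LINT q|lborel. F y q)" by simp
  also have "\<dots> = (LINT q|lborel. LINT y|lborel. F y q)"
    using lborel_pair.Fubini_integral[OF int] by simp
  also have "\<dots> = 0" by (simp only: zero_q Bochner_Integration.integral_zero)
  finally show ?thesis by simp
qed

text \<open>Integrating the Gaussians of width e over all centers in the box gives smoothed
  indicators, against which \<open>g\<close> integrates to zero. As e tends to 0 they converge to
  the indicator, and dominated convergence applies.\<close>

lemma integral_box_eq_0_of_fourier_eq_0:
  fixes g :: "real ^ 'm \<Rightarrow> complex"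
  assumes g: "integrable lborel g"
    and zero: "\<And>p. (LINT y|lborel. exp (\<i> * of_real (p \<bullet> y)) * g y) = 0"
  shows "(LINT y|lborel. g y * indicator (box l u) y) = 0"
proof -
  define G where "G z = exp (- ((z \<bullet> z) / 2))" for z :: "real ^ 'm"
  let ?C = "sqrt (2 * pi) ^ CARD('m)"
  have [measurable]: "g \<in> borel_measurable borel" using g by auto
  have [measurable]: "G \<in> borel_measurable borel" by (simp add: G_def[abs_def])
  have G0: "G z > 0" "G (- z) = G z" for z by (simp_all add: G_def)
  have G1: "G z \<le> 1" for z by (simp add: G_def)
  have hG: "has_bochner_integral lborel G ?C"
    using has_bochner_integral_gaussian_linear[of "mat 1 :: real ^ 'm ^ 'm"]
    by (simp add: G_def[abs_def] invertible_det_nz)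
  then have iG: "integrable lborel G" by (auto simp: has_bochner_integral_iff)
  have bounded: "integrable lborel (\<lambda>a. indicator (box l u) a :: real)"
    by (rule integrable_real_indicator) (auto simp: emeasure_lborel_box_eq)
  \<comment> \<open>With e = 1 / (n + 1) this is e^{-m} times the integral, over all a in the box,
    of the Gaussian with center a and width e, m being the dimension; the substitution a = y + e z
    fixes the Gaussian and moves the box, which makes the limit visible.\<close>
  define H where "H n y = (LINT z|lborel. indicator (box l u) (y + (1 / Suc n) *\<^sub>R z) * G z)"
    for n :: nat and y
  have H0: "(LINT y|lborel. g y * of_real (H n y)) = 0" for n
  proof -
    define e where "e = 1 / real (Suc n)"
    have e: "e > 0" by (simp add: e_def)
    have H_e: "H n y = (LINT z|lborel. indicator (box l u) (y + e *\<^sub>R z) * G z)" for y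
      by (simp only: H_def e_def)
    define F where "F y a = g y * (of_real (G ((y - a) /\<^sub>R e)) * indicator (box l u) a)" for y a
    have "integrable (lborel \<Otimes>\<^sub>M lborel) (\<lambda>(y, a). F y a)"
    proof (rule pair_integrable_bounded_product[OF _ integrable_norm[OF g] bounded])
      show "cmod (case (y, a) of (y, a) \<Rightarrow> F y a) \<le> cmod (g y) * indicator (box l u) a" for y a
        by (auto simp: F_def norm_mult abs_of_pos[OF G0(1)] G1 split: split_indicator intro!: mult_left_le)
    qed (simp add: F_def)
    then have swap: "(LINT a|lborel. LINT y|lborel. F y a) = (LINT y|lborel. LINT a|lborel. F y a)"
      using lborel_pair.Fubini_integral by fastforce
    have "(LINT y|lborel. F y a) = indicator (box l u) a * (LINT y|lborel. g y * of_real (G ((y - a) /\<^sub>R e)))" for a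
      by (simp add: F_def mult_ac split: split_indicator)
    then have "(LINT y|lborel. F y a) = 0" for a
      using integral_against_gaussian_eq_0[OF g zero e, of a] by (simp add: G_def)
    then have "(LINT y|lborel. LINT a|lborel. F y a) = 0"
      using swap by simp
    moreover have "(LINT a|lborel. F y a) = of_real (e ^ CARD('m)) * (g y * of_real (H n y))" for y
    proof -
      let ?f = "\<lambda>a. G ((y - a) /\<^sub>R e) * indicator (box l u) a"
      have "integrable lborel ?f"
      proof (rule Bochner_Integration.integrable_bound[OF bounded])
        show "AE a in lborel. norm (?f a) \<le> norm (indicator (box l u) a :: real)"
          by (auto simp: abs_of_pos[OF G0(1)] G1 split: split_indicator)
      qed simp
      then have "has_bochner_integral lborel ?f (integral\<^sup>L lborel ?f)"
        by (rule has_bochner_integral_integrable)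
      from has_bochner_integral_affine_substitution[OF _ this, of e y]
      have "H n y = integral\<^sup>L lborel ?f / e ^ CARD('m)"
        using e by (simp add: H_e has_bochner_integral_iff G0 mult.commute divide_inverse)
      then have "integral\<^sup>L lborel ?f = e ^ CARD('m) * H n y" using e by simp
      moreover have "F y a = g y * of_real (?f a)" for a
        by (simp add: F_def split: split_indicator)
      then have "(LINT a|lborel. F y a) = g y * of_real (integral\<^sup>L lborel ?f)"
        by (simp only: integral_mult_right_zero integral_complex_of_real)
      ultimately show ?thesis by (simp add: mult_ac)
    qed
    ultimately show ?thesis using e by simp
  qed
  \<comment> \<open>At boundary points the limit need not be a multiple of the indicator; the
    boundary is a null set.\<close>
  have lim: "(\<lambda>n. H n y) \<longlonglongrightarrow> ?C * indicator (box l u) y" if y: "y \<notin> cbox l u - box l u" for y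
  proof -
    have "(\<lambda>n. H n y) \<longlonglongrightarrow> (LINT z|lborel. indicator (box l u) y * G z)"
      unfolding H_def
    proof (rule integral_dominated_convergence[OF _ _ iG])
      show "AE z in lborel. (\<lambda>n. indicator (box l u) (y + (1 / Suc n) *\<^sub>R z) * G z)
          \<longlonglongrightarrow> indicator (box l u) y * G z"
      proof (intro AE_I2 tendsto_mult tendsto_const)
        fix z :: "real ^ 'm"
        have "(\<lambda>n. y + (1 / Suc n) *\<^sub>R z) \<longlonglongrightarrow> y + 0 *\<^sub>R z"
          by (intro tendsto_intros LIMSEQ_Suc lim_1_over_n)
        then have tend: "(\<lambda>n. y + (1 / Suc n) *\<^sub>R z) \<longlonglongrightarrow> y" by simp
        have "\<forall>\<^sub>F n in sequentially. indicator (box l u) (y + (1 / Suc n) *\<^sub>R z) = (indicator (box l u) y :: real)"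
        proof (cases "y \<in> box l u")
          case True
          from topological_tendstoD[OF tend open_box this] True show ?thesis
            by (auto elim: eventually_mono)
        next
          case False
          with y have "y \<in> - cbox l u" by auto
          from topological_tendstoD[OF tend open_Compl[OF closed_cbox] this]
          have "\<forall>\<^sub>F n in sequentially. y + (1 / Suc n) *\<^sub>R z \<notin> cbox l u" by simp
          then show ?thesis
            by eventually_elim (use False box_subset_cbox[of l u] in \<open>auto split: split_indicator\<close>)
        qed
        then show "(\<lambda>n. indicator (box l u) (y + (1 / Suc n) *\<^sub>R z)) \<longlonglongrightarrow> (indicator (box l u) y :: real)"
          by (rule tendsto_eventually)
      qed
    qed (use G0(1) in \<open>auto split: split_indicator simp: less_imp_le\<close>)
    then show ?thesis using hG by (simp add: has_bochner_integral_iff mult.commute)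
  qed
  have "(\<lambda>n. LINT y|lborel. g y * of_real (H n y)) \<longlonglongrightarrow>
      (LINT y|lborel. g y * of_real (?C * indicator (box l u) y))"
  proof (rule integral_dominated_convergence)
    show "integrable lborel (\<lambda>y. cmod (g y) * ?C)" using g by simp
    have "cbox l u - box l u \<in> null_sets lborel"
      using negligible_frontier_interval[of l u] by (simp add: negligible_iff_null_sets null_sets_completion_iff)
    then have "AE y in lborel. y \<notin> cbox l u - box l u" by (rule AE_not_in)
    then show "AE y in lborel. (\<lambda>n. g y * of_real (H n y)) \<longlonglongrightarrow> g y * of_real (?C * indicator (box l u) y)"
      by eventually_elim (intro tendsto_intros lim)
    show "(\<lambda>y. g y * of_real (H n y)) \<in> borel_measurable lborel" for n
      unfolding H_def by measurable
    have "\<bar>H n y\<bar> \<le> ?C" for n y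
    proof -
      have "\<bar>H n y\<bar> \<le> (LINT z|lborel. G z)"
        unfolding H_def using G0(1) integral_norm_bound
        by (intro order_trans[OF integral_abs_bound] integral_mono' iG)
           (auto split: split_indicator simp: less_imp_le abs_of_pos)
      then show ?thesis using hG by (simp add: has_bochner_integral_iff)
    qed
    then show "AE y in lborel. norm (g y * of_real (H n y)) \<le> cmod (g y) * ?C" for n
      by (auto simp: norm_mult intro!: mult_left_mono)
  qed simp
  then have "(LINT y|lborel. g y * of_real (?C * indicator (box l u) y)) = 0"
    by (simp add: H0 LIMSEQ_const_iff)
  moreover have "(LINT y|lborel. g y * of_real (?C * indicator (box l u) y)) =
      of_real ?C * (LINT y|lborel. g y * indicator (box l u) y)"
  proof -
    have eq: "g y * of_real (?C * indicator (box l u) y) = of_real ?C * (g y * indicator (box l u) y)" for y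
      by (simp split: split_indicator)
    show ?thesis unfolding eq by (rule integral_mult_right_zero)
  qed
  ultimately show ?thesis by simp
qed

text \<open>Since \<open>ennreal\<close> truncates negative values to 0, the densities for s = 1 and
  s = -1 are the positive and the negative part of f. The two measures agree on boxes, an
  intersection stable generator, hence everywhere; so the two parts agree almost everywhere, and
  both vanish.\<close>

lemma AE_eq_0_of_integral_box_eq_0:
  fixes f :: "'a::euclidean_space \<Rightarrow> real"
  assumes f: "integrable lborel f" and zero: "\<And>l u. (LINT y|lborel. f y * indicator (box l u) y) = 0"
  shows "AE x in lborel. f x = 0"
proof -
  have [measurable]: "f \<in> borel_measurable borel" using f by auto
  have dens: "emeasure (density lborel (\<lambda>x. ennreal (s * f x))) (box l u) =
      ennreal (LINT x|lborel. max 0 (s * f x) * indicator (box l u) x)" for s l u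
  proof -
    have "emeasure (density lborel (\<lambda>x. ennreal (s * f x))) (box l u) =
        (\<integral>\<^sup>+x. ennreal (max 0 (s * f x) * indicator (box l u) x) \<partial>lborel)"
      by (subst emeasure_density) (auto intro!: nn_integral_cong split: split_indicator simp: max_def ennreal_neg)
    also have "\<dots> = ennreal (LINT x|lborel. max 0 (s * f x) * indicator (box l u) x)"
      using f by (intro nn_integral_eq_integral) (auto intro!: integrable_real_mult_indicator)
    finally show ?thesis .
  qed
  have "density lborel (\<lambda>x. ennreal (1 * f x)) = density lborel (\<lambda>x. ennreal (- 1 * f x))"
  proof (rule measure_eqI_generator_eq)
    let ?E = "range (\<lambda>(a, b). box a b :: 'a set)"
    let ?A = "\<lambda>n::nat. box (- (real n *\<^sub>R One)) (real n *\<^sub>R One) :: 'a set"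
    show "Int_stable ?E" by (auto simp: Int_stable_def box_Int_box)
    show "range ?A \<subseteq> ?E" "(\<Union>i. ?A i) = UNIV" unfolding UN_box_eq_UNIV by auto
    show "emeasure (density lborel (\<lambda>x. ennreal (1 * f x))) (?A i) \<noteq> \<infinity>" for i
      unfolding dens by simp
    fix X assume "X \<in> ?E"
    then obtain l u where X: "X = box l u" by auto
    have "(LINT x|lborel. max 0 (1 * f x) * indicator (box l u) x) -
        (LINT x|lborel. max 0 (- 1 * f x) * indicator (box l u) x) =
        (LINT x|lborel. f x * indicator (box l u) x)"
      using f by (subst Bochner_Integration.integral_diff[symmetric])
        (auto intro!: integrable_real_mult_indicator Bochner_Integration.integral_cong split: split_indicator)
    then show "emeasure (density lborel (\<lambda>x. ennreal (1 * f x))) X = emeasure (density lborel (\<lambda>x. ennreal (- 1 * f x))) X"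
      unfolding X dens by (simp add: zero)
  qed (simp_all add: borel_eq_box)
  then have "AE x in lborel. ennreal (1 * f x) = ennreal (- 1 * f x)"
    by (intro sigma_finite_measure.density_unique sigma_finite_lborel) simp_all
  then show ?thesis
    by eventually_elim (metis ennreal_eq_0_iff ennreal_neg linorder_le_cases minus_mult_minus mult_1
        mult_minus1 neg_le_0_iff_le order_antisym)
qed

theorem fourier_L1_eq_0:
  fixes g :: "real ^ 'm \<Rightarrow> complex"
  assumes g: "integrable lborel g"
    and zero: "\<And>p. (LINT y|lborel. exp (\<i> * of_real (p \<bullet> y)) * g y) = 0"
  shows "AE y in lborel. g y = 0"
proof -
  have int: "integrable lborel (\<lambda>y. g y * indicator (box l u) y)" for l u
    by (rule Bochner_Integration.integrable_bound[OF g])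
       (use g in \<open>auto split: split_indicator\<close>)
  have "Re (g y * indicator S y) = Re (g y) * indicator S y"
    and "Im (g y * indicator S y) = Im (g y) * indicator S y" for S y
    by (simp_all split: split_indicator)
  then have "(LINT y|lborel. Re (g y) * indicator (box l u) y) = 0"
    and "(LINT y|lborel. Im (g y) * indicator (box l u) y) = 0" for l u
    using integral_Re[OF int[of l u]] integral_Im[OF int[of l u]]
      integral_box_eq_0_of_fourier_eq_0[OF g zero, of l u] by simp_all
  then have "AE y in lborel. Re (g y) = 0" "AE y in lborel. Im (g y) = 0"
    using g by (auto intro!: AE_eq_0_of_integral_box_eq_0)
  then show ?thesis by eventually_elim (simp add: complex_eq_iff)
qed

section \<open>Square integrable functions\<close>

lemma sums_of_suminf_ennreal:
  assumes "\<And>i. a i \<ge> 0" "t \<ge> 0" "(\<Sum>i. ennreal (a i)) = ennreal t"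
  shows "a sums t"
proof -
  have "summable a" using assms(1,3) by (intro summable_suminf_not_top) auto
  moreover from this have "ennreal (suminf a) = ennreal t"
    using assms by (simp add: suminf_ennreal2)
  ultimately show ?thesis
    using assms(1,2) by (simp add: sums_iff suminf_nonneg)
qed

lemma suminf_ennreal_of_sums:
  assumes "\<And>i. a i \<ge> 0" "a sums t"
  shows "(\<Sum>i. ennreal (a i)) = ennreal t"
  using assms by (intro suminf_ennreal_eq)

lemma suminf_ennreal_swap: "(\<Sum>i. \<Sum>j. f i j) = (\<Sum>j. \<Sum>i. f i j :: ennreal)"
  using nn_integral_suminf[of "\<lambda>j i. f i j" "count_space UNIV"]
  by (simp add: nn_integral_count_space_nat)

lemma L2_measurable [measurable_dest]: "f \<in> L2 \<Longrightarrow> f \<in> borel_measurable borel"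
  by (simp add: L2_def)

lemma L2_integrable: "f \<in> L2 \<Longrightarrow> integrable lborel (\<lambda>x. (cmod (f x))\<^sup>2)"
  by (simp add: L2_def)

lemma L2_I: "f \<in> borel_measurable borel \<Longrightarrow> integrable lborel (\<lambda>x. (cmod (f x))\<^sup>2) \<Longrightarrow> f \<in> L2"
  by (simp add: L2_def)

lemma L2_dominated:
  assumes "f \<in> borel_measurable borel" "integrable lborel g" "\<And>x. (cmod (f x))\<^sup>2 \<le> g x"
  shows "f \<in> L2"
proof (rule L2_I)
  have [measurable]: "f \<in> borel_measurable borel" by fact
  show "integrable lborel (\<lambda>x. (cmod (f x))\<^sup>2)"
    by (rule Bochner_Integration.integrable_bound[OF assms(2)])
       (use assms(3) in \<open>auto intro!: AE_I2 order_trans[OF assms(3)]\<close>)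
qed fact

lemma L2_norm_nonneg [simp]: "L2_norm f \<ge> 0"
  by (simp add: L2_norm_def)

lemma L2_norm_power2: "(L2_norm f)\<^sup>2 = (LINT x|lborel. (cmod (f x))\<^sup>2)"
  by (simp add: L2_norm_def)

lemma nn_integral_L2: "f \<in> L2 \<Longrightarrow> (\<integral>\<^sup>+x. ennreal ((cmod (f x))\<^sup>2) \<partial>lborel) = ennreal ((L2_norm f)\<^sup>2)"
  unfolding L2_norm_power2 by (intro nn_integral_eq_integral L2_integrable) simp_all

lemma cmod_mult_le_sum_power2: "cmod a * cmod b \<le> (cmod a)\<^sup>2 + (cmod b)\<^sup>2"
proof -
  have "0 \<le> (cmod a - cmod b)\<^sup>2 + (cmod a)\<^sup>2 + (cmod b)\<^sup>2" by simp
  then show ?thesis by (simp add: power2_diff)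
qed

lemma L2_mult_integrable:
  assumes "f \<in> L2" "g \<in> L2"
  shows "integrable lborel (\<lambda>x. f x * g x)"
proof (rule Bochner_Integration.integrable_bound)
  show "integrable lborel (\<lambda>x. (cmod (f x))\<^sup>2 + (cmod (g x))\<^sup>2)"
    using assms by (simp add: L2_integrable)
  show "AE x in lborel. norm (f x * g x) \<le> norm ((cmod (f x))\<^sup>2 + (cmod (g x))\<^sup>2)"
    using cmod_mult_le_sum_power2 by (auto simp: norm_mult)
qed (use assms in measurable)

lemma borel_measurable_cnj [measurable]: "cnj \<in> borel_measurable borel"
  by (intro borel_measurable_continuous_onI continuous_intros)

lemma L2_cnj:
  assumes f [measurable]: "f \<in> L2"
  shows "(\<lambda>x. cnj (f x)) \<in> L2"
  by (rule L2_I) (measurable, simp add: L2_integrable f)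

lemma L2_inner_integrable: "f \<in> L2 \<Longrightarrow> g \<in> L2 \<Longrightarrow> integrable lborel (\<lambda>x. cnj (f x) * g x)"
  by (intro L2_mult_integrable L2_cnj)

lemma L2_norm_mult_integrable: "f \<in> L2 \<Longrightarrow> g \<in> L2 \<Longrightarrow> integrable lborel (\<lambda>x. cmod (f x) * cmod (g x))"
  using integrable_norm[OF L2_mult_integrable, of f g] by (simp add: norm_mult)

lemma L2_cmult:
  assumes f [measurable]: "f \<in> L2"
  shows "(\<lambda>x. c * f x) \<in> L2"
  by (rule L2_I) (measurable, simp add: L2_integrable f norm_mult power_mult_distrib)

lemma L2_add:
  assumes "f \<in> L2" "g \<in> L2"
  shows "(\<lambda>x. f x + g x) \<in> L2"
proof (rule L2_dominated)
  show "(\<lambda>x. f x + g x) \<in> borel_measurable borel" using assms by measurable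
  show "integrable lborel (\<lambda>x. (cmod (f x))\<^sup>2 + (cmod (g x))\<^sup>2 + 2 * (cmod (f x) * cmod (g x)))"
    using assms by (simp add: L2_integrable L2_norm_mult_integrable)
  show "(cmod (f x + g x))\<^sup>2 \<le> (cmod (f x))\<^sup>2 + (cmod (g x))\<^sup>2 + 2 * (cmod (f x) * cmod (g x))" for x
    using power_mono[OF norm_triangle_ineq[of "f x" "g x"], of 2] by (simp add: power2_sum)
qed

lemma L2_diff: "f \<in> L2 \<Longrightarrow> g \<in> L2 \<Longrightarrow> (\<lambda>x. f x - g x) \<in> L2"
  using L2_add[of f "\<lambda>x. - 1 * g x"] L2_cmult[of g "- 1"] by simp

lemma L2_zero: "(\<lambda>_. 0) \<in> L2"
  by (simp add: L2_def)

lemma L2_sum: "(\<And>i. i \<in> I \<Longrightarrow> f i \<in> L2) \<Longrightarrow> (\<lambda>x. \<Sum>i\<in>I. f i x) \<in> L2"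
  by (induction I rule: infinite_finite_induct) (auto intro: L2_zero L2_add)

lemma L2_inner_commute: "L2_inner g f = cnj (L2_inner f g)"
  unfolding L2_inner_def Bochner_Integration.integral_cnj[symmetric] by (simp add: mult.commute)

lemma cmod_L2_inner_commute: "cmod (L2_inner g f) = cmod (L2_inner f g)"
  by (subst L2_inner_commute) (rule complex_mod_cnj)

lemma L2_inner_self: "L2_inner f f = of_real ((L2_norm f)\<^sup>2)"
  unfolding L2_inner_def L2_norm_power2 integral_complex_of_real[symmetric]
  by (intro Bochner_Integration.integral_cong refl) (simp only: complex_norm_square mult.commute)

lemma L2_inner_cmult: "L2_inner f (\<lambda>x. c * g x) = c * L2_inner f g"
  unfolding L2_inner_def by (simp add: mult.left_commute)

lemma L2_inner_diff: "f \<in> L2 \<Longrightarrow> g \<in> L2 \<Longrightarrow> h \<in> L2 \<Longrightarrow> L2_inner f (\<lambda>x. g x - h x) = L2_inner f g - L2_inner f h"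
  unfolding L2_inner_def by (simp add: right_diff_distrib L2_inner_integrable)

lemma L2_inner_sum:
  "f \<in> L2 \<Longrightarrow> (\<And>i. i \<in> I \<Longrightarrow> g i \<in> L2) \<Longrightarrow> L2_inner f (\<lambda>x. \<Sum>i\<in>I. g i x) = (\<Sum>i\<in>I. L2_inner f (g i))"
  unfolding L2_inner_def by (simp add: sum_distrib_left L2_inner_integrable)

lemma L2_inner_cong_AE:
  assumes "f \<in> L2" "g \<in> L2" "h \<in> L2" "AE x in lborel. g x = h x"
  shows "L2_inner f g = L2_inner f h"
  unfolding L2_inner_def
proof (rule integral_cong_AE)
  show "AE x in lborel. cnj (f x) * g x = cnj (f x) * h x"
    using assms(4) by eventually_elim simp
qed (use L2_inner_integrable[OF assms(1,2)] L2_inner_integrable[OF assms(1,3)] in auto)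

lemma L2_norm_cong_AE:
  assumes "g \<in> L2" "h \<in> L2" "AE x in lborel. g x = h x"
  shows "L2_norm g = L2_norm h"
proof -
  have "(LINT x|lborel. (cmod (g x))\<^sup>2) = (LINT x|lborel. (cmod (h x))\<^sup>2)"
  proof (rule integral_cong_AE)
    show "AE x in lborel. (cmod (g x))\<^sup>2 = (cmod (h x))\<^sup>2"
      using assms(3) by eventually_elim simp
  qed (use L2_integrable[OF assms(1)] L2_integrable[OF assms(2)] in auto)
  then show ?thesis by (simp add: L2_norm_def)
qed

lemma L2_Cauchy_Schwarz_norm:
  assumes "f \<in> L2" "g \<in> L2"
  shows "(LINT x|lborel. cmod (f x) * cmod (g x)) \<le> L2_norm f * L2_norm g"
proof -
  have [measurable]: "f \<in> borel_measurable borel" "g \<in> borel_measurable borel"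
    using assms by (auto dest: L2_measurable)
  let ?I = "LINT x|lborel. cmod (f x) * cmod (g x)"
  have I0: "?I \<ge> 0" by (intro integral_nonneg_AE) auto
  have "(ennreal ?I)\<^sup>2 = (\<integral>\<^sup>+x. ennreal (cmod (f x)) * ennreal (cmod (g x)) \<partial>lborel)\<^sup>2"
    using assms by (subst nn_integral_eq_integral[symmetric])
      (auto simp: L2_norm_mult_integrable ennreal_mult)
  also have "\<dots> \<le> (\<integral>\<^sup>+x. (ennreal (cmod (f x)))\<^sup>2 \<partial>lborel) * (\<integral>\<^sup>+x. (ennreal (cmod (g x)))\<^sup>2 \<partial>lborel)"
    by (intro Cauchy_Schwarz_nn_integral) simp_all
  also have "\<dots> = ennreal ((L2_norm f)\<^sup>2 * (L2_norm g)\<^sup>2)"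
  proof -
    have "(\<integral>\<^sup>+x. (ennreal (cmod (f x)))\<^sup>2 \<partial>lborel) = ennreal ((L2_norm f)\<^sup>2)" if "f \<in> L2" for f :: "'a \<Rightarrow> complex"
      using nn_integral_L2[OF that] by (simp add: ennreal_power)
    with assms show ?thesis by (simp only: ennreal_mult zero_le_power2)
  qed
  finally have "?I\<^sup>2 \<le> (L2_norm f * L2_norm g)\<^sup>2"
    using I0 by (simp add: ennreal_power power_mult_distrib)
  then show ?thesis by (rule power2_le_imp_le) simp
qed

lemma L2_Cauchy_Schwarz:
  assumes "f \<in> L2" "g \<in> L2"
  shows "cmod (L2_inner f g) \<le> L2_norm f * L2_norm g"
proof -
  have "cmod (L2_inner f g) \<le> (LINT x|lborel. cmod (f x) * cmod (g x))"
    unfolding L2_inner_def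
    by (rule order_trans[OF integral_norm_bound]) (simp add: norm_mult)
  then show ?thesis using L2_Cauchy_Schwarz_norm[OF assms] by simp
qed

lemma L2_norm_diff_cmult:
  assumes "f \<in> L2" "g \<in> L2"
  shows "(L2_norm (\<lambda>x. f x - c * g x))\<^sup>2 =
    (L2_norm f)\<^sup>2 - 2 * Re (cnj c * L2_inner g f) + (cmod c)\<^sup>2 * (L2_norm g)\<^sup>2"
proof -
  define u where "u x = Re (cnj c * (cnj (g x) * f x))" for x
  have "(cmod (f x - c * g x))\<^sup>2 = (cmod (f x))\<^sup>2 - 2 * u x + (cmod c)\<^sup>2 * (cmod (g x))\<^sup>2" for x
    unfolding cmod_power2 u_def by (simp add: power2_eq_square algebra_simps)
  moreover have int: "integrable lborel (\<lambda>x. cnj c * (cnj (g x) * f x))"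
    using L2_inner_integrable[OF assms(2,1)] by (rule integrable_mult_right)
  then have "integrable lborel u"
    unfolding u_def by (rule integrable_Re)
  moreover have "(LINT x|lborel. u x) = Re (cnj c * L2_inner g f)"
    unfolding L2_inner_def u_def using int by (simp only: integral_Re integral_mult_right_zero)
  ultimately show ?thesis
    unfolding L2_norm_power2 using assms by (simp add: L2_integrable)
qed

text \<open>The definition of a basis only speaks of remainders tending to zero. Subtracting one
  more projection lowers the squared norm of the remainder by exactly the next squared coefficient,
  so the partial sums of the series are explicit.\<close>

lemma L2_parseval:
  assumes e: "orthonormal_basis e" and f: "f \<in> L2"
  shows "(\<lambda>i. (cmod (L2_inner (e i) f))\<^sup>2) sums (L2_norm f)\<^sup>2"
proof -
  have eL2: "e i \<in> L2" for i using e by (simp add: orthonormal_basis_def)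
  have ee: "L2_inner (e i) (e j) = (if i = j then 1 else 0)" for i j
    using e by (simp add: orthonormal_basis_def)
  have norm_e: "(L2_norm (e i))\<^sup>2 = 1" for i
    using ee[of i i] unfolding L2_inner_self by (simp flip: of_real_power)
  define s where "s N = (\<lambda>x. f x - (\<Sum>i<N. L2_inner (e i) f * e i x))" for N
  have sL2: "s N \<in> L2" for N
    unfolding s_def by (intro L2_diff f L2_sum L2_cmult eL2)
  have norm_s: "(L2_norm (s N))\<^sup>2 = (L2_norm f)\<^sup>2 - (\<Sum>i<N. (cmod (L2_inner (e i) f))\<^sup>2)" for N
  proof (induction N)
    case (Suc N)
    let ?c = "L2_inner (e N) f"
    have inner_s: "L2_inner (e N) (s N) = ?c"
      unfolding s_def
      by (subst L2_inner_diff) (auto simp: L2_inner_sum L2_inner_cmult ee eL2 f L2_cmult intro!: L2_sum)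
    have "s (Suc N) = (\<lambda>x. s N x - ?c * e N x)"
      by (auto simp: s_def)
    moreover have "Re (cnj ?c * ?c) = (cmod ?c)\<^sup>2"
      unfolding cmod_power2 by (simp add: power2_eq_square)
    ultimately show ?case
      using L2_norm_diff_cmult[OF sL2 eL2, of N ?c N] by (simp add: inner_s norm_e Suc)
  qed (simp add: s_def)
  have "(\<lambda>N. L2_norm (s N)) \<longlonglongrightarrow> 0"
    using e f by (simp add: orthonormal_basis_def s_def)
  then have "(\<lambda>N. (L2_norm f)\<^sup>2 - (L2_norm (s N))\<^sup>2) \<longlonglongrightarrow> (L2_norm f)\<^sup>2 - 0\<^sup>2"
    by (intro tendsto_intros)
  then show ?thesis by (simp add: sums_def norm_s)
qed

text \<open>Fatou: the squared norm of f - F is at most the limit inferior of those of f - s N. This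
  identifies limits in norm with pointwise limits along the whole sequence.\<close>

lemma L2_limit_AE_unique:
  assumes f: "f \<in> L2" and s: "\<And>N. s N \<in> L2" and lim: "(\<lambda>N. L2_norm (\<lambda>x. f x - s N x)) \<longlonglongrightarrow> 0"
    and [measurable]: "F \<in> borel_measurable borel"
    and ptw: "AE x in lborel. (\<lambda>N. s N x) \<longlonglongrightarrow> F x"
  shows "AE x in lborel. f x = F x"
proof -
  have [measurable]: "f \<in> borel_measurable borel" "\<And>N. s N \<in> borel_measurable borel"
    using f s by (auto dest: L2_measurable)
  have "(\<integral>\<^sup>+x. ennreal ((cmod (f x - F x))\<^sup>2) \<partial>lborel) =
      (\<integral>\<^sup>+x. liminf (\<lambda>N. ennreal ((cmod (f x - s N x))\<^sup>2)) \<partial>lborel)"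
  proof (rule nn_integral_cong_AE)
    show "AE x in lborel. ennreal ((cmod (f x - F x))\<^sup>2) = liminf (\<lambda>N. ennreal ((cmod (f x - s N x))\<^sup>2))"
      using ptw
    proof eventually_elim
      case (elim x)
      have "(\<lambda>N. ennreal ((cmod (f x - s N x))\<^sup>2)) \<longlonglongrightarrow> ennreal ((cmod (f x - F x))\<^sup>2)"
        by (intro tendsto_intros elim tendsto_ennrealI)
      then show ?case by (rule lim_imp_Liminf[OF trivial_limit_sequentially, symmetric])
    qed
  qed
  also have "\<dots> \<le> liminf (\<lambda>N. \<integral>\<^sup>+x. ennreal ((cmod (f x - s N x))\<^sup>2) \<partial>lborel)"
    by (intro nn_integral_liminf) simp
  also have "\<dots> = liminf (\<lambda>N. ennreal ((L2_norm (\<lambda>x. f x - s N x))\<^sup>2))"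
    using f s by (simp add: nn_integral_L2 L2_diff)
  also have "\<dots> = ennreal (0\<^sup>2)"
    by (intro lim_imp_Liminf tendsto_ennrealI tendsto_power lim) simp
  finally have "(\<integral>\<^sup>+x. ennreal ((cmod (f x - F x))\<^sup>2) \<partial>lborel) = 0" by simp
  then have "AE x in lborel. ennreal ((cmod (f x - F x))\<^sup>2) = 0"
    by (subst (asm) nn_integral_0_iff_AE) simp_all
  then show ?thesis by eventually_elim simp
qed

lemma L2_norm_eq_0_AE:
  assumes f: "f \<in> L2" and "L2_norm f = 0"
  shows "AE x in lborel. f x = 0"
  by (rule L2_limit_AE_unique[OF f L2_zero]) (use assms in simp_all)

section \<open>Convex combinations of pure states\<close>

lemma unit_L2_norm: "unit_L2 f \<Longrightarrow> f \<in> L2" "unit_L2 f \<Longrightarrow> L2_norm f = 1"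
  by (simp_all add: unit_L2_def)

text \<open>Strong convergence of the decomposition implies convergence of the quadratic forms, by
  Cauchy-Schwarz.\<close>

lemma state_decomposition_inner_sums:
  assumes dec: "state_decomposition \<rho> \<mu> \<psi>" and op: "L2_operator \<rho>" and f: "f \<in> L2"
  shows "(\<lambda>j. of_real (\<mu> j * (cmod (L2_inner (\<psi> j) f))\<^sup>2)) sums L2_inner f (\<rho> f)"
proof -
  have \<psi>: "\<psi> j \<in> L2" for j using dec by (simp add: state_decomposition_def unit_L2_def)
  have \<rho>f: "\<rho> f \<in> L2" using op f by (simp add: L2_operator_def)
  define s where "s N = (\<lambda>x. \<Sum>j<N. of_real (\<mu> j) * ketbra (\<psi> j) f x)" for N
  have sL2: "s N \<in> L2" for N
    unfolding s_def ketbra_def by (intro L2_sum L2_cmult \<psi>)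
  have inner_s: "L2_inner f (s N) = (\<Sum>j<N. of_real (\<mu> j * (cmod (L2_inner (\<psi> j) f))\<^sup>2))" for N
  proof -
    have "L2_inner f (s N) = (\<Sum>j<N. L2_inner f (\<lambda>x. of_real (\<mu> j) * (L2_inner (\<psi> j) f * \<psi> j x)))"
      unfolding s_def ketbra_def by (intro L2_inner_sum f L2_cmult \<psi>)
    moreover have "L2_inner f (\<lambda>x. of_real (\<mu> j) * (L2_inner (\<psi> j) f * \<psi> j x)) =
        of_real (\<mu> j * (cmod (L2_inner (\<psi> j) f))\<^sup>2)" for j
      unfolding L2_inner_cmult by (subst (2) L2_inner_commute) (simp only: of_real_mult complex_norm_square mult_ac)
    ultimately show ?thesis by simp
  qed
  have "(\<lambda>N. L2_norm f * L2_norm (\<lambda>x. \<rho> f x - s N x)) \<longlonglongrightarrow> L2_norm f * 0"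
    using dec f by (intro tendsto_mult tendsto_const) (simp add: state_decomposition_def s_def)
  then have null: "(\<lambda>N. L2_norm f * L2_norm (\<lambda>x. \<rho> f x - s N x)) \<longlonglongrightarrow> 0" by simp
  have "cmod (L2_inner f (\<rho> f) - L2_inner f (s N)) \<le> L2_norm f * L2_norm (\<lambda>x. \<rho> f x - s N x)" for N
    unfolding L2_inner_diff[OF f \<rho>f sL2, symmetric]
    by (intro L2_Cauchy_Schwarz f L2_diff \<rho>f sL2)
  then have "(\<lambda>N. L2_inner f (\<rho> f) - L2_inner f (s N)) \<longlonglongrightarrow> 0"
    by (intro Lim_null_comparison[OF _ null]) simp
  then have "(\<lambda>N. L2_inner f (\<rho> f) - (L2_inner f (\<rho> f) - L2_inner f (s N))) \<longlonglongrightarrow> L2_inner f (\<rho> f) - 0"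
    by (intro tendsto_intros)
  then show ?thesis by (simp add: sums_def inner_s)
qed

text \<open>The diagonal entries are series with nonnegative terms, so the sum over the basis and
  the sum over the mixture may be exchanged. Parseval then gives 1 for each unit vector, and the
  weights add up to the trace 1.\<close>

lemma quantum_state_of_decomposition:
  assumes dec: "state_decomposition \<rho> \<mu> \<psi>" and op: "L2_operator \<rho>"
  shows "quantum_state \<rho>"
proof -
  have \<psi>: "\<psi> j \<in> L2" "L2_norm (\<psi> j) = 1" and \<mu>0: "\<mu> j \<ge> 0" and \<mu>: "\<mu> sums 1" for j
    using dec by (auto simp: state_decomposition_def unit_L2_def)
  note sums = state_decomposition_inner_sums[OF dec op]
  have Im0: "Im (L2_inner f (\<rho> f)) = 0" if "f \<in> L2" for f
    using sums_Im[OF sums[OF that]] by (simp add: sums_iff)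
  have Re_sums: "(\<lambda>j. \<mu> j * (cmod (L2_inner (\<psi> j) f))\<^sup>2) sums Re (L2_inner f (\<rho> f))" if "f \<in> L2" for f
    using sums_Re[OF sums[OF that]] by simp
  have Re0: "Re (L2_inner f (\<rho> f)) \<ge> 0" if "f \<in> L2" for f
    using sums_le[OF _ sums_zero Re_sums[OF that]] \<mu>0 by simp
  have "(\<lambda>i. L2_inner (e i) (\<rho> (e i))) sums 1" if e: "orthonormal_basis e" for e
  proof -
    have eL2: "e i \<in> L2" for i using e by (simp add: orthonormal_basis_def)
    have "(\<Sum>i. ennreal (Re (L2_inner (e i) (\<rho> (e i))))) =
        (\<Sum>i. \<Sum>j. ennreal (\<mu> j * (cmod (L2_inner (\<psi> j) (e i)))\<^sup>2))"
      using \<mu>0 by (intro suminf_cong suminf_ennreal_of_sums[symmetric] Re_sums eL2) simp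
    also have "\<dots> = (\<Sum>j. \<Sum>i. ennreal (\<mu> j * (cmod (L2_inner (\<psi> j) (e i)))\<^sup>2))"
      by (rule suminf_ennreal_swap)
    also have "\<dots> = (\<Sum>j. ennreal (\<mu> j * 1))"
    proof (rule suminf_cong)
      show "(\<Sum>i. ennreal (\<mu> j * (cmod (L2_inner (\<psi> j) (e i)))\<^sup>2)) = ennreal (\<mu> j * 1)" for j
      proof (rule suminf_ennreal_of_sums)
        have "(\<lambda>i. (cmod (L2_inner (\<psi> j) (e i)))\<^sup>2) sums 1"
        using L2_parseval[OF e \<psi>(1)[of j]] by (simp add: \<psi> cmod_L2_inner_commute[of "\<psi> j"])
      then show "(\<lambda>i. \<mu> j * (cmod (L2_inner (\<psi> j) (e i)))\<^sup>2) sums (\<mu> j * 1)"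
        by (rule sums_mult)
      qed (use \<mu>0 in simp)
    qed
    also have "(\<Sum>j. ennreal (\<mu> j * 1)) = ennreal 1"
      using suminf_ennreal_of_sums[OF \<mu>0 \<mu>] by simp
    finally have "(\<lambda>i. Re (L2_inner (e i) (\<rho> (e i)))) sums 1"
      using Re0[OF eL2] by (intro sums_of_suminf_ennreal) auto
    then have "(\<lambda>i. of_real (Re (L2_inner (e i) (\<rho> (e i)))) :: complex) sums of_real 1"
      by (rule sums_of_real)
    moreover have "of_real (Re (L2_inner (e i) (\<rho> (e i)))) = L2_inner (e i) (\<rho> (e i))" for i
      using Im0[OF eL2] by (simp add: complex_eq_iff)
    ultimately show ?thesis by simp
  qed
  then show ?thesis
    using op Im0 Re0 by (simp add: quantum_state_def possemidef_operator_def has_trace_def)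
qed

section \<open>Operators with a real symmetric kernel\<close>

lemma tendsto_L2_norm_0:
  fixes s :: "nat \<Rightarrow> 'a::euclidean_space \<Rightarrow> complex"
  assumes s: "\<And>N. s N \<in> L2" and g: "integrable lborel g"
    and bound: "\<And>N x. (cmod (s N x))\<^sup>2 \<le> g x" and ptw: "\<And>x. (\<lambda>N. s N x) \<longlonglongrightarrow> 0"
  shows "(\<lambda>N. L2_norm (s N)) \<longlonglongrightarrow> 0"
proof -
  have [measurable]: "s N \<in> borel_measurable borel" for N using s by (rule L2_measurable)
  have "(\<lambda>N. LINT x|lborel. (cmod (s N x))\<^sup>2) \<longlonglongrightarrow> (LINT x::'a|lborel. 0)"
  proof (rule integral_dominated_convergence[OF _ _ g])
    show "AE x in lborel. (\<lambda>N. (cmod (s N x))\<^sup>2) \<longlonglongrightarrow> 0"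
      using tendsto_power[OF tendsto_norm[OF ptw], where n = 2] by simp
  qed (use bound in simp_all)
  then have "(\<lambda>N. sqrt (LINT x|lborel. (cmod (s N x))\<^sup>2)) \<longlonglongrightarrow> sqrt 0"
    by (intro tendsto_real_sqrt) simp
  then show ?thesis by (simp add: L2_norm_def)
qed

text \<open>The product majorant with square integrable \<open>r\<close> makes \<open>K\<close> a
  Hilbert-Schmidt kernel and supplies the majorants for Fubini and dominated convergence. In the
  application \<open>r\<close> is the square root of the diagonal of \<open>K\<close>.\<close>

locale real_kernel =
  fixes K :: "'a::euclidean_space \<Rightarrow> 'a \<Rightarrow> real" and r :: "'a \<Rightarrow> real"
  assumes K_measurable: "(\<lambda>(x, y). K x y) \<in> borel_measurable (borel \<Otimes>\<^sub>M borel)"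
    and K_sym: "K x y = K y x"
    and K_bound: "\<bar>K x y\<bar> \<le> r x * r y"
    and r_measurable [measurable]: "r \<in> borel_measurable borel"
    and r_square_integrable: "integrable lborel (\<lambda>x. (r x)\<^sup>2)"
    and r_nonneg: "r x \<ge> 0"
begin

lemma K_measurable' [measurable]:
  "f \<in> M \<rightarrow>\<^sub>M borel \<Longrightarrow> g \<in> M \<rightarrow>\<^sub>M borel \<Longrightarrow> (\<lambda>z. K (f z) (g z)) \<in> borel_measurable M"
  using measurable_compose[OF measurable_Pair K_measurable, of f M g] by simp

definition Kop :: "('a \<Rightarrow> complex) \<Rightarrow> 'a \<Rightarrow> complex" where
  "Kop f x = (LINT y|lborel. of_real (K x y) * f y)"

text \<open>The square of the Hilbert-Schmidt norm.\<close>

definition hilbert_schmidt :: real where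
  "hilbert_schmidt = (LINT x|lborel. LINT y|lborel. (K x y)\<^sup>2)"

definition rnorm :: real where "rnorm = L2_norm (\<lambda>x. of_real (r x))"

lemma r_L2: "(\<lambda>x. of_real (r x)) \<in> L2"
  using r_square_integrable by (intro L2_I) simp_all

lemma rnorm_nonneg: "rnorm \<ge> 0" and rnorm_power2: "rnorm\<^sup>2 = (LINT x|lborel. (r x)\<^sup>2)"
  by (simp_all add: rnorm_def L2_norm_power2)

lemma K_bound2: "(K x y)\<^sup>2 \<le> (r x)\<^sup>2 * (r y)\<^sup>2"
  using power_mono[OF K_bound[of x y], of 2] by (simp add: power_mult_distrib)

lemma K_row_L2: "(\<lambda>y. of_real (K x y)) \<in> L2"
proof (rule L2_dominated)
  show "integrable lborel (\<lambda>y. (r x)\<^sup>2 * (r y)\<^sup>2)" using r_square_integrable by simp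
qed (use K_bound2 in simp_all)

lemma K_row_norm: "(L2_norm (\<lambda>y. of_real (K x y)))\<^sup>2 = (LINT y|lborel. (K x y)\<^sup>2)"
  by (simp add: L2_norm_power2)

lemma Kop_integrable: "f \<in> L2 \<Longrightarrow> integrable lborel (\<lambda>y. of_real (K x y) * f y)"
  by (intro L2_mult_integrable K_row_L2)

lemma Kop_measurable:
  assumes "f \<in> L2"
  shows "Kop f \<in> borel_measurable borel"
proof -
  have [measurable]: "f \<in> borel_measurable borel" using assms by (rule L2_measurable)
  show ?thesis unfolding Kop_def[abs_def] by measurable
qed

lemma Kop_bound_row:
  assumes "f \<in> L2"
  shows "(cmod (Kop f x))\<^sup>2 \<le> (LINT y|lborel. (K x y)\<^sup>2) * (L2_norm f)\<^sup>2"
proof -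
  have "Kop f x = L2_inner (\<lambda>y. of_real (K x y)) f"
    by (simp add: Kop_def L2_inner_def)
  then have "cmod (Kop f x) \<le> L2_norm (\<lambda>y. of_real (K x y)) * L2_norm f"
    using L2_Cauchy_Schwarz[OF K_row_L2 assms] by simp
  from power_mono[OF this, of 2] show ?thesis
    by (simp only: power_mult_distrib K_row_norm norm_ge_zero)
qed

lemma K_row_integral_le: "(LINT y|lborel. (K x y)\<^sup>2) \<le> (r x)\<^sup>2 * rnorm\<^sup>2"
proof -
  have "(LINT y|lborel. (K x y)\<^sup>2) \<le> (LINT y|lborel. (r x)\<^sup>2 * (r y)\<^sup>2)"
    using K_bound2 L2_integrable[OF K_row_L2[of x]] r_square_integrable by (intro integral_mono) simp_all
  then show ?thesis by (simp add: rnorm_power2)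
qed

lemma K_square_integrable: "integrable lborel (\<lambda>x. LINT y|lborel. (K x y)\<^sup>2)"
proof (rule Bochner_Integration.integrable_bound)
  show "integrable lborel (\<lambda>x. (r x)\<^sup>2 * rnorm\<^sup>2)" using r_square_integrable by simp
  show "AE x in lborel. norm (LINT y|lborel. (K x y)\<^sup>2) \<le> norm ((r x)\<^sup>2 * rnorm\<^sup>2)"
    using K_row_integral_le by (intro AE_I2) (simp add: abs_of_nonneg integral_nonneg_AE)
qed simp

lemma Kop_L2: "f \<in> L2 \<Longrightarrow> Kop f \<in> L2"
  by (rule L2_dominated[OF Kop_measurable _ Kop_bound_row]) (simp_all add: K_square_integrable)

lemma Kop_norm: 
  assumes f: "f \<in> L2"
  shows "(L2_norm (Kop f))\<^sup>2 \<le> hilbert_schmidt * (L2_norm f)\<^sup>2"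
proof -
  have "(LINT x|lborel. (cmod (Kop f x))\<^sup>2) \<le> (LINT x|lborel. (LINT y|lborel. (K x y)\<^sup>2) * (L2_norm f)\<^sup>2)"
    using K_square_integrable Kop_L2[OF f] by (intro integral_mono Kop_bound_row f) (simp_all add: L2_integrable)
  then show ?thesis by (simp add: L2_norm_power2[of "Kop f"] hilbert_schmidt_def)
qed

lemma hilbert_schmidt_nonneg: "hilbert_schmidt \<ge> 0"
  unfolding hilbert_schmidt_def by (intro integral_nonneg_AE AE_I2) simp

lemma Kop_linear:
  assumes "f \<in> L2" "g \<in> L2"
  shows "Kop (\<lambda>y. a * f y + b * g y) x = a * Kop f x + b * Kop g x"
proof -
  have "of_real (K x y) * (a * f y + b * g y) = a * (of_real (K x y) * f y) + b * (of_real (K x y) * g y)" for y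
    by (simp add: algebra_simps)
  then show ?thesis
    using Kop_integrable[OF assms(1), of x] Kop_integrable[OF assms(2), of x] by (simp add: Kop_def)
qed

lemma Kop_cong_AE:
  assumes "f \<in> L2" "g \<in> L2" "AE y in lborel. f y = g y"
  shows "Kop f x = Kop g x"
  unfolding Kop_def
proof (rule integral_cong_AE)
  show "AE y in lborel. of_real (K x y) * f y = of_real (K x y) * g y"
    using assms(3) by eventually_elim simp
qed (use Kop_integrable[OF assms(1), of x] Kop_integrable[OF assms(2), of x] in auto)

lemma Kop_operator: "L2_operator Kop"
  unfolding L2_operator_def
proof (intro conjI ballI allI exI)
  fix f :: "'a \<Rightarrow> complex" assume f: "f \<in> L2"
  show "Kop f \<in> L2" using f by (rule Kop_L2)
  show "L2_norm (Kop f) \<le> sqrt hilbert_schmidt * L2_norm f"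
    by (rule power2_le_imp_le)
      (use Kop_norm[OF f] in \<open>simp_all add: power_mult_distrib hilbert_schmidt_nonneg\<close>)
qed (simp add: Kop_linear)

lemma Kop_self_adjoint:
  assumes f: "f \<in> L2" and g: "g \<in> L2"
  shows "L2_inner f (Kop g) = L2_inner (Kop f) g"
proof -
  have [measurable]: "f \<in> borel_measurable borel" "g \<in> borel_measurable borel"
    using f g by (auto dest: L2_measurable)
  let ?F = "\<lambda>(x, y). cnj (f x) * (of_real (K x y) * g y)"
  have int: "integrable (lborel \<Otimes>\<^sub>M lborel) ?F"
  proof (rule pair_integrable_bounded_product)
    show "integrable lborel (\<lambda>x. r x * cmod (f x))" "integrable lborel (\<lambda>x. r x * cmod (g x))"
      using L2_norm_mult_integrable[OF r_L2 f] L2_norm_mult_integrable[OF r_L2 g]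
      by (simp_all add: abs_of_nonneg r_nonneg)
    show "cmod (?F (x, y)) \<le> r x * cmod (f x) * (r y * cmod (g y))" for x y
      using mult_right_mono[OF K_bound[of x y], of "cmod (f x) * cmod (g y)"]
      by (simp add: norm_mult mult_ac)
  qed measurable
  have "L2_inner f (Kop g) = (LINT x|lborel. LINT y|lborel. cnj (f x) * (of_real (K x y) * g y))"
    by (simp add: L2_inner_def Kop_def)
  also have "\<dots> = (LINT y|lborel. LINT x|lborel. cnj (f x) * (of_real (K x y) * g y))"
    using lborel_pair.Fubini_integral[OF int] by simp
  also have "\<dots> = (LINT y|lborel. cnj (Kop f y) * g y)"
  proof (rule Bochner_Integration.integral_cong[OF refl])
    fix y
    have "(LINT x|lborel. cnj (f x) * (of_real (K x y) * g y)) =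
        (LINT x|lborel. cnj (of_real (K y x) * f x) * g y)"
      by (intro Bochner_Integration.integral_cong refl) (simp add: K_sym[of y] mult_ac)
    also have "\<dots> = (LINT x|lborel. cnj (of_real (K y x) * f x)) * g y"
      by (rule integral_mult_left_zero)
    also have "\<dots> = cnj (Kop f y) * g y"
      unfolding Kop_def by (simp only: Bochner_Integration.integral_cnj)
    finally show "(LINT x|lborel. cnj (f x) * (of_real (K x y) * g y)) = cnj (Kop f y) * g y" .
  qed
  finally show ?thesis by (simp add: L2_inner_def)
qed

text \<open>For fixed x the values of \<open>Kop (e i)\<close> at x are the coefficients of the row
  of the kernel at x. Parseval sums their squares over i, and integrating over x gives the claim by
  monotone convergence.\<close>

lemma Kop_onb_sums:
  assumes e: "orthonormal_basis e"
  shows "(\<lambda>i. (L2_norm (Kop (e i)))\<^sup>2) sums hilbert_schmidt"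
proof (rule sums_of_suminf_ennreal[OF _ hilbert_schmidt_nonneg])
  have eL2: "e i \<in> L2" for i using e by (simp add: orthonormal_basis_def)
  have [measurable]: "Kop (e i) \<in> borel_measurable borel" for i
    by (intro Kop_measurable eL2)
  have row: "(\<Sum>i. ennreal ((cmod (Kop (e i) x))\<^sup>2)) = ennreal (LINT y|lborel. (K x y)\<^sup>2)" for x
  proof (rule suminf_ennreal_of_sums)
    have "Kop (e i) x = L2_inner (\<lambda>y. of_real (K x y)) (e i)" for i
      by (simp add: Kop_def L2_inner_def)
    then show "(\<lambda>i. (cmod (Kop (e i) x))\<^sup>2) sums (LINT y|lborel. (K x y)\<^sup>2)"
      using L2_parseval[OF e K_row_L2, of x] by (simp add: cmod_L2_inner_commute K_row_norm)
  qed simp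
  have "(\<Sum>i. ennreal ((L2_norm (Kop (e i)))\<^sup>2)) = (\<Sum>i. \<integral>\<^sup>+x. ennreal ((cmod (Kop (e i) x))\<^sup>2) \<partial>lborel)"
    by (intro suminf_cong nn_integral_L2[symmetric] Kop_L2 eL2)
  also have "\<dots> = (\<integral>\<^sup>+x. (\<Sum>i. ennreal ((cmod (Kop (e i) x))\<^sup>2)) \<partial>lborel)"
    by (intro nn_integral_suminf[symmetric]) simp
  also have "\<dots> = ennreal hilbert_schmidt"
    unfolding row hilbert_schmidt_def
    by (intro nn_integral_eq_integral K_square_integrable AE_I2 integral_nonneg_AE) simp
  finally show "(\<Sum>i. ennreal ((L2_norm (Kop (e i)))\<^sup>2)) = ennreal hilbert_schmidt" .
qed simp

text \<open>By self-adjointness the diagonal entries of the squared operator are the squared norms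
  of \<open>Kop (e i)\<close>, whose sum is known for every basis.\<close>

lemma has_purity_of_kernel:
  assumes op: "L2_operator \<rho>" and eq: "\<And>f. f \<in> L2 \<Longrightarrow> AE x in lborel. \<rho> f x = Kop f x"
  shows "has_purity \<rho> hilbert_schmidt"
proof -
  have \<rho>L2: "\<rho> f \<in> L2" if "f \<in> L2" for f using op that by (simp add: L2_operator_def)
  have eq2: "AE x in lborel. \<rho> (\<rho> f) x = Kop (Kop f) x" if f: "f \<in> L2" for f
    using eq[OF \<rho>L2[OF f]] by eventually_elim (simp add: Kop_cong_AE[OF \<rho>L2[OF f] Kop_L2[OF f] eq[OF f]])
  have "L2_operator (\<rho> \<circ> \<rho>)"
    unfolding L2_operator_def
  proof (intro conjI ballI allI)
    fix f g :: "'a \<Rightarrow> complex" and a b assume f: "f \<in> L2" and g: "g \<in> L2"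
    have fg: "(\<lambda>y. a * f y + b * g y) \<in> L2" by (intro L2_add L2_cmult f g)
    have lin: "Kop (\<lambda>y. a * f y + b * g y) = (\<lambda>y. a * Kop f y + b * Kop g y)"
      by (rule ext) (rule Kop_linear[OF f g])
    show "AE x in lborel. (\<rho> \<circ> \<rho>) (\<lambda>y. a * f y + b * g y) x = a * (\<rho> \<circ> \<rho>) f x + b * (\<rho> \<circ> \<rho>) g x"
      using eq2[OF fg] eq2[OF f] eq2[OF g]
      by eventually_elim (simp add: lin Kop_linear Kop_L2 f g)
  next
    obtain C where C: "\<And>f. f \<in> L2 \<Longrightarrow> L2_norm (\<rho> f) \<le> C * L2_norm f"
      using op unfolding L2_operator_def by blast
    have "L2_norm (\<rho> (\<rho> f)) \<le> \<bar>C\<bar> * \<bar>C\<bar> * L2_norm f" if f: "f \<in> L2" for f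
    proof -
      have abs: "L2_norm (\<rho> f) \<le> \<bar>C\<bar> * L2_norm f" if "f \<in> L2" for f
        by (rule order_trans[OF C[OF that]]) (simp add: mult_right_mono)
      have "L2_norm (\<rho> (\<rho> f)) \<le> \<bar>C\<bar> * (\<bar>C\<bar> * L2_norm f)"
        by (rule order_trans[OF abs[OF \<rho>L2[OF f]]]) (intro mult_left_mono abs f, simp)
      then show ?thesis by (simp add: mult.assoc)
    qed
    then show "\<exists>C. \<forall>f\<in>L2. L2_norm ((\<rho> \<circ> \<rho>) f) \<le> C * L2_norm f" by auto
  qed (simp add: \<rho>L2)
  moreover have "(\<lambda>i. L2_inner (e i) ((\<rho> \<circ> \<rho>) (e i))) sums of_real hilbert_schmidt"
    if e: "orthonormal_basis e" for e
  proof -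
    have eL2: "e i \<in> L2" for i using e by (simp add: orthonormal_basis_def)
    have "L2_inner (e i) ((\<rho> \<circ> \<rho>) (e i)) = of_real ((L2_norm (Kop (e i)))\<^sup>2)" for i
    proof -
      have "L2_inner (e i) ((\<rho> \<circ> \<rho>) (e i)) = L2_inner (e i) (Kop (Kop (e i)))"
        using eq2[OF eL2] by (intro L2_inner_cong_AE) (simp_all add: eL2 \<rho>L2 Kop_L2)
      also have "\<dots> = of_real ((L2_norm (Kop (e i)))\<^sup>2)"
        by (simp only: Kop_self_adjoint[OF eL2 Kop_L2[OF eL2]] L2_inner_self)
      finally show ?thesis .
    qed
    then show ?thesis using sums_of_real[OF Kop_onb_sums[OF e], where 'a = complex] by simp
  qed
  ultimately show ?thesis by (simp add: has_purity_def has_trace_def)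
qed

text \<open>The vector of a pure state is fixed by the operator, but the Hilbert-Schmidt norm bounds
  the operator norm, and it is below one.\<close>

lemma mixed_state_of_kernel:
  assumes q: "quantum_state \<rho>" and eq: "\<And>f. f \<in> L2 \<Longrightarrow> AE x in lborel. \<rho> f x = Kop f x"
    and hs: "hilbert_schmidt < 1"
  shows "mixed_state \<rho>"
proof -
  have "\<not> pure_state \<rho>"
  proof
    assume "pure_state \<rho>"
    then obtain \<psi> where \<psi>: "\<psi> \<in> L2" "L2_norm \<psi> = 1"
      and pure: "\<And>f. f \<in> L2 \<Longrightarrow> AE x in lborel. \<rho> f x = ketbra \<psi> f x"
      by (auto simp: pure_state_def unit_L2_def)
    have "AE x in lborel. \<psi> x = Kop \<psi> x"
      using pure[OF \<psi>(1)] eq[OF \<psi>(1)]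
      by eventually_elim (simp add: ketbra_def L2_inner_self \<psi>)
    then have "L2_norm (Kop \<psi>) = 1"
      using L2_norm_cong_AE[OF \<psi>(1) Kop_L2[OF \<psi>(1)]] \<psi>(2) by simp
    with Kop_norm[OF \<psi>(1)] \<psi>(2) hs show False by simp
  qed
  with q show ?thesis by (simp add: mixed_state_def)
qed

text \<open>The partial sums applied to f converge to \<rho> f in norm by the decomposition, and
  almost everywhere to \<open>Kop f\<close> by termwise integration of the kernel series in y. The
  latter works at each x where the sum of \<mu> j |\<psi> j x|^2 is finite, which is almost every x
  because this sum has integral one.\<close>

lemma kernel_of_decomposition:
  assumes dec: "state_decomposition \<rho> \<mu> \<psi>" and op: "L2_operator \<rho>"
    and ker: "AE x in lborel. AE y in lborel. (\<lambda>j. of_real (\<mu> j) * (\<psi> j x * cnj (\<psi> j y))) sums of_real (K x y)"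
    and f: "f \<in> L2"
  shows "AE x in lborel. \<rho> f x = Kop f x"
proof (rule L2_limit_AE_unique)
  have \<psi>: "\<psi> j \<in> L2" "L2_norm (\<psi> j) = 1" and \<mu>0: "\<mu> j \<ge> 0" and \<mu>: "\<mu> sums 1" for j
    using dec by (auto simp: state_decomposition_def unit_L2_def)
  have [measurable]: "\<psi> j \<in> borel_measurable borel" "f \<in> borel_measurable borel" for j
    using \<psi> f by (auto dest: L2_measurable)
  show "\<rho> f \<in> L2" using op f by (simp add: L2_operator_def)
  show "Kop f \<in> borel_measurable borel" using f by (rule Kop_measurable)
  define s where "s N = (\<lambda>x. \<Sum>j<N. of_real (\<mu> j) * ketbra (\<psi> j) f x)" for N
  show "s N \<in> L2" for N
    unfolding s_def ketbra_def by (intro L2_sum L2_cmult \<psi>)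
  show "(\<lambda>N. L2_norm (\<lambda>x. \<rho> f x - s N x)) \<longlonglongrightarrow> 0"
    using dec f by (simp add: state_decomposition_def s_def)
  have "(\<integral>\<^sup>+x. (\<Sum>j. ennreal (\<mu> j * (cmod (\<psi> j x))\<^sup>2)) \<partial>lborel) =
      (\<Sum>j. \<integral>\<^sup>+x. ennreal (\<mu> j) * ennreal ((cmod (\<psi> j x))\<^sup>2) \<partial>lborel)"
    using \<mu>0 by (subst nn_integral_suminf) (simp_all add: ennreal_mult)
  also have "\<dots> = (\<Sum>j. ennreal (\<mu> j))"
    using \<psi> by (simp add: nn_integral_cmult nn_integral_L2)
  also have "\<dots> = ennreal 1" using \<mu>0 \<mu> by (rule suminf_ennreal_of_sums)
  finally have "AE x in lborel. (\<Sum>j. ennreal (\<mu> j * (cmod (\<psi> j x))\<^sup>2)) \<noteq> \<infinity>"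
    by (intro nn_integral_noteq_infinite) auto
  then have fin: "AE x in lborel. summable (\<lambda>j. \<mu> j * (cmod (\<psi> j x))\<^sup>2)"
    by eventually_elim (use \<mu>0 in \<open>auto intro!: summable_suminf_not_top\<close>)
  show "AE x in lborel. (\<lambda>N. s N x) \<longlonglongrightarrow> Kop f x"
    using fin ker
  proof eventually_elim
    case (elim x)
    define F where "F j y = of_real (\<mu> j) * (\<psi> j x * cnj (\<psi> j y)) * f y" for j y
    have int_F: "integrable lborel (F j)" for j
      using L2_inner_integrable[OF \<psi>(1) f, of j] unfolding F_def
      by (simp add: mult.assoc)
    then have [measurable]: "F j \<in> borel_measurable borel" for j
      using borel_measurable_integrable by force
    \<comment> \<open>Cauchy-Schwarz in y, then |c| <= |c|^2 + 1 for c = \<open>\<psi> j x\<close>,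
      which leaves two series known to converge.\<close>
    have norm_F: "(LINT y|lborel. norm (F j y)) \<le> (\<mu> j * (cmod (\<psi> j x))\<^sup>2 + \<mu> j) * L2_norm f" for j
    proof -
      have "(LINT y|lborel. norm (F j y)) = \<mu> j * cmod (\<psi> j x) * (LINT y|lborel. cmod (\<psi> j y) * cmod (f y))"
        using \<mu>0 by (simp add: F_def norm_mult mult.assoc)
      also have "\<dots> \<le> \<mu> j * cmod (\<psi> j x) * (1 * L2_norm f)"
        using L2_Cauchy_Schwarz_norm[OF \<psi>(1) f, of j] \<psi>(2)[of j] \<mu>0 by (intro mult_left_mono) simp_all
      also have "\<dots> \<le> \<mu> j * ((cmod (\<psi> j x))\<^sup>2 + 1) * (1 * L2_norm f)"
        using cmod_mult_le_sum_power2[of "\<psi> j x" 1] \<mu>0 by (intro mult_right_mono mult_left_mono) simp_all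
      finally show ?thesis by (simp add: algebra_simps)
    qed
    have sum_F: "summable (\<lambda>j. LINT y|lborel. norm (F j y))"
    proof (rule summable_comparison_test')
      show "summable (\<lambda>j. (\<mu> j * (cmod (\<psi> j x))\<^sup>2 + \<mu> j) * L2_norm f)"
        using elim(1) \<mu> by (intro summable_mult2 summable_add) (auto simp: sums_iff)
    qed (use norm_F in simp)
    have "AE y in lborel. summable (\<lambda>j. norm (F j y))"
    proof -
      have "(\<integral>\<^sup>+y. (\<Sum>j. ennreal (norm (F j y))) \<partial>lborel) = (\<Sum>j. ennreal (LINT y|lborel. norm (F j y)))"
        using int_F by (subst nn_integral_suminf)
          (auto intro!: suminf_cong nn_integral_eq_integral integrable_norm)
      also have "\<dots> \<noteq> \<infinity>"
        using sum_F by (simp add: suminf_ennreal2)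
      finally have "AE y in lborel. (\<Sum>j. ennreal (norm (F j y))) \<noteq> \<infinity>"
        by (intro nn_integral_noteq_infinite) auto
      then show ?thesis by eventually_elim (auto intro!: summable_suminf_not_top)
    qed
    from sums_integral[OF int_F this sum_F]
    have "(\<lambda>j. integral\<^sup>L lborel (F j)) sums (LINT y|lborel. (\<Sum>j. F j y))" .
    moreover have "(LINT y|lborel. (\<Sum>j. F j y)) = Kop f x"
      unfolding Kop_def
    proof (rule integral_cong_AE)
      show "AE y in lborel. (\<Sum>j. F j y) = of_real (K x y) * f y"
        using elim(2)
      proof eventually_elim
        case (elim y)
        then show ?case
          unfolding F_def by (intro sums_unique[symmetric] sums_mult2)
      qed
    qed (simp_all add: F_def)
    moreover have "integral\<^sup>L lborel (F j) = of_real (\<mu> j) * ketbra (\<psi> j) f x" for j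
    proof -
      have "F j = (\<lambda>y. of_real (\<mu> j) * \<psi> j x * (cnj (\<psi> j y) * f y))"
        by (simp add: F_def fun_eq_iff)
      then show ?thesis
        by (simp only: ketbra_def L2_inner_def integral_mult_right_zero) (simp only: mult_ac)
    qed
    ultimately show ?case by (simp add: sums_def s_def)
  qed
qed

end

section \<open>Wigner distributions\<close>

lemma AE_affine:
  fixes t :: "'a::euclidean_space"
  assumes "AE u in lborel. P u" and c: "c \<noteq> 0"
  shows "AE y in lborel. P (t + c *\<^sub>R y)"
proof -
  obtain N where N: "{u. \<not> P u} \<subseteq> N" "N \<in> sets borel" "emeasure lborel N = 0"
    using assms(1) by (auto simp: eventually_ae_filter null_sets_def)
  have [measurable]: "N \<in> sets borel" by fact
  have "(\<integral>\<^sup>+x. indicator N x \<partial>lborel) = ennreal (\<bar>c\<bar> ^ DIM('a)) * (\<integral>\<^sup>+y. indicator N (t + c *\<^sub>R y) \<partial>lborel)"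
    by (rule nn_integral_affine_substitution[OF c]) simp
  then have "(\<integral>\<^sup>+y. indicator N (t + c *\<^sub>R y) \<partial>lborel) = 0"
    using N(3) c by simp
  then have "AE y in lborel. indicator N (t + c *\<^sub>R y) = (0 :: ennreal)"
    by (subst (asm) nn_integral_0_iff_AE) simp_all
  then show ?thesis
    by eventually_elim (use N(1) in \<open>auto simp: indicator_def split: if_splits\<close>)
qed

text \<open>The map from (x, y) to (x + y/2, x - y/2) preserves measure; here it is composed of two
  translations, in x by y/2 and then in y by x, each performed inside a Tonelli exchange.\<close>

lemma nn_integral_midpoint:
  fixes f :: "'a::euclidean_space \<times> 'a \<Rightarrow> ennreal"
  assumes [measurable]: "f \<in> borel_measurable (borel \<Otimes>\<^sub>M borel)"
  shows "(\<integral>\<^sup>+x. \<integral>\<^sup>+y. f (x + (1/2) *\<^sub>R y, x - (1/2) *\<^sub>R y) \<partial>lborel \<partial>lborel) =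
    (\<integral>\<^sup>+u. \<integral>\<^sup>+v. f (u, v) \<partial>lborel \<partial>lborel)"
proof -
  have shift: "(\<integral>\<^sup>+x. g (t + x) \<partial>lborel) = (\<integral>\<^sup>+x. g x \<partial>lborel)"
    if "g \<in> borel_measurable borel" for g :: "'a \<Rightarrow> ennreal" and t
    using nn_integral_affine_substitution[OF _ that, of 1 t] by simp
  have "(\<integral>\<^sup>+x. \<integral>\<^sup>+y. f (x + (1/2) *\<^sub>R y, x - (1/2) *\<^sub>R y) \<partial>lborel \<partial>lborel) =
      (\<integral>\<^sup>+y. \<integral>\<^sup>+x. f (x + (1/2) *\<^sub>R y, x - (1/2) *\<^sub>R y) \<partial>lborel \<partial>lborel)"
    by (rule lborel_pair.Fubini'[symmetric]) simp
  also have "\<dots> = (\<integral>\<^sup>+y. \<integral>\<^sup>+x. f (x + y, x) \<partial>lborel \<partial>lborel)"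
  proof (rule nn_integral_cong)
    fix y :: 'a
    have half: "(1/2) *\<^sub>R y + (1/2) *\<^sub>R y = y" by (simp flip: scaleR_add_left)
    have "(\<integral>\<^sup>+x. f (x + y, x) \<partial>lborel) = (\<integral>\<^sup>+x. f (- ((1/2) *\<^sub>R y) + x + y, - ((1/2) *\<^sub>R y) + x) \<partial>lborel)"
      by (rule shift[symmetric]) simp
    moreover have "(- ((1/2) *\<^sub>R y) + x + y, - ((1/2) *\<^sub>R y) + x) = (x + (1/2) *\<^sub>R y, x - (1/2) *\<^sub>R y)" for x
      by (subst (2) half[symmetric]) (simp add: algebra_simps)
    ultimately show "(\<integral>\<^sup>+x. f (x + (1/2) *\<^sub>R y, x - (1/2) *\<^sub>R y) \<partial>lborel) = (\<integral>\<^sup>+x. f (x + y, x) \<partial>lborel)"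
      by (simp only:)
  qed
  also have "\<dots> = (\<integral>\<^sup>+x. \<integral>\<^sup>+y. f (x + y, x) \<partial>lborel \<partial>lborel)"
    by (rule lborel_pair.Fubini') simp
  also have "\<dots> = (\<integral>\<^sup>+x. \<integral>\<^sup>+u. f (u, x) \<partial>lborel \<partial>lborel)"
    by (intro nn_integral_cong shift) simp
  also have "\<dots> = (\<integral>\<^sup>+u. \<integral>\<^sup>+v. f (u, v) \<partial>lborel \<partial>lborel)"
    by (rule lborel_pair.Fubini') simp
  finally show ?thesis .
qed

text \<open>A Wigner transform at position x sees only the pairs with midpoint x. This lemma
  collects what holds on each of these lines into a statement about almost all pairs.\<close>

lemma AE_midpoint:
  fixes P :: "'a::euclidean_space \<Rightarrow> 'a \<Rightarrow> bool"
  assumes [measurable]: "Measurable.pred (borel \<Otimes>\<^sub>M borel) (\<lambda>z. P (fst z) (snd z))"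
    and P: "\<And>x. AE y in lborel. P (x + (1/2) *\<^sub>R y) (x - (1/2) *\<^sub>R y)"
  shows "AE u in lborel. AE v in lborel. P u v"
proof -
  define f :: "'a \<times> 'a \<Rightarrow> ennreal" where "f = indicator {z. \<not> P (fst z) (snd z)}"
  have [measurable]: "{z. \<not> P (fst z) (snd z)} \<in> sets (borel \<Otimes>\<^sub>M borel)"
  proof -
    have "{z \<in> space (borel \<Otimes>\<^sub>M borel). \<not> P (fst z) (snd z)} \<in> sets (borel \<Otimes>\<^sub>M borel)"
      by measurable
    then show ?thesis by (simp add: space_pair_measure)
  qed
  have [measurable]: "f \<in> borel_measurable (borel \<Otimes>\<^sub>M borel)"
    unfolding f_def by measurable
  have "(\<integral>\<^sup>+y. f (x + (1/2) *\<^sub>R y, x - (1/2) *\<^sub>R y) \<partial>lborel) = 0" for x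
    by (subst nn_integral_0_iff_AE) (use P[of x] in \<open>auto simp: f_def elim: eventually_mono\<close>)
  then have "(\<integral>\<^sup>+u. \<integral>\<^sup>+v. f (u, v) \<partial>lborel \<partial>lborel) = 0"
    using nn_integral_midpoint[of f] by simp
  then have "AE u in lborel. (\<integral>\<^sup>+v. f (u, v) \<partial>lborel) = 0"
    by (subst (asm) nn_integral_0_iff_AE) simp_all
  then show ?thesis
  proof eventually_elim
    case (elim u)
    then have "AE v in lborel. f (u, v) = 0"
      by (subst (asm) nn_integral_0_iff_AE) simp_all
    then show ?case by eventually_elim (simp add: f_def indicator_def split: if_splits)
  qed
qed

text \<open>The product is at most the sum of the two squares, and each substitution with factor 1/2
  or -1/2 contributes 2 ^ DIM. The bound does not depend on x, so it can be summed over a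
  mixture.\<close>

lemma L2_midpoint_integrable:
  fixes \<psi> :: "'a::euclidean_space \<Rightarrow> complex"
  assumes \<psi>: "\<psi> \<in> L2"
  shows "integrable lborel (\<lambda>y. \<psi> (x + (1/2) *\<^sub>R y) * cnj (\<psi> (x - (1/2) *\<^sub>R y)))"
    and "(LINT y|lborel. norm (\<psi> (x + (1/2) *\<^sub>R y) * cnj (\<psi> (x - (1/2) *\<^sub>R y))))
      \<le> 2 * 2 ^ DIM('a) * (L2_norm \<psi>)\<^sup>2"
proof -
  have [measurable]: "\<psi> \<in> borel_measurable borel" using \<psi> by (rule L2_measurable)
  have h: "has_bochner_integral lborel (\<lambda>y. (cmod (\<psi> (x + c *\<^sub>R y)))\<^sup>2) (2 ^ DIM('a) * (L2_norm \<psi>)\<^sup>2)"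
    if "c = 1/2 \<or> c = - (1/2)" for c :: real
  proof -
    have "has_bochner_integral lborel (\<lambda>x. (cmod (\<psi> x))\<^sup>2) ((L2_norm \<psi>)\<^sup>2)"
      using \<psi> by (simp add: has_bochner_integral_iff L2_integrable L2_norm_power2)
    moreover have "c \<noteq> 0" and abs: "\<bar>c\<bar> = 1/2" using that by auto
    moreover have "inverse (\<bar>c\<bar> ^ DIM('a)) = 2 ^ DIM('a)" unfolding abs by (simp add: power_one_over)
    ultimately show ?thesis
      using has_bochner_integral_affine_substitution[of c "\<lambda>x. (cmod (\<psi> x))\<^sup>2" "(L2_norm \<psi>)\<^sup>2" x]
      by simp
  qed
  let ?g = "\<lambda>y. (cmod (\<psi> (x + (1/2) *\<^sub>R y)))\<^sup>2 + (cmod (\<psi> (x + (- (1/2)) *\<^sub>R y)))\<^sup>2"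
  have g: "has_bochner_integral lborel ?g (2 ^ DIM('a) * (L2_norm \<psi>)\<^sup>2 + 2 ^ DIM('a) * (L2_norm \<psi>)\<^sup>2)"
    by (intro has_bochner_integral_add h) auto
  have bound: "norm (\<psi> (x + (1/2) *\<^sub>R y) * cnj (\<psi> (x - (1/2) *\<^sub>R y))) \<le> ?g y" for y
    using cmod_mult_le_sum_power2[of "\<psi> (x + (1/2) *\<^sub>R y)" "\<psi> (x - (1/2) *\<^sub>R y)"]
    by (simp add: norm_mult)
  show int: "integrable lborel (\<lambda>y. \<psi> (x + (1/2) *\<^sub>R y) * cnj (\<psi> (x - (1/2) *\<^sub>R y)))"
    by (rule Bochner_Integration.integrable_bound[of _ ?g])
       (use g bound in \<open>auto simp: has_bochner_integral_iff intro!: AE_I2 order_trans[OF bound]\<close>)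
  have "(LINT y|lborel. norm (\<psi> (x + (1/2) *\<^sub>R y) * cnj (\<psi> (x - (1/2) *\<^sub>R y)))) \<le> integral\<^sup>L lborel ?g"
    using g int by (intro integral_mono bound integrable_norm) (auto simp: has_bochner_integral_iff)
  then show "(LINT y|lborel. norm (\<psi> (x + (1/2) *\<^sub>R y) * cnj (\<psi> (x - (1/2) *\<^sub>R y))))
      \<le> 2 * 2 ^ DIM('a) * (L2_norm \<psi>)\<^sup>2"
    using g by (simp add: has_bochner_integral_iff mult_ac)
qed

text \<open>The integral kernel of \<mu> j |\<psi> j><\<psi> j|.\<close>

definition mixture_term ::
  "(nat \<Rightarrow> real) \<Rightarrow> (nat \<Rightarrow> 'a::euclidean_space \<Rightarrow> complex) \<Rightarrow> nat \<Rightarrow> 'a \<Rightarrow> 'a \<Rightarrow> complex" where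
  "mixture_term \<mu> \<psi> j u v = of_real (\<mu> j) * (\<psi> j u * cnj (\<psi> j v))"

text \<open>On the line of pairs with midpoint x the integrals of the moduli are bounded by a
  multiple of the weights, so the series converges absolutely almost everywhere and may be
  integrated termwise against any bounded \<open>\<phi>\<close>, in particular against a Fourier
  phase. This holds for every x, not just almost every one.\<close>

lemma mixture_midpoint_sums:
  fixes \<psi> :: "nat \<Rightarrow> 'a::euclidean_space \<Rightarrow> complex" and \<phi> :: "'a \<Rightarrow> complex"
  assumes dec: "state_decomposition \<rho> \<mu> \<psi>"
    and [measurable]: "\<phi> \<in> borel_measurable borel" and \<phi>: "\<And>y. cmod (\<phi> y) \<le> 1"
  defines "G x y \<equiv> (\<Sum>j. mixture_term \<mu> \<psi> j (x + (1/2) *\<^sub>R y) (x - (1/2) *\<^sub>R y))"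
  shows "AE y in lborel. (\<lambda>j. mixture_term \<mu> \<psi> j (x + (1/2) *\<^sub>R y) (x - (1/2) *\<^sub>R y)) sums G x y"
    and "integrable lborel (G x)"
    and "(\<lambda>j. LINT y|lborel. \<phi> y * mixture_term \<mu> \<psi> j (x + (1/2) *\<^sub>R y) (x - (1/2) *\<^sub>R y)) sums
      (LINT y|lborel. \<phi> y * G x y)"
proof -
  have \<psi>: "\<psi> j \<in> L2" "L2_norm (\<psi> j) = 1" and \<mu>0: "\<mu> j \<ge> 0" and \<mu>: "\<mu> sums 1" for j
    using dec by (auto simp: state_decomposition_def unit_L2_def)
  define F where "F j y = mixture_term \<mu> \<psi> j (x + (1/2) *\<^sub>R y) (x - (1/2) *\<^sub>R y)" for j y
  have int_F: "integrable lborel (F j)" for j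
    unfolding F_def mixture_term_def by (intro integrable_mult_right L2_midpoint_integrable \<psi>)
  then have [measurable]: "F j \<in> borel_measurable borel" for j
    using borel_measurable_integrable by force
  have norm_F: "(LINT y|lborel. norm (F j y)) \<le> \<mu> j * (2 * 2 ^ DIM('a))" for j
  proof -
    have "(LINT y|lborel. norm (F j y)) =
        \<mu> j * (LINT y|lborel. norm (\<psi> j (x + (1/2) *\<^sub>R y) * cnj (\<psi> j (x - (1/2) *\<^sub>R y))))"
      using \<mu>0 by (simp add: F_def mixture_term_def norm_mult)
    also have "\<dots> \<le> \<mu> j * (2 * 2 ^ DIM('a) * (L2_norm (\<psi> j))\<^sup>2)"
      by (intro mult_left_mono L2_midpoint_integrable \<psi> \<mu>0)
    finally show ?thesis by (simp add: \<psi>)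
  qed
  have sum_F: "summable (\<lambda>j. LINT y|lborel. norm (F j y))"
  proof (rule summable_comparison_test')
    show "summable (\<lambda>j. \<mu> j * (2 * 2 ^ DIM('a)))"
      using \<mu> by (intro summable_mult2) (auto simp: sums_iff)
  qed (use norm_F in simp)
  have AE_F: "AE y in lborel. summable (\<lambda>j. norm (F j y))"
  proof -
    have "(\<integral>\<^sup>+y. (\<Sum>j. ennreal (norm (F j y))) \<partial>lborel) = (\<Sum>j. ennreal (LINT y|lborel. norm (F j y)))"
      using int_F by (subst nn_integral_suminf)
        (auto intro!: suminf_cong nn_integral_eq_integral integrable_norm)
    also have "\<dots> \<noteq> \<infinity>"
      using sum_F by (simp add: suminf_ennreal2)
    finally have "AE y in lborel. (\<Sum>j. ennreal (norm (F j y))) \<noteq> \<infinity>"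
      by (intro nn_integral_noteq_infinite) auto
    then show ?thesis by eventually_elim (auto intro!: summable_suminf_not_top)
  qed
  have G: "G x y = (\<Sum>j. F j y)" for y by (simp add: G_def F_def)
  show "AE y in lborel. (\<lambda>j. mixture_term \<mu> \<psi> j (x + (1/2) *\<^sub>R y) (x - (1/2) *\<^sub>R y)) sums G x y"
    using AE_F unfolding F_def[symmetric] G
    by eventually_elim (rule summable_sums, rule summable_norm_cancel)
  show "integrable lborel (G x)"
    unfolding G by (rule integrable_suminf[OF int_F AE_F sum_F])
  have le: "norm (\<phi> y * F j y) \<le> norm (F j y)" for j y
    using mult_right_mono[OF \<phi>[of y], of "cmod (F j y)"] by (simp add: norm_mult)
  have int_\<phi>: "integrable lborel (\<lambda>y. \<phi> y * F j y)" for j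
    by (rule Bochner_Integration.integrable_bound[OF int_F[of j]]) (use le in auto)
  have "AE y in lborel. summable (\<lambda>j. norm (\<phi> y * F j y))"
    using AE_F by eventually_elim (rule summable_comparison_test', assumption, use le in simp)
  moreover have "summable (\<lambda>j. LINT y|lborel. norm (\<phi> y * F j y))"
    by (rule summable_comparison_test'[OF sum_F])
       (use le int_F int_\<phi> in \<open>auto simp: abs_of_nonneg integral_nonneg_AE intro!: integral_mono integrable_norm\<close>)
  ultimately have "(\<lambda>j. LINT y|lborel. \<phi> y * F j y) sums (LINT y|lborel. (\<Sum>j. \<phi> y * F j y))"
    by (rule sums_integral[OF int_\<phi>])
  moreover have "(LINT y|lborel. (\<Sum>j. \<phi> y * F j y)) = (LINT y|lborel. \<phi> y * G x y)"
  proof (rule integral_cong_AE)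
    show "AE y in lborel. (\<Sum>j. \<phi> y * F j y) = \<phi> y * G x y"
      using AE_F by eventually_elim (simp add: G suminf_mult summable_norm_cancel)
  qed (simp_all add: G)
  ultimately show "(\<lambda>j. LINT y|lborel. \<phi> y * mixture_term \<mu> \<psi> j (x + (1/2) *\<^sub>R y) (x - (1/2) *\<^sub>R y)) sums
      (LINT y|lborel. \<phi> y * G x y)"
    by (simp add: F_def)
qed

lemma wigner_mixture_term:
  "of_real (\<mu> j) * wigner hbar (\<psi> j) z = of_real ((1 / (2 * pi * hbar)) ^ CARD('n)) *
    (LINT y|lborel. exp (- (\<i> / of_real hbar) * of_real (pproj z \<bullet> y)) *
      mixture_term \<mu> \<psi> j (xproj z + (1/2) *\<^sub>R y) (xproj z - (1/2) *\<^sub>R y))"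
  for z :: "real ^ ('n::finite + 'n)"
proof -
  have "(\<lambda>y. exp (- (\<i> / of_real hbar) * of_real (pproj z \<bullet> y)) *
      mixture_term \<mu> \<psi> j (xproj z + (1/2) *\<^sub>R y) (xproj z - (1/2) *\<^sub>R y)) =
    (\<lambda>y. of_real (\<mu> j) * (exp (- (\<i> / of_real hbar) * of_real (pproj z \<bullet> y)) *
      \<psi> j (xproj z + (1/2) *\<^sub>R y) * cnj (\<psi> j (xproj z - (1/2) *\<^sub>R y))))"
    by (simp add: mixture_term_def fun_eq_iff)
  then show ?thesis
    unfolding wigner_def by (simp only: integral_mult_right_zero) (simp only: mult_ac)
qed

lemma cmod_wigner_phase: "cmod (exp (- (\<i> / of_real hbar) * of_real t)) = 1"
proof -
  have "- (\<i> / of_real hbar) * of_real t = \<i> * of_real (- t / hbar)" by simp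
  then show ?thesis by (simp only: norm_exp_i_times)
qed

definition wigner_of_kernel ::
  "real \<Rightarrow> (real ^ 'n \<Rightarrow> real ^ 'n \<Rightarrow> real) \<Rightarrow> real ^ ('n::finite + 'n) \<Rightarrow> complex" where
  "wigner_of_kernel hbar K z = of_real ((1 / (2 * pi * hbar)) ^ CARD('n)) *
    (LINT y|lborel. exp (- (\<i> / of_real hbar) * of_real (pproj z \<bullet> y)) *
      of_real (K (xproj z + (1/2) *\<^sub>R y) (xproj z - (1/2) *\<^sub>R y)))"

lemma wigner_sums_of_kernel:
  fixes \<psi> :: "nat \<Rightarrow> real ^ 'n \<Rightarrow> complex"
  assumes dec: "state_decomposition \<rho> \<mu> \<psi>"
    and [measurable]: "(\<lambda>y. K (xproj z + (1/2) *\<^sub>R y) (xproj z - (1/2) *\<^sub>R y)) \<in> borel_measurable borel"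
    and ker: "AE y in lborel. (\<lambda>j. mixture_term \<mu> \<psi> j (xproj z + (1/2) *\<^sub>R y) (xproj z - (1/2) *\<^sub>R y))
      sums of_real (K (xproj z + (1/2) *\<^sub>R y) (xproj z - (1/2) *\<^sub>R y))"
  shows "(\<lambda>j. of_real (\<mu> j) * wigner hbar (\<psi> j) z) sums wigner_of_kernel hbar K z"
proof -
  define G where "G y = (\<Sum>j. mixture_term \<mu> \<psi> j (xproj z + (1/2) *\<^sub>R y) (xproj z - (1/2) *\<^sub>R y))" for y
  note G = mixture_midpoint_sums[OF dec, of "\<lambda>y. exp (- (\<i> / of_real hbar) * of_real (pproj z \<bullet> y))" "xproj z",
      folded G_def]
  have "integrable lborel G"
    unfolding G_def by (rule mixture_midpoint_sums(2)[OF dec, of "\<lambda>_. 0"]) simp_all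
  then have [measurable]: "G \<in> borel_measurable borel" by auto
  have "(LINT y|lborel. exp (- (\<i> / of_real hbar) * of_real (pproj z \<bullet> y)) * G y) =
      (LINT y|lborel. exp (- (\<i> / of_real hbar) * of_real (pproj z \<bullet> y)) *
        of_real (K (xproj z + (1/2) *\<^sub>R y) (xproj z - (1/2) *\<^sub>R y)))"
  proof (rule integral_cong_AE)
    show "AE y in lborel. exp (- (\<i> / of_real hbar) * of_real (pproj z \<bullet> y)) * G y =
        exp (- (\<i> / of_real hbar) * of_real (pproj z \<bullet> y)) *
        of_real (K (xproj z + (1/2) *\<^sub>R y) (xproj z - (1/2) *\<^sub>R y))"
      using ker by eventually_elim (simp add: G_def sums_iff)
  qed simp_all
  moreover have "(\<lambda>j. LINT y|lborel. exp (- (\<i> / of_real hbar) * of_real (pproj z \<bullet> y)) *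
      mixture_term \<mu> \<psi> j (xproj z + (1/2) *\<^sub>R y) (xproj z - (1/2) *\<^sub>R y)) sums
      (LINT y|lborel. exp (- (\<i> / of_real hbar) * of_real (pproj z \<bullet> y)) * G y)"
    by (rule G(3)) (simp_all only: cmod_wigner_phase order_refl, simp)
  ultimately show ?thesis
    unfolding wigner_mixture_term wigner_of_kernel_def by (intro sums_mult) simp
qed

text \<open>Converse of \<open>wigner_sums_of_kernel\<close>: on each line with midpoint x the sum
  of the mixture and the given kernel are integrable and have equal Fourier transforms, hence agree
  almost everywhere.\<close>

lemma kernel_of_wigner:
  fixes \<psi> :: "nat \<Rightarrow> real ^ 'n \<Rightarrow> complex"
  assumes dec: "state_decomposition \<rho> \<mu> \<psi>" and h: "hbar > 0"
    and K: "(\<lambda>(u, v). K u v) \<in> borel_measurable (borel \<Otimes>\<^sub>M borel)"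
    and int_K: "\<And>x. integrable lborel (\<lambda>y. K (x + (1/2) *\<^sub>R y) (x - (1/2) *\<^sub>R y))"
    and wig: "\<And>z. (\<lambda>j. of_real (\<mu> j) * wigner hbar (\<psi> j) z) sums wigner_of_kernel hbar K z"
  shows "AE u in lborel. AE v in lborel. (\<lambda>j. mixture_term \<mu> \<psi> j u v) sums of_real (K u v)"
proof -
  have [measurable]: "\<psi> j \<in> borel_measurable borel" for j
    using dec by (auto simp: state_decomposition_def unit_L2_def intro: L2_measurable)
  have [measurable]: "(\<lambda>z. K (fst z) (snd z)) \<in> borel_measurable (borel \<Otimes>\<^sub>M borel)"
    using K by (simp add: case_prod_beta')
  let ?S = "\<lambda>N z. \<Sum>j<N. mixture_term \<mu> \<psi> j (fst z) (snd z)"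
  have [measurable]: "?S N \<in> borel_measurable (borel \<Otimes>\<^sub>M borel)" for N
    unfolding mixture_term_def by measurable
  \<comment> \<open>\<open>AE_midpoint\<close> asks for a measurable predicate. Convergence to a
    given value is measurable in the pair once split into the Cauchy property and the value of
    \<open>lim\<close>.\<close>
  have sums_lim: "(f sums s) = (Cauchy (\<lambda>N. \<Sum>j<N. f j) \<and> lim (\<lambda>N. \<Sum>j<N. f j) = s)" for f and s :: complex
    unfolding sums_def Cauchy_convergent_iff by (metis convergent_LIMSEQ_iff limI convergentI)
  have "Measurable.pred (borel \<Otimes>\<^sub>M borel)
      (\<lambda>z. Cauchy (\<lambda>N. ?S N z) \<and> lim (\<lambda>N. ?S N z) = of_real (K (fst z) (snd z)))"
    by measurable
  then have meas: "Measurable.pred (borel \<Otimes>\<^sub>M borel)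
      (\<lambda>z. (\<lambda>j. mixture_term \<mu> \<psi> j (fst z) (snd z)) sums of_real (K (fst z) (snd z)))"
    by (simp only: sums_lim)
  show ?thesis
  proof (rule AE_midpoint[OF meas])
    fix x :: "real ^ 'n"
    define G where "G y = (\<Sum>j. mixture_term \<mu> \<psi> j (x + (1/2) *\<^sub>R y) (x - (1/2) *\<^sub>R y))" for y
    have int_G: "integrable lborel G"
      unfolding G_def by (rule mixture_midpoint_sums(2)[OF dec, of "\<lambda>_. 0"]) simp_all
    have sums_G: "AE y in lborel. (\<lambda>j. mixture_term \<mu> \<psi> j (x + (1/2) *\<^sub>R y) (x - (1/2) *\<^sub>R y)) sums G y"
      unfolding G_def by (rule mixture_midpoint_sums(1)[OF dec, of "\<lambda>_. 0"]) simp_all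
    let ?k = "\<lambda>y. of_real (K (x + (1/2) *\<^sub>R y) (x - (1/2) *\<^sub>R y)) :: complex"
    have int_k: "integrable lborel ?k" using int_K by simp
    have phase: "integrable lborel (\<lambda>y. exp (- (\<i> / of_real hbar) * of_real (p \<bullet> y)) * f y)"
      if "integrable lborel f" for f and p :: "real ^ 'n"
    proof (rule Bochner_Integration.integrable_bound[OF that])
      show "AE y in lborel. norm (exp (- (\<i> / of_real hbar) * of_real (p \<bullet> y)) * f y) \<le> norm (f y)"
        by (simp only: norm_mult cmod_wigner_phase mult_1 order_refl) simp
      show "(\<lambda>y. exp (- (\<i> / of_real hbar) * of_real (p \<bullet> y)) * f y) \<in> borel_measurable lborel"
        using that by (intro borel_measurable_times) auto
    qed
    have "AE y in lborel. G y - ?k y = 0"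
    proof (rule fourier_L1_eq_0)
      show "integrable lborel (\<lambda>y. G y - ?k y)" using int_G int_k by simp
      fix q :: "real ^ 'n"
      \<comment> \<open>Turns the Wigner phase exp (- i p . y / hbar) into exp (i q . y), so every
        Fourier frequency is reached.\<close>
      define p where "p = - hbar *\<^sub>R q"
      define z where "z = vec_join x p"
      have z: "xproj z = x" "pproj z = p" by (simp_all add: z_def)
      have "(\<lambda>j. of_real (\<mu> j) * wigner hbar (\<psi> j) z) sums
          (of_real ((1 / (2 * pi * hbar)) ^ CARD('n)) *
            (LINT y|lborel. exp (- (\<i> / of_real hbar) * of_real (p \<bullet> y)) * G y))"
        unfolding wigner_mixture_term z G_def
        by (intro sums_mult mixture_midpoint_sums(3)[OF dec]) (simp_all only: cmod_wigner_phase order_refl, simp)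
      from sums_unique2[OF this wig[of z]]
      have "(LINT y|lborel. exp (- (\<i> / of_real hbar) * of_real (p \<bullet> y)) * G y) =
          (LINT y|lborel. exp (- (\<i> / of_real hbar) * of_real (p \<bullet> y)) * ?k y)"
        using h by (simp add: wigner_of_kernel_def z)
      then have "(LINT y|lborel. exp (- (\<i> / of_real hbar) * of_real (p \<bullet> y)) * (G y - ?k y)) = 0"
        using phase[OF int_G, of p] phase[OF int_k, of p] by (simp only: right_diff_distrib
            Bochner_Integration.integral_diff right_minus_eq)
      moreover have "- (\<i> / of_real hbar) * of_real (p \<bullet> y) = \<i> * of_real (q \<bullet> y)" for y
        using h by (simp add: p_def)
      ultimately show "(LINT y|lborel. exp (\<i> * of_real (q \<bullet> y)) * (G y - ?k y)) = 0" by simp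
    qed
    with sums_G show "AE y in lborel. (\<lambda>j. mixture_term \<mu> \<psi> j (x + (1/2) *\<^sub>R y) (x - (1/2) *\<^sub>R y)) sums
        of_real (K (x + (1/2) *\<^sub>R y) (x - (1/2) *\<^sub>R y))"
      by eventually_elim simp
  qed
qed

section \<open>Expansion of kernels into rank one terms\<close>

context real_kernel
begin

text \<open>Normalizing the functions \<open>h j\<close> makes their squared norms the weights, and
  these sum to the integral of the diagonal, which is one. By Cauchy-Schwarz the partial sums of the
  expansion are bounded by r(x) r(y), just like K, and this majorant drives the dominated
  convergence. The terms agree with those of the expansion only almost everywhere because a term of
  weight zero may be nonzero on a null set.\<close>

lemma state_decomposition_of_expansion:
  fixes h :: "nat \<Rightarrow> 'a \<Rightarrow> real"
  assumes [measurable]: "\<And>j. h j \<in> borel_measurable borel"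
    and sums: "\<And>u v. (\<lambda>j. h j u * h j v) sums K u v"
    and diag: "\<And>u. K u u = (r u)\<^sup>2" and tr: "(LINT u|lborel. (r u)\<^sup>2) = 1"
  shows "\<exists>\<mu> \<psi>. state_decomposition Kop \<mu> \<psi> \<and>
    (\<forall>j. AE u in lborel. \<forall>v. mixture_term \<mu> \<psi> j u v = of_real (h j u * h j v))"
proof -
  have sq_sums: "(\<lambda>j. (h j u)\<^sup>2) sums (r u)\<^sup>2" for u
    using sums[of u u] by (simp add: diag power2_eq_square)
  have partial_sq: "(\<Sum>j<N. (h j u)\<^sup>2) \<le> (r u)\<^sup>2" for N u
    using sq_sums[of u] sum_le_suminf[of "\<lambda>j. (h j u)\<^sup>2" "{..<N}"] by (simp add: sums_iff)
  have h_le: "(h j u)\<^sup>2 \<le> (r u)\<^sup>2" for j u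
    using partial_sq[where N="Suc j" and u=u] sum_nonneg[of "{..<j}" "\<lambda>j. (h j u)\<^sup>2"] by simp
  have hL2: "(\<lambda>u. of_real (h j u)) \<in> L2" for j
    by (rule L2_dominated[OF _ r_square_integrable]) (use h_le in simp_all)
  define \<mu> where "\<mu> j = (LINT u|lborel. (h j u)\<^sup>2)" for j
  have norm_h: "(L2_norm (\<lambda>u. of_real (h j u)))\<^sup>2 = \<mu> j" for j
    by (simp add: L2_norm_power2 \<mu>_def)
  have \<mu>0: "\<mu> j \<ge> 0" for j
    unfolding \<mu>_def by (intro integral_nonneg_AE) simp
  have \<mu>_sums: "\<mu> sums 1"
  proof (rule sums_of_suminf_ennreal[OF \<mu>0])
    have "(\<Sum>j. ennreal (\<mu> j)) = (\<Sum>j. \<integral>\<^sup>+u. ennreal ((h j u)\<^sup>2) \<partial>lborel)"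
      using nn_integral_L2[OF hL2] by (simp add: norm_h)
    also have "\<dots> = (\<integral>\<^sup>+u. (\<Sum>j. ennreal ((h j u)\<^sup>2)) \<partial>lborel)"
      by (rule nn_integral_suminf[symmetric]) simp
    also have "\<dots> = (\<integral>\<^sup>+u. ennreal ((r u)\<^sup>2) \<partial>lborel)"
      by (intro nn_integral_cong suminf_ennreal_of_sums sq_sums) simp
    also have "\<dots> = ennreal 1"
      using r_square_integrable tr by (subst nn_integral_eq_integral) simp_all
    finally show "(\<Sum>j. ennreal (\<mu> j)) = ennreal 1" .
  qed simp
  \<comment> \<open>A decomposition asks for unit vectors even where the weight is zero;
    \<open>r\<close> is one, by \<open>tr\<close>.\<close>
  define \<psi> :: "nat \<Rightarrow> 'a \<Rightarrow> complex" where
    "\<psi> j u = (if \<mu> j = 0 then of_real (r u) else of_real (1 / sqrt (\<mu> j)) * of_real (h j u))" for j u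
  have unit: "unit_L2 (\<psi> j)" for j
  proof (cases "\<mu> j = 0")
    case True
    then have "\<psi> j = (\<lambda>u. of_real (r u))" by (simp add: \<psi>_def fun_eq_iff)
    then show ?thesis
      using r_L2 tr by (simp add: unit_L2_def L2_norm_def)
  next
    case False
    then have \<psi>j: "\<psi> j = (\<lambda>u. of_real (1 / sqrt (\<mu> j)) * of_real (h j u))" by (simp add: \<psi>_def fun_eq_iff)
    have "(LINT u|lborel. (cmod (\<psi> j u))\<^sup>2) = (LINT u|lborel. (1 / \<mu> j) * (h j u)\<^sup>2)"
      using \<mu>0 unfolding \<psi>j
      by (intro Bochner_Integration.integral_cong refl) (simp add: norm_mult power_mult_distrib norm_divide power_divide)
    also have "\<dots> = 1" using False by (simp add: \<mu>_def)
    finally have "L2_norm (\<psi> j) = 1" by (simp add: L2_norm_def)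
    moreover have "\<psi> j \<in> L2" unfolding \<psi>j by (rule L2_cmult[OF hL2])
    ultimately show ?thesis by (simp add: unit_L2_def)
  qed
  have AE0: "AE u in lborel. h j u = 0" if "\<mu> j = 0" for j
    using L2_norm_eq_0_AE[OF hL2[of j]] norm_h[of j] that by simp
  have sqrt_sqrt: "complex_of_real (sqrt (\<mu> j)) * complex_of_real (sqrt (\<mu> j)) = of_real \<bar>\<mu> j\<bar>" for j
    by (simp flip: of_real_mult)
  have mixture_eq: "AE u in lborel. \<forall>v. mixture_term \<mu> \<psi> j u v = of_real (h j u * h j v)" for j
  proof (cases "\<mu> j = 0")
    case True
    show ?thesis using AE0[OF True] by eventually_elim (simp add: mixture_term_def True)
  next
    case False
    have "\<mu> j * (1 / sqrt (\<mu> j) * h j u * (1 / sqrt (\<mu> j) * h j v)) = h j u * h j v" for u v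
      using False \<mu>0[of j] by (simp add: field_simps)
    moreover have "mixture_term \<mu> \<psi> j u v =
        of_real (\<mu> j * (1 / sqrt (\<mu> j) * h j u * (1 / sqrt (\<mu> j) * h j v)))" for u v
      using False by (simp add: \<psi>_def mixture_term_def sqrt_sqrt)
    ultimately show ?thesis by simp
  qed
  have partial: "(\<Sum>j<N. of_real (\<mu> j) * ketbra (\<psi> j) f x) =
      (LINT y|lborel. of_real (\<Sum>j<N. h j x * h j y) * f y)" if f: "f \<in> L2" for N f x
  proof -
    have "of_real (\<mu> j) * ketbra (\<psi> j) f x = of_real (h j x) * L2_inner (\<lambda>u. of_real (h j u)) f" for j
    proof (cases "\<mu> j = 0")
      case True
      have "L2_inner (\<lambda>u. of_real (h j u)) f = 0"
        using L2_Cauchy_Schwarz[OF hL2[of j] f] norm_h[of j] True by simp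
      then show ?thesis by (simp add: True)
    next
      case False
      have "L2_inner (\<psi> j) f = of_real (1 / sqrt (\<mu> j)) * L2_inner (\<lambda>u. of_real (h j u)) f"
        using False unfolding L2_inner_def \<psi>_def by (simp add: mult.assoc del: of_real_divide)
      then have "of_real (\<mu> j) * ketbra (\<psi> j) f x =
          of_real (\<mu> j * (1 / sqrt (\<mu> j)) * (1 / sqrt (\<mu> j)) * h j x) * L2_inner (\<lambda>u. of_real (h j u)) f"
        using False by (simp add: ketbra_def \<psi>_def sqrt_sqrt)
      also have "\<mu> j * (1 / sqrt (\<mu> j)) * (1 / sqrt (\<mu> j)) * h j x = h j x"
        using False \<mu>0[of j] by (simp add: field_simps)
      finally show ?thesis .
    qed
    then have "(\<Sum>j<N. of_real (\<mu> j) * ketbra (\<psi> j) f x) =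
        (\<Sum>j<N. LINT y|lborel. of_real (h j x) * (of_real (h j y) * f y))"
      by (simp add: L2_inner_def)
    also have "\<dots> = (LINT y|lborel. (\<Sum>j<N. of_real (h j x) * (of_real (h j y) * f y)))"
      by (rule Bochner_Integration.integral_sum[symmetric]) (intro integrable_mult_right L2_mult_integrable hL2 f)
    finally show ?thesis by (simp add: sum_distrib_right mult.assoc)
  qed
  have partial_bound: "\<bar>\<Sum>j<N. h j x * h j y\<bar> \<le> r x * r y" for N x y
  proof (rule power2_le_imp_le)
    have "(\<Sum>j<N. h j x * h j y)\<^sup>2 \<le> (\<Sum>j<N. (h j x)\<^sup>2) * (\<Sum>j<N. (h j y)\<^sup>2)"
      by (rule Cauchy_Schwarz_ineq_sum)
    also have "\<dots> \<le> (r x)\<^sup>2 * (r y)\<^sup>2"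
      by (intro mult_mono partial_sq sum_nonneg) simp_all
    finally show "(\<bar>\<Sum>j<N. h j x * h j y\<bar>)\<^sup>2 \<le> (r x * r y)\<^sup>2"
      by (simp add: power_mult_distrib)
  qed (simp add: r_nonneg)
  have conv: "(\<lambda>N. L2_norm (\<lambda>x. Kop f x - (\<Sum>j<N. of_real (\<mu> j) * ketbra (\<psi> j) f x))) \<longlonglongrightarrow> 0"
    if f: "f \<in> L2" for f
  proof (rule tendsto_L2_norm_0)
    have [measurable]: "f \<in> borel_measurable borel" using f by (rule L2_measurable)
    have rf: "integrable lborel (\<lambda>y. r y * cmod (f y))"
      using L2_norm_mult_integrable[OF r_L2 f] by (simp add: abs_of_nonneg r_nonneg)
    define C where "C = (LINT y|lborel. r y * cmod (f y))"
    have bound_int: "cmod (LINT y|lborel. of_real (k y) * f y) \<le> r x * C"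
      if k: "\<And>y. \<bar>k y\<bar> \<le> r x * r y" and [measurable]: "k \<in> borel_measurable borel" for k x
    proof -
      have le: "norm (of_real (k y) * f y) \<le> r x * (r y * cmod (f y))" for y
        using mult_right_mono[OF k[of y], of "cmod (f y)"] by (simp add: norm_mult mult.assoc)
      have int: "integrable lborel (\<lambda>y. of_real (k y) * f y)"
      proof (rule Bochner_Integration.integrable_bound)
        show "integrable lborel (\<lambda>y. r x * (r y * cmod (f y)))" using rf by simp
        show "AE y in lborel. norm (of_real (k y) * f y) \<le> norm (r x * (r y * cmod (f y)))"
          using le r_nonneg by simp
      qed measurable
      have "cmod (LINT y|lborel. of_real (k y) * f y) \<le> (LINT y|lborel. norm (of_real (k y) * f y))"
        by (rule integral_norm_bound)
      also have "\<dots> \<le> (LINT y|lborel. r x * (r y * cmod (f y)))"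
        using rf int by (intro integral_mono le integrable_norm) simp_all
      finally show ?thesis by (simp add: C_def)
    qed
    show "(\<lambda>x. Kop f x - (\<Sum>j<N. of_real (\<mu> j) * ketbra (\<psi> j) f x)) \<in> L2" for N
      unfolding ketbra_def
      by (intro L2_diff Kop_L2 f L2_sum L2_cmult unit_L2_norm unit)
    show "integrable lborel (\<lambda>x. (r x)\<^sup>2 * (2 * C)\<^sup>2)" using r_square_integrable by simp
    show "(cmod (Kop f x - (\<Sum>j<N. of_real (\<mu> j) * ketbra (\<psi> j) f x)))\<^sup>2 \<le> (r x)\<^sup>2 * (2 * C)\<^sup>2" for N x
    proof -
      have "cmod (Kop f x - (\<Sum>j<N. of_real (\<mu> j) * ketbra (\<psi> j) f x)) \<le> r x * C + r x * C"
        unfolding partial[OF f] unfolding Kop_def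
        by (intro order_trans[OF norm_triangle_ineq4] add_mono bound_int K_bound partial_bound) simp_all
      from power_mono[OF this, of 2] show ?thesis by (simp add: power_mult_distrib mult_ac)
    qed
    show "(\<lambda>N. Kop f x - (\<Sum>j<N. of_real (\<mu> j) * ketbra (\<psi> j) f x)) \<longlonglongrightarrow> 0" for x
    proof -
      have "(\<lambda>N. LINT y|lborel. of_real (\<Sum>j<N. h j x * h j y) * f y) \<longlonglongrightarrow> Kop f x"
        unfolding Kop_def
      proof (rule integral_dominated_convergence)
        show "integrable lborel (\<lambda>y. r x * (r y * cmod (f y)))" using rf by simp
        show "AE y in lborel. (\<lambda>N. of_real (\<Sum>j<N. h j x * h j y) * f y) \<longlonglongrightarrow> of_real (K x y) * f y"
          using sums unfolding sums_def by (intro AE_I2 tendsto_intros) auto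
        show "AE y in lborel. norm (of_real (\<Sum>j<N. h j x * h j y) * f y) \<le> r x * (r y * cmod (f y))" for N
          using mult_right_mono[OF partial_bound[where N = N and x = x], of "cmod (f _)"]
          by (intro AE_I2) (simp only: norm_mult norm_of_real mult.assoc[symmetric] norm_ge_zero)
      qed simp_all
      from tendsto_diff[OF tendsto_const[of "Kop f x"] this] show ?thesis
        unfolding partial[OF f] by simp
    qed
  qed
  have "state_decomposition Kop \<mu> \<psi>"
    unfolding state_decomposition_def using \<mu>0 \<mu>_sums unit conv by blast
  with mixture_eq show ?thesis by blast
qed

end

text \<open>Words over the index type take the place of multi-indices; each multi-index of degree \<open>k\<close> is
  counted with its multinomial coefficient, so the weights are just \<open>1 / k!\<close>.\<close>

lemma sum_prod_list_words:
  fixes x :: "'n::finite \<Rightarrow> 'a::comm_semiring_1"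
  shows "(\<Sum>w | length w = k. prod_list (map x w)) = (\<Sum>i\<in>UNIV. x i) ^ k"
proof (induction k)
  case (Suc k)
  have words: "{w :: 'n list. length w = Suc k} = (\<lambda>(i, w). i # w) ` (UNIV \<times> {w. length w = k})"
    by (auto simp: image_iff length_Suc_conv)
  have "(\<Sum>w | length w = Suc k. prod_list (map x w)) =
      (\<Sum>(i, w)\<in>UNIV \<times> {w. length w = k}. x i * prod_list (map x w))"
    unfolding words by (subst sum.reindex) (auto simp: inj_on_def case_prod_beta' intro!: sum.cong)
  also have "\<dots> = (\<Sum>i\<in>UNIV. x i) * (\<Sum>w | length w = k. prod_list (map x w))"
    by (simp add: sum.cartesian_product[symmetric] sum_product)
  finally show ?case by (simp add: Suc)
qed simp

lemma exp_sum_has_sum_words: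
  fixes x :: "'n::finite \<Rightarrow> real"
  shows "((\<lambda>w. prod_list (map x w) / fact (length w)) has_sum exp (\<Sum>i\<in>UNIV. x i)) UNIV"
proof -
  define f where "f y w = prod_list (map y w) / fact (length w)" for y :: "'n \<Rightarrow> real" and w
  let ?L = "\<lambda>k. {w :: 'n list. length w = k}"
  have fin: "finite (?L k)" for k
    using finite_lists_length_eq[of "UNIV :: 'n set" k] by simp
  have inner: "(\<Sum>w\<in>?L k. f y w) = (\<Sum>i\<in>UNIV. y i) ^ k / fact k" for y k
    unfolding sum_prod_list_words[symmetric] f_def by (simp add: sum_divide_distrib)
  have outer: "((\<lambda>k. (\<Sum>i\<in>UNIV. y i) ^ k / fact k) has_sum exp (\<Sum>i\<in>UNIV. y i)) UNIV" for y :: "'n \<Rightarrow> real"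
  proof (rule norm_summable_imp_has_sum)
    show "summable (\<lambda>k. norm ((\<Sum>i\<in>UNIV. y i) ^ k / fact k))"
      using summable_norm_exp[of "\<Sum>i\<in>UNIV. y i"] by (simp add: divide_inverse mult.commute)
    show "(\<lambda>k. (\<Sum>i\<in>UNIV. y i) ^ k / fact k) sums exp (\<Sum>i\<in>UNIV. y i)"
      using exp_converges[of "\<Sum>i\<in>UNIV. y i"] by (simp add: divide_inverse mult.commute)
  qed
  have bij: "bij_betw snd (Sigma UNIV ?L) UNIV"
    by (rule bij_betwI[where g = "\<lambda>w. (length w, w)"]) auto
  \<comment> \<open>Passing to |x i| makes all terms nonnegative, and they can be summed length by
    length to an exponential series. The resulting absolute summability justifies the same grouping
    for x itself.\<close>
  have "(\<lambda>w. norm (f x w)) summable_on UNIV"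
  proof -
    have "(\<lambda>w. f (\<lambda>i. \<bar>x i\<bar>) (snd w)) summable_on Sigma UNIV ?L"
    proof (rule summable_on_SigmaI)
      show "((\<lambda>w. f (\<lambda>i. \<bar>x i\<bar>) (snd (k, w))) has_sum ((\<Sum>i\<in>UNIV. \<bar>x i\<bar>) ^ k / fact k)) (?L k)" for k
        using has_sum_finite[OF fin[of k], of "f (\<lambda>i. \<bar>x i\<bar>)"] by (simp add: inner)
      show "(\<lambda>k. (\<Sum>i\<in>UNIV. \<bar>x i\<bar>) ^ k / fact k) summable_on UNIV"
        using outer[of "\<lambda>i. \<bar>x i\<bar>"] by (auto simp: summable_on_def)
      show "0 \<le> f (\<lambda>i. \<bar>x i\<bar>) (snd (k, w))" for k w
        by (auto simp: f_def intro!: divide_nonneg_nonneg prod_list_nonneg)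
    qed
    then have "f (\<lambda>i. \<bar>x i\<bar>) summable_on UNIV"
      using summable_on_reindex_bij_betw[OF bij] by blast
    moreover have "norm (f x w) = f (\<lambda>i. \<bar>x i\<bar>) w" for w
    proof -
      have "\<bar>prod_list (map x w)\<bar> = prod_list (map (\<lambda>i. \<bar>x i\<bar>) w)"
        by (induction w) (simp_all add: abs_mult)
      then show ?thesis by (simp add: f_def)
    qed
    ultimately show ?thesis by simp
  qed
  then have summable: "(f x) summable_on UNIV"
    by (rule abs_summable_summable)
  then have "(\<lambda>w. f x (snd w)) summable_on Sigma UNIV ?L"
    using summable_on_reindex_bij_betw[OF bij] by blast
  then obtain S where S: "((\<lambda>w. f x (snd w)) has_sum S) (Sigma UNIV ?L)"
    by (auto simp: summable_on_def)
  have "((\<lambda>k. (\<Sum>i\<in>UNIV. x i) ^ k / fact k) has_sum S) UNIV"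
    by (rule has_sum_SigmaD[OF S])
       (use has_sum_finite[OF fin, of "f x"] in \<open>simp add: inner\<close>)
  then have "S = exp (\<Sum>i\<in>UNIV. x i)"
    using outer has_sum_unique by blast
  moreover have "(f x has_sum S) UNIV"
    using S has_sum_reindex_bij_betw[OF bij, of "f x" S] by (simp only:)
  ultimately show ?thesis by (simp add: f_def[abs_def])
qed

text \<open>A single enumeration of the words serves all \<open>x\<close>; thus the terms of the
  kernel expansion are indexed independently of the points u and v.\<close>

lemma exp_sum_sums_words:
  "\<exists>wd :: nat \<Rightarrow> 'n::finite list.
    \<forall>x. (\<lambda>j. prod_list (map x (wd j)) / fact (length (wd j))) sums exp (\<Sum>i\<in>UNIV. x i :: real)"
proof -
  define wd :: "nat \<Rightarrow> 'n list" where "wd = from_nat_into UNIV"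
  have "infinite (UNIV :: 'n list set)" by (rule infinite_UNIV_listI)
  then have bij: "bij_betw wd UNIV UNIV"
    unfolding wd_def by (intro bij_betw_from_nat_into) auto
  have "(\<lambda>j. prod_list (map x (wd j)) / fact (length (wd j))) sums exp (\<Sum>i\<in>UNIV. x i)"
    for x :: "'n \<Rightarrow> real"
    using exp_sum_has_sum_words[of x] unfolding has_sum_reindex_bij_betw[OF bij, symmetric]
    by (rule has_sum_imp_sums)
  then show ?thesis by blast
qed

section \<open>The Gaussian kernel of the largest ellipsoid\<close>

lemma gaussian_norm_eq:
  fixes V :: "real ^ 'n ^ 'n"
  assumes c: "\<And>i. c i \<ge> 0"
  shows "(norm ((diag_mat (\<lambda>i. sqrt (c i)) ** V) *v y))\<^sup>2 = (\<Sum>i\<in>UNIV. c i * ((V *v y) $ i)\<^sup>2)"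
  using c by (simp add: power2_norm_eq_inner inner_vec_eq_sum_power2 power_mult_distrib
      flip: matrix_vector_mul_assoc)

text \<open>The substitution by L = diag (sqrt (2 c)) V leads to the standard Gaussian, and the
  frequency p becomes q = diag (1 / sqrt (2 c)) V^{-T} p; half of |q|^2 is the exponent with 4 c in
  the denominator.\<close>

lemma has_bochner_integral_gaussian_diag:
  fixes V :: "real ^ 'n ^ 'n"
  assumes V: "invertible V" and c: "\<And>i. c i > 0"
  shows "has_bochner_integral lborel (\<lambda>y. exp (- (\<Sum>i\<in>UNIV. c i * ((V *v y) $ i)\<^sup>2)))
    (sqrt pi ^ CARD('n) / ((\<Prod>i\<in>UNIV. sqrt (c i)) * \<bar>det V\<bar>))"
    and "has_bochner_integral lborel
      (\<lambda>y. exp (\<i> * of_real (p \<bullet> y)) * complex_of_real (exp (- (\<Sum>i\<in>UNIV. c i * ((V *v y) $ i)\<^sup>2))))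
      (of_real (sqrt pi ^ CARD('n) / ((\<Prod>i\<in>UNIV. sqrt (c i)) * \<bar>det V\<bar>) *
        exp (- (\<Sum>i\<in>UNIV. ((matrix_inv (transpose V) *v p) $ i)\<^sup>2 / (4 * c i)))))"
proof -
  define L where "L = diag_mat (\<lambda>i. sqrt (2 * c i)) ** V"
  have c2: "2 * c i \<ge> 0" for i using c[of i] by simp
  have c0: "c i \<noteq> 0" for i using c[of i] by simp
  have detL: "\<bar>det L\<bar> = sqrt 2 ^ CARD('n) * (\<Prod>i\<in>UNIV. sqrt (c i)) * \<bar>det V\<bar>"
    using c by (simp add: L_def det_mul abs_mult abs_prod real_sqrt_mult prod.distrib less_imp_le)
  have L: "invertible L"
    using V by (simp add: invertible_det_nz L_def det_mul c0)
  have form: "(L *v y) \<bullet> (L *v y) / 2 = (\<Sum>i\<in>UNIV. c i * ((V *v y) $ i)\<^sup>2)" for y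
    using gaussian_norm_eq[of "\<lambda>i. 2 * c i" V y] c2
    by (simp add: L_def power2_norm_eq_inner mult.assoc flip: sum_distrib_left)
  have const: "sqrt (2 * pi) ^ CARD('n) / \<bar>det L\<bar> = sqrt pi ^ CARD('n) / ((\<Prod>i\<in>UNIV. sqrt (c i)) * \<bar>det V\<bar>)"
    by (simp add: detL real_sqrt_mult power_mult_distrib)
  show "has_bochner_integral lborel (\<lambda>y. exp (- (\<Sum>i\<in>UNIV. c i * ((V *v y) $ i)\<^sup>2)))
    (sqrt pi ^ CARD('n) / ((\<Prod>i\<in>UNIV. sqrt (c i)) * \<bar>det V\<bar>))"
    using has_bochner_integral_gaussian_linear[OF L] unfolding form const .
  define w where "w = matrix_inv (transpose V) *v p"
  define q where "q = diag_mat (\<lambda>i. 1 / sqrt (2 * c i)) *v w"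
  have pw: "p = transpose V *v w"
    using V by (simp add: w_def invertible_transpose matrix_inv_mult_cancel del: transpose_matrix_vector)
  have ip: "q \<bullet> (L *v y) = p \<bullet> y" for y
  proof -
    have "q \<bullet> (L *v y) = w \<bullet> (V *v y)"
      using c0 by (simp add: q_def L_def inner_vec_def flip: matrix_vector_mul_assoc)
    then show ?thesis by (simp add: pw inner_transpose_mult del: transpose_matrix_vector)
  qed
  have qq: "q \<bullet> q / 2 = (\<Sum>i\<in>UNIV. (w $ i)\<^sup>2 / (4 * c i))"
    using c2 by (simp add: inner_vec_eq_sum_power2 q_def power_mult_distrib power_divide sum_divide_distrib)
  show "has_bochner_integral lborel
      (\<lambda>y. exp (\<i> * of_real (p \<bullet> y)) * complex_of_real (exp (- (\<Sum>i\<in>UNIV. c i * ((V *v y) $ i)\<^sup>2))))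
      (of_real (sqrt pi ^ CARD('n) / ((\<Prod>i\<in>UNIV. sqrt (c i)) * \<bar>det V\<bar>) *
        exp (- (\<Sum>i\<in>UNIV. ((matrix_inv (transpose V) *v p) $ i)\<^sup>2 / (4 * c i)))))"
    using has_bochner_integral_gaussian_fourier_linear[OF L, of q]
    unfolding form const ip qq w_def by (simp only: mult.commute)
qed

text \<open>
  \<open>K\<close> comes from inverting the Fourier transform in $p$ of the Gaussian density \<open>wig\<close>; the
  covariance ellipsoids in this locale are those of $A = V^T V$ and $B^{-1} = V^T \mathrm{diag}(d) V$.
\<close>

locale gaussian_kernel =
  fixes hbar :: real and V :: "real ^ 'n ^ 'n" and d :: "'n \<Rightarrow> real"
  assumes hbar: "hbar > 0" and V: "invertible V" and d: "\<And>i. d i \<ge> 1"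
begin

text \<open>Chosen so that the integral of r^2, which is the trace of the operator, equals
  one.\<close>

definition nrm :: real where "nrm = \<bar>det V\<bar> / sqrt (pi * hbar) ^ CARD('n)"

definition K :: "real ^ 'n \<Rightarrow> real ^ 'n \<Rightarrow> real" where
  "K u v = nrm * exp (- (\<Sum>i\<in>UNIV. ((V *v (u + v)) $ i)\<^sup>2 + d i * ((V *v (u - v)) $ i)\<^sup>2) / (4 * hbar))"

text \<open>The square root of the diagonal of \<open>K\<close>, and also the common modulus of the
  two pure states.\<close>

definition r :: "real ^ 'n \<Rightarrow> real" where
  "r u = sqrt nrm * exp (- (\<Sum>i\<in>UNIV. ((V *v u) $ i)\<^sup>2) / (2 * hbar))"

lemma d_pos: "d i > 0"
  using d[of i] by simp

lemma nrm_pos: "nrm > 0"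
  using V hbar by (simp add: nrm_def invertible_det_nz)

lemma r_power2: "(r u)\<^sup>2 = nrm * exp (- (\<Sum>i\<in>UNIV. (1 / hbar) * ((V *v u) $ i)\<^sup>2))"
proof -
  have "(exp (- (\<Sum>i\<in>UNIV. ((V *v u) $ i)\<^sup>2) / (2 * hbar)))\<^sup>2 = exp (- (\<Sum>i\<in>UNIV. (1 / hbar) * ((V *v u) $ i)\<^sup>2))"
    using hbar by (simp add: exp_double[symmetric] sum_distrib_left[symmetric] sum_divide_distrib[symmetric])
  then show ?thesis using nrm_pos by (simp add: r_def power_mult_distrib)
qed

lemma has_integral_r_power2: "has_bochner_integral lborel (\<lambda>u. (r u)\<^sup>2) 1"
proof -
  have "has_bochner_integral lborel (\<lambda>u. (r u)\<^sup>2)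
      (nrm * (sqrt pi ^ CARD('n) / ((\<Prod>i\<in>(UNIV :: 'n set). sqrt (1 / hbar)) * \<bar>det V\<bar>)))"
    unfolding r_power2 using hbar
    by (intro has_bochner_integral_mult_right has_bochner_integral_gaussian_diag V) simp
  moreover have "nrm * (sqrt pi ^ CARD('n) / ((\<Prod>i\<in>(UNIV :: 'n set). sqrt (1 / hbar)) * \<bar>det V\<bar>)) = 1"
    using V hbar by (simp add: nrm_def invertible_det_nz real_sqrt_mult real_sqrt_divide power_mult_distrib power_divide)
  ultimately show ?thesis by (simp only:)
qed

lemma K_measurable: "(\<lambda>(u, v). K u v) \<in> borel_measurable (borel \<Otimes>\<^sub>M borel)"
proof -
  have [measurable]: "(\<lambda>x. (V *v x) $ i) \<in> borel_measurable borel" for i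
    by (intro borel_measurable_continuous_onI continuous_on_component linear_continuous_on
        matrix_vector_mul_bounded_linear)
  show ?thesis unfolding K_def by measurable
qed

sublocale real_kernel K r
proof
  show "(\<lambda>(u, v). K u v) \<in> borel_measurable (borel \<Otimes>\<^sub>M borel)" by (rule K_measurable)
  show "K u v = K v u" for u v
    by (simp add: K_def add.commute matrix_vector_mult_diff_distrib power2_commute)
  show "\<bar>K u v\<bar> \<le> r u * r v" for u v
  proof -
    \<comment> \<open>The parallelogram law after lowering d i to 1; so the product majorant depends
      on the inclusion of the polar dual.\<close>
    have "2 * ((V *v u) $ i)\<^sup>2 + 2 * ((V *v v) $ i)\<^sup>2 \<le> ((V *v (u + v)) $ i)\<^sup>2 + d i * ((V *v (u - v)) $ i)\<^sup>2" for i
    proof -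
      have "((V *v (u + v)) $ i)\<^sup>2 + 1 * ((V *v (u - v)) $ i)\<^sup>2 \<le> ((V *v (u + v)) $ i)\<^sup>2 + d i * ((V *v (u - v)) $ i)\<^sup>2"
        by (intro add_left_mono mult_right_mono d) simp
      then show ?thesis
        by (simp add: matrix_vector_right_distrib matrix_vector_mult_diff_distrib power2_eq_square algebra_simps)
    qed
    then have "(\<Sum>i\<in>UNIV. 2 * ((V *v u) $ i)\<^sup>2 + 2 * ((V *v v) $ i)\<^sup>2) \<le>
        (\<Sum>i\<in>UNIV. ((V *v (u + v)) $ i)\<^sup>2 + d i * ((V *v (u - v)) $ i)\<^sup>2)"
      by (rule sum_mono)
    then have "- (\<Sum>i\<in>UNIV. ((V *v (u + v)) $ i)\<^sup>2 + d i * ((V *v (u - v)) $ i)\<^sup>2) / (4 * hbar) \<le>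
        - (\<Sum>i\<in>UNIV. 2 * ((V *v u) $ i)\<^sup>2 + 2 * ((V *v v) $ i)\<^sup>2) / (4 * hbar)"
      using hbar by (intro divide_right_mono) simp_all
    also have "\<dots> = - (\<Sum>i\<in>UNIV. ((V *v u) $ i)\<^sup>2) / (2 * hbar) + - (\<Sum>i\<in>UNIV. ((V *v v) $ i)\<^sup>2) / (2 * hbar)"
      using hbar by (simp add: sum.distrib sum_distrib_left[symmetric] field_simps)
    finally have "- (\<Sum>i\<in>UNIV. ((V *v (u + v)) $ i)\<^sup>2 + d i * ((V *v (u - v)) $ i)\<^sup>2) / (4 * hbar) \<le>
        - (\<Sum>i\<in>UNIV. ((V *v u) $ i)\<^sup>2) / (2 * hbar) + - (\<Sum>i\<in>UNIV. ((V *v v) $ i)\<^sup>2) / (2 * hbar)" .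
    then have "K u v \<le> nrm * (exp (- (\<Sum>i\<in>UNIV. ((V *v u) $ i)\<^sup>2) / (2 * hbar)) *
        exp (- (\<Sum>i\<in>UNIV. ((V *v v) $ i)\<^sup>2) / (2 * hbar)))"
      unfolding K_def exp_add[symmetric] using nrm_pos by (intro mult_left_mono) simp_all
    also have "\<dots> = r u * r v" using nrm_pos by (simp add: r_def)
    finally show ?thesis using nrm_pos by (simp add: K_def)
  qed
  show "r \<in> borel_measurable borel"
  proof -
    have [measurable]: "(\<lambda>x. (V *v x) $ i) \<in> borel_measurable borel" for i
      by (intro borel_measurable_continuous_onI continuous_on_component linear_continuous_on
          matrix_vector_mul_bounded_linear)
    show ?thesis unfolding r_def[abs_def] by measurable
  qed
  show "integrable lborel (\<lambda>x. (r x)\<^sup>2)"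
    using has_integral_r_power2 by (simp add: has_bochner_integral_iff)
  show "r x \<ge> 0" for x using nrm_pos by (simp add: r_def)
qed

lemma K_diag: "K u u = (r u)\<^sup>2"
proof -
  have "(V *v (u + u)) $ i = 2 * (V *v u) $ i" for i
    by (simp only: matrix_vector_right_distrib vector_add_component mult_2)
  then have "- (\<Sum>i\<in>UNIV. ((V *v (u + u)) $ i)\<^sup>2 + d i * ((V *v (u - u)) $ i)\<^sup>2) / (4 * hbar) =
      - (\<Sum>i\<in>UNIV. (1 / hbar) * ((V *v u) $ i)\<^sup>2)"
    by (simp only:) (simp add: power_mult_distrib sum_divide_distrib)
  then show ?thesis unfolding K_def r_power2 by (simp only:)
qed

lemma K_midpoint:
  "K (x + (1/2) *\<^sub>R y) (x - (1/2) *\<^sub>R y) =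
    (r x)\<^sup>2 * exp (- (\<Sum>i\<in>UNIV. d i / (4 * hbar) * ((V *v y) $ i)\<^sup>2))"
proof -
  have "x + (1/2) *\<^sub>R y + (x - (1/2) *\<^sub>R y) = 2 *\<^sub>R x" by (simp add: scaleR_2)
  moreover have "x + (1/2) *\<^sub>R y - (x - (1/2) *\<^sub>R y) = y"
    by (simp add: algebra_simps flip: scaleR_add_left)
  ultimately have "K (x + (1/2) *\<^sub>R y) (x - (1/2) *\<^sub>R y) =
      nrm * exp (- (\<Sum>i\<in>UNIV. 4 * ((V *v x) $ i)\<^sup>2 + d i * ((V *v y) $ i)\<^sup>2) / (4 * hbar))"
    by (simp add: K_def matrix_vector_mult_scaleR power_mult_distrib)
  also have "- (\<Sum>i\<in>UNIV. 4 * ((V *v x) $ i)\<^sup>2 + d i * ((V *v y) $ i)\<^sup>2) / (4 * hbar) =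
      - (\<Sum>i\<in>UNIV. (1 / hbar) * ((V *v x) $ i)\<^sup>2) + - (\<Sum>i\<in>UNIV. d i / (4 * hbar) * ((V *v y) $ i)\<^sup>2)"
    using hbar by (simp add: sum.distrib sum_distrib_left[symmetric] sum_divide_distrib add_divide_distrib diff_divide_distrib)
  finally show ?thesis unfolding exp_add r_power2 by simp
qed

lemma K_midpoint_integrable: "integrable lborel (\<lambda>y. K (x + (1/2) *\<^sub>R y) (x - (1/2) *\<^sub>R y))"
  unfolding K_midpoint
  using has_bochner_integral_gaussian_diag(1)[OF V, of "\<lambda>i. d i / (4 * hbar)"] d_pos hbar
  by (auto simp: has_bochner_integral_iff)

text \<open>With a = (V u)_i and b = (V v)_i, (a + b)^2 + d (a - b)^2 = (1 + d) (a^2 + b^2) - 2 (d -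
  1) a b. The squares go into \<open>f\<close>, and the mixed term enters the exponent with
  coefficient (d i - 1) / (2 hbar) >= 0, whose square root \<open>q i\<close> is shared between u
  and v.\<close>

lemma K_expansion:
  "\<exists>h :: nat \<Rightarrow> real ^ 'n \<Rightarrow> real.
    (\<forall>j. h j \<in> borel_measurable borel) \<and> (\<forall>u v. (\<lambda>j. h j u * h j v) sums K u v)"
proof -
  obtain wd :: "nat \<Rightarrow> 'n list" where
    wd: "\<And>x. (\<lambda>j. prod_list (map x (wd j)) / fact (length (wd j))) sums exp (\<Sum>i\<in>UNIV. x i :: real)"
    using exp_sum_sums_words by blast
  define q where "q i = sqrt ((d i - 1) / (2 * hbar))" for i
  define g where "g u i = q i * (V *v u) $ i" for u i
  define f where "f u = sqrt nrm * exp (- (\<Sum>i\<in>UNIV. (1 + d i) * ((V *v u) $ i)\<^sup>2) / (4 * hbar))" for u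
  \<comment> \<open>The weight 1 / k! of a word of length k is split evenly between
    \<open>h j u\<close> and \<open>h j v\<close>.\<close>
  define h where "h j u = f u * prod_list (map (g u) (wd j)) / sqrt (fact (length (wd j)))" for j u
  show ?thesis
  proof (intro exI[of _ h] conjI allI)
    have [measurable]: "(\<lambda>x. (V *v x) $ i) \<in> borel_measurable borel" for i
      by (intro borel_measurable_continuous_onI continuous_on_component linear_continuous_on
          matrix_vector_mul_bounded_linear)
    have [measurable]: "(\<lambda>u. prod_list (map (g u) w)) \<in> borel_measurable borel" for w
      by (induction w) (simp_all add: g_def)
    show "h j \<in> borel_measurable borel" for j
      unfolding h_def f_def by measurable
    show "(\<lambda>j. h j u * h j v) sums K u v" for u v
    proof -
      have prod: "prod_list (map (g u) w) * prod_list (map (g v) w) = prod_list (map (\<lambda>i. g u i * g v i) w)" for w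
        by (induction w) simp_all
      have "h j u * h j v = f u * f v * (prod_list (map (\<lambda>i. g u i * g v i) (wd j)) / fact (length (wd j)))" for j
        unfolding prod[symmetric] h_def by simp
      moreover have "f u * f v * exp (\<Sum>i\<in>UNIV. g u i * g v i) = K u v"
      proof -
        have q2: "q i * q i = (d i - 1) / (2 * hbar)" for i
          using d[of i] hbar by (simp add: q_def)
        have gg: "g u i * g v i = (d i - 1) / (2 * hbar) * ((V *v u) $ i * (V *v v) $ i)" for i
          unfolding q2[symmetric] g_def by simp
        have "- (\<Sum>i\<in>UNIV. (1 + d i) * ((V *v u) $ i)\<^sup>2) / (4 * hbar) +
            - (\<Sum>i\<in>UNIV. (1 + d i) * ((V *v v) $ i)\<^sup>2) / (4 * hbar) + (\<Sum>i\<in>UNIV. g u i * g v i) =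
            (\<Sum>i\<in>UNIV. - ((1 + d i) * ((V *v u) $ i)\<^sup>2) / (4 * hbar) +
              - ((1 + d i) * ((V *v v) $ i)\<^sup>2) / (4 * hbar) + g u i * g v i)"
          by (simp add: sum.distrib sum_divide_distrib sum_negf sum_subtractf)
        also have "\<dots> = (\<Sum>i\<in>UNIV. - (((V *v (u + v)) $ i)\<^sup>2 + d i * ((V *v (u - v)) $ i)\<^sup>2) / (4 * hbar))"
          using hbar unfolding gg
          by (intro sum.cong refl) (simp add: matrix_vector_right_distrib matrix_vector_mult_diff_distrib
              power2_eq_square field_simps)
        also have "\<dots> = - (\<Sum>i\<in>UNIV. ((V *v (u + v)) $ i)\<^sup>2 + d i * ((V *v (u - v)) $ i)\<^sup>2) / (4 * hbar)"
          by (simp only: sum_divide_distrib[symmetric] sum_negf)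
        finally have expo: "- (\<Sum>i\<in>UNIV. (1 + d i) * ((V *v u) $ i)\<^sup>2) / (4 * hbar) +
            - (\<Sum>i\<in>UNIV. (1 + d i) * ((V *v v) $ i)\<^sup>2) / (4 * hbar) + (\<Sum>i\<in>UNIV. g u i * g v i) =
            - (\<Sum>i\<in>UNIV. ((V *v (u + v)) $ i)\<^sup>2 + d i * ((V *v (u - v)) $ i)\<^sup>2) / (4 * hbar)" .
        have "f u * f v * exp (\<Sum>i\<in>UNIV. g u i * g v i) = nrm *
            (exp (- (\<Sum>i\<in>UNIV. (1 + d i) * ((V *v u) $ i)\<^sup>2) / (4 * hbar)) *
             exp (- (\<Sum>i\<in>UNIV. (1 + d i) * ((V *v v) $ i)\<^sup>2) / (4 * hbar)) * exp (\<Sum>i\<in>UNIV. g u i * g v i))"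
          using nrm_pos by (simp add: f_def)
        also have "\<dots> = K u v"
          unfolding exp_add[symmetric] expo K_def ..
        finally show ?thesis .
      qed
      ultimately show ?thesis
        using sums_mult[OF wd[of "\<lambda>i. g u i * g v i"], of "f u * f v"] by simp
    qed
  qed
qed

text \<open>The Gaussian density of the largest ellipsoid, with inverse and determinant of its
  covariance matrix computed; see \<open>gaussian_density_\<Sigma>0\<close>.\<close>

definition wig :: "real ^ ('n + 'n) \<Rightarrow> real" where
  "wig z = (1 / (pi * hbar)) ^ CARD('n) / (\<Prod>i\<in>UNIV. sqrt (d i)) *
    exp (- ((\<Sum>i\<in>UNIV. ((V *v xproj z) $ i)\<^sup>2) +
      (\<Sum>i\<in>UNIV. ((matrix_inv (transpose V) *v pproj z) $ i)\<^sup>2 / d i)) / hbar)"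

lemma wigner_K: "wigner_of_kernel hbar K z = of_real (wig z)"
proof -
  let ?c = "\<lambda>i. d i / (4 * hbar)"
  let ?p = "- (1 / hbar) *\<^sub>R pproj z"
  let ?w = "matrix_inv (transpose V) *v pproj z"
  have c: "?c i > 0" for i using d_pos hbar by simp
  have phase: "- (\<i> / of_real hbar) * of_real (pproj z \<bullet> y) = \<i> * of_real (?p \<bullet> y)" for y
    using hbar by simp
  have wp: "(matrix_inv (transpose V) *v ?p) $ i = - (1 / hbar) * ?w $ i" for i
    by (simp only: matrix_vector_mult_scaleR vector_scaleR_component real_scaleR_def)
  have "(LINT y|lborel. exp (- (\<i> / of_real hbar) * of_real (pproj z \<bullet> y)) *
      of_real (K (xproj z + (1/2) *\<^sub>R y) (xproj z - (1/2) *\<^sub>R y))) =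
    (LINT y|lborel. of_real ((r (xproj z))\<^sup>2) *
      (exp (\<i> * of_real (?p \<bullet> y)) * of_real (exp (- (\<Sum>i\<in>UNIV. ?c i * ((V *v y) $ i)\<^sup>2)))))"
    unfolding phase K_midpoint of_real_mult by (simp only: mult_ac)
  also have "\<dots> = of_real ((r (xproj z))\<^sup>2) *
      of_real (sqrt pi ^ CARD('n) / ((\<Prod>i\<in>UNIV. sqrt (?c i)) * \<bar>det V\<bar>) *
        exp (- (\<Sum>i\<in>UNIV. ((matrix_inv (transpose V) *v ?p) $ i)\<^sup>2 / (4 * ?c i))))"
    using has_bochner_integral_gaussian_diag(2)[of V ?c ?p, OF V c]
    by (simp only: integral_mult_right_zero has_bochner_integral_integral_eq)
  also have "(\<Sum>i\<in>UNIV. ((matrix_inv (transpose V) *v ?p) $ i)\<^sup>2 / (4 * ?c i)) = (\<Sum>i\<in>UNIV. (?w $ i)\<^sup>2 / d i) / hbar"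
    unfolding wp sum_divide_distrib using hbar
    by (intro sum.cong refl) (simp add: power2_eq_square field_simps)
  finally have int: "(LINT y|lborel. exp (- (\<i> / of_real hbar) * of_real (pproj z \<bullet> y)) *
      of_real (K (xproj z + (1/2) *\<^sub>R y) (xproj z - (1/2) *\<^sub>R y))) =
      of_real ((r (xproj z))\<^sup>2 * (sqrt pi ^ CARD('n) / ((\<Prod>i\<in>UNIV. sqrt (?c i)) * \<bar>det V\<bar>) *
        exp (- ((\<Sum>i\<in>UNIV. (?w $ i)\<^sup>2 / d i) / hbar))))"
    by (simp only: of_real_mult)
  have sqrt_c: "(\<Prod>i\<in>UNIV. sqrt (?c i)) = (\<Prod>i\<in>UNIV. sqrt (d i)) / (2 * sqrt hbar) ^ CARD('n)"
    by (simp add: real_sqrt_divide real_sqrt_mult prod_dividef)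
  have const: "(1 / (2 * pi * hbar)) ^ CARD('n) * (nrm * (sqrt pi ^ CARD('n) / ((\<Prod>i\<in>UNIV. sqrt (?c i)) * \<bar>det V\<bar>))) =
      (1 / (pi * hbar)) ^ CARD('n) / (\<Prod>i\<in>UNIV. sqrt (d i))"
    using V hbar unfolding sqrt_c
    by (simp add: nrm_def invertible_det_nz power_mult_distrib power_divide real_sqrt_mult)
  have "wigner_of_kernel hbar K z = of_real ((1 / (2 * pi * hbar)) ^ CARD('n) *
      ((r (xproj z))\<^sup>2 * (sqrt pi ^ CARD('n) / ((\<Prod>i\<in>UNIV. sqrt (?c i)) * \<bar>det V\<bar>) *
        exp (- ((\<Sum>i\<in>UNIV. (?w $ i)\<^sup>2 / d i) / hbar)))))"
    unfolding wigner_of_kernel_def int by (simp only: of_real_mult)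
  also have "(1 / (2 * pi * hbar)) ^ CARD('n) *
      ((r (xproj z))\<^sup>2 * (sqrt pi ^ CARD('n) / ((\<Prod>i\<in>UNIV. sqrt (?c i)) * \<bar>det V\<bar>) *
        exp (- ((\<Sum>i\<in>UNIV. (?w $ i)\<^sup>2 / d i) / hbar)))) =
      ((1 / (2 * pi * hbar)) ^ CARD('n) * (nrm * (sqrt pi ^ CARD('n) / ((\<Prod>i\<in>UNIV. sqrt (?c i)) * \<bar>det V\<bar>)))) *
      (exp (- (\<Sum>i\<in>UNIV. (1 / hbar) * ((V *v xproj z) $ i)\<^sup>2)) * exp (- ((\<Sum>i\<in>UNIV. (?w $ i)\<^sup>2 / d i) / hbar)))"
    unfolding r_power2 by (simp only: mult_ac)
  also have "\<dots> = wig z"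
  proof -
    have "- (\<Sum>i\<in>UNIV. (1 / hbar) * ((V *v xproj z) $ i)\<^sup>2) + - ((\<Sum>i\<in>UNIV. (?w $ i)\<^sup>2 / d i) / hbar) =
        - ((\<Sum>i\<in>UNIV. ((V *v xproj z) $ i)\<^sup>2) + (\<Sum>i\<in>UNIV. (?w $ i)\<^sup>2 / d i)) / hbar"
      by (simp add: sum_distrib_left[symmetric] diff_divide_distrib sum_divide_distrib[of _ _ hbar, symmetric])
    then show ?thesis unfolding const exp_add[symmetric] wig_def by simp
  qed
  finally show ?thesis .
qed

text \<open>In midpoint coordinates K^2 is the product of a Gaussian in x, with coefficients 2 /
  hbar, and one in y, with coefficients d i / (2 hbar). Only the latter involves d, and each
  coordinate contributes 1 / sqrt (d i).\<close>

lemma hilbert_schmidt_K: "hilbert_schmidt = (\<Prod>i\<in>UNIV. 1 / sqrt (d i))"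
proof -
  let ?g = "\<lambda>x. (\<Sum>i\<in>UNIV. 2 / hbar * ((V *v x) $ i)\<^sup>2)"
  let ?k = "\<lambda>y. (\<Sum>i\<in>UNIV. d i / (2 * hbar) * ((V *v y) $ i)\<^sup>2)"
  have K2: "(K (x + (1/2) *\<^sub>R y) (x - (1/2) *\<^sub>R y))\<^sup>2 = nrm\<^sup>2 * exp (- ?g x) * exp (- ?k y)" for x y
  proof -
    have "(exp (- a))\<^sup>2 = exp (- (2 * a))" for a :: real
      by (simp add: exp_double[symmetric])
    then show ?thesis
      unfolding K_midpoint r_power2 power_mult_distrib by (simp add: sum_distrib_left)
  qed
  let ?G = "sqrt pi ^ CARD('n) / ((\<Prod>i\<in>(UNIV :: 'n set). sqrt (2 / hbar)) * \<bar>det V\<bar>)"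
  let ?H = "sqrt pi ^ CARD('n) / ((\<Prod>i\<in>UNIV. sqrt (d i / (2 * hbar))) * \<bar>det V\<bar>)"
  have G: "has_bochner_integral lborel (\<lambda>x. exp (- ?g x)) ?G"
    by (rule has_bochner_integral_gaussian_diag[OF V]) (use hbar in simp)
  have H: "has_bochner_integral lborel (\<lambda>x. exp (- ?k x)) ?H"
    by (rule has_bochner_integral_gaussian_diag[OF V]) (use hbar d_pos in simp)
  have [measurable]: "(\<lambda>z. ennreal ((K (fst z) (snd z))\<^sup>2)) \<in> borel_measurable (borel \<Otimes>\<^sub>M borel)"
    by measurable
  have nn: "(\<integral>\<^sup>+x. ennreal (f x) \<partial>lborel) = ennreal I"
    if "has_bochner_integral lborel f I" "\<And>x. f x \<ge> 0" for f :: "real ^ 'n \<Rightarrow> real" and I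
    using that by (subst nn_integral_eq_integral) (auto simp: has_bochner_integral_iff)
  have "ennreal hilbert_schmidt = (\<integral>\<^sup>+u. ennreal (LINT v|lborel. (K u v)\<^sup>2) \<partial>lborel)"
    unfolding hilbert_schmidt_def
    by (intro nn_integral_eq_integral[symmetric] K_square_integrable AE_I2 integral_nonneg_AE) simp
  also have "\<dots> = (\<integral>\<^sup>+u. \<integral>\<^sup>+v. ennreal ((K u v)\<^sup>2) \<partial>lborel \<partial>lborel)"
    using L2_integrable[OF K_row_L2] by (intro nn_integral_cong nn_integral_eq_integral[symmetric]) simp_all
  also have "\<dots> = (\<integral>\<^sup>+x. \<integral>\<^sup>+y. ennreal ((K (x + (1/2) *\<^sub>R y) (x - (1/2) *\<^sub>R y))\<^sup>2) \<partial>lborel \<partial>lborel)"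
    using nn_integral_midpoint[of "\<lambda>z. ennreal ((K (fst z) (snd z))\<^sup>2)"] by simp
  also have "\<dots> = (\<integral>\<^sup>+x. ennreal (nrm\<^sup>2 * exp (- ?g x) * ?H) \<partial>lborel)"
    unfolding K2 by (intro nn_integral_cong nn has_bochner_integral_mult_right H) simp
  also have "\<dots> = ennreal (nrm\<^sup>2 * ?G * ?H)"
  proof (rule nn)
    show "has_bochner_integral lborel (\<lambda>x. nrm\<^sup>2 * exp (- ?g x) * ?H) (nrm\<^sup>2 * ?G * ?H)"
      by (intro has_bochner_integral_mult_right has_bochner_integral_mult_left G)
    show "0 \<le> nrm\<^sup>2 * exp (- ?g x) * ?H" for x
      using d_pos hbar by (intro mult_nonneg_nonneg divide_nonneg_nonneg prod_nonneg) (simp_all add: less_imp_le)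
  qed
  finally have "hilbert_schmidt = nrm\<^sup>2 * ?G * ?H"
    using hilbert_schmidt_nonneg d_pos hbar
    by (subst (asm) ennreal_inj) (auto intro!: mult_nonneg_nonneg divide_nonneg_nonneg prod_nonneg simp: less_imp_le)
  also have "\<dots> = (\<Prod>i\<in>UNIV. 1 / sqrt (d i))"
  proof -
    have k: "(\<Prod>i\<in>UNIV. sqrt (d i / (2 * hbar))) = (\<Prod>i\<in>UNIV. sqrt (d i)) / (sqrt 2 ^ CARD('n) * sqrt hbar ^ CARD('n))"
      by (simp add: real_sqrt_divide real_sqrt_mult prod_dividef power_mult_distrib)
    have g: "(\<Prod>i\<in>(UNIV :: 'n set). sqrt (2 / hbar)) = sqrt 2 ^ CARD('n) / sqrt hbar ^ CARD('n)"
      by (simp add: real_sqrt_divide power_divide)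
    have n: "nrm = \<bar>det V\<bar> / (sqrt pi ^ CARD('n) * sqrt hbar ^ CARD('n))"
      by (simp add: nrm_def real_sqrt_mult power_mult_distrib)
    have p: "(\<Prod>i\<in>UNIV. 1 / sqrt (d i)) = 1 / (\<Prod>i\<in>UNIV. sqrt (d i))"
      by (simp add: prod_dividef)
    have P: "(\<Prod>i\<in>UNIV. sqrt (d i)) \<noteq> 0" using d_pos by (simp add: less_imp_neq[symmetric])
    have "(D / (S * T))\<^sup>2 * (S / (R / T * D)) * (S / (P / (R * T) * D)) = 1 / P"
      if "D \<noteq> 0" "S \<noteq> 0" "T \<noteq> 0" "R \<noteq> 0" "P \<noteq> 0" for D S T R P :: real
      using that by (simp add: power2_eq_square)
    then show ?thesis
      unfolding k g n p using V hbar P by (simp add: invertible_det_nz)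
  qed
  finally show ?thesis .
qed

lemma hilbert_schmidt_lt_1:
  assumes "d k \<noteq> 1"
  shows "hilbert_schmidt < 1"
proof -
  have le: "0 \<le> 1 / sqrt (d i) \<and> 1 / sqrt (d i) \<le> 1" for i
    using d[of i] by simp
  have "hilbert_schmidt = 1 / sqrt (d k) * (\<Prod>i\<in>UNIV - {k}. 1 / sqrt (d i))"
    unfolding hilbert_schmidt_K by (rule prod.remove) simp_all
  also have "\<dots> \<le> 1 / sqrt (d k) * 1"
    using le by (intro mult_left_mono prod_le_1) auto
  also have "\<dots> < 1" using assms d[of k] by simp
  finally show ?thesis .
qed

lemma state_of_wigner_unique:
  assumes q: "quantum_state \<rho>" and w: "has_wigner_distribution hbar \<rho> (\<lambda>z. of_real (wig z))"
    and f: "f \<in> L2"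
  shows "AE x in lborel. \<rho> f x = Kop f x"
proof -
  obtain \<mu> \<psi> where dec: "state_decomposition \<rho> \<mu> \<psi>"
    and sums: "\<And>z. (\<lambda>j. of_real (\<mu> j) * wigner hbar (\<psi> j) z) sums of_real (wig z)"
    using w by (auto simp: has_wigner_distribution_def)
  have "AE u in lborel. AE v in lborel. (\<lambda>j. mixture_term \<mu> \<psi> j u v) sums of_real (K u v)"
    using dec hbar K_measurable K_midpoint_integrable
    by (rule kernel_of_wigner) (use sums in \<open>simp add: wigner_K\<close>)
  then show ?thesis
    using q dec f by (intro kernel_of_decomposition)
      (auto simp: mixture_term_def quantum_state_def possemidef_operator_def)
qed

lemma gaussian_state_exists:
  "\<exists>\<rho>. quantum_state \<rho> \<and> has_wigner_distribution hbar \<rho> (\<lambda>z. of_real (wig z))"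
proof -
  obtain h :: "nat \<Rightarrow> real ^ 'n \<Rightarrow> real" where
    h: "\<And>j. h j \<in> borel_measurable borel" "\<And>u v. (\<lambda>j. h j u * h j v) sums K u v"
    using K_expansion by blast
  obtain \<mu> \<psi> where dec: "state_decomposition Kop \<mu> \<psi>"
    and mix: "\<And>j. AE u in lborel. \<forall>v. mixture_term \<mu> \<psi> j u v = of_real (h j u * h j v)"
    using has_integral_r_power2 state_decomposition_of_expansion[OF h K_diag]
    by (auto simp: has_bochner_integral_iff)
  \<comment> \<open>The exceptional set restricts u alone, so its preimage under y \<mapsto> x + y/2
    is null for every x. Thus the Wigner series is identified at every point z.\<close>
  have "AE u in lborel. \<forall>j. \<forall>v. mixture_term \<mu> \<psi> j u v = of_real (h j u * h j v)"
    using mix by (simp add: AE_all_countable)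
  then have AE: "AE u in lborel. \<forall>v. (\<lambda>j. mixture_term \<mu> \<psi> j u v) sums of_real (K u v)"
  proof eventually_elim
    case (elim u)
    have "(\<lambda>j. of_real (h j u * h j v)) sums (of_real (K u v) :: complex)" for v
      by (rule sums_of_real[OF h(2)])
    with elim show ?case by simp
  qed
  have half: "(1/2 :: real) \<noteq> 0" by simp
  have "(\<lambda>j. of_real (\<mu> j) * wigner hbar (\<psi> j) z) sums of_real (wig z)" for z
    unfolding wigner_K[symmetric]
  proof (rule wigner_sums_of_kernel[OF dec])
    show "AE y in lborel. (\<lambda>j. mixture_term \<mu> \<psi> j (xproj z + (1/2) *\<^sub>R y) (xproj z - (1/2) *\<^sub>R y))
        sums of_real (K (xproj z + (1/2) *\<^sub>R y) (xproj z - (1/2) *\<^sub>R y))"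
      using AE_affine[OF AE half, of "xproj z"] by eventually_elim auto
  qed measurable
  then show ?thesis
    using dec quantum_state_of_decomposition[OF dec Kop_operator] unfolding has_wigner_distribution_def by blast
qed

end

section \<open>The two quantum blobs and the largest ellipsoid\<close>

context gaussian_kernel
begin

section \<open>The given ellipsoids, and the two blobs, in terms of V and d\<close>

definition A :: "real ^ 'n ^ 'n" where "A = transpose V ** V"

definition B :: "real ^ 'n ^ 'n" where
  "B = matrix_inv V ** diag_mat (\<lambda>i. 1 / d i) ** matrix_inv (transpose V)"

abbreviation X :: "(real ^ 'n) set" where "X \<equiv> quad_ellipsoid A hbar"
abbreviation P :: "(real ^ 'n) set" where "P \<equiv> quad_ellipsoid B hbar"

definition E :: "real ^ 'n ^ 'n" where "E = diag_mat (\<lambda>i. sqrt (d i - 1))"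

lemma VT: "invertible (transpose V)"
  using V by (simp add: invertible_transpose)

lemmas V_cancel = matrix_inv_mult_cancel[OF V]
lemmas VT_cancel = matrix_inv_mult_cancel[OF VT]

lemma transpose_inv_V: "transpose (matrix_inv V) = matrix_inv (transpose V)"
  using transpose_matrix_inv[OF V] by simp

lemma A_form: "(A *v x) \<bullet> x = (norm (V *v x))\<^sup>2"
  by (simp add: A_def power2_norm_eq_inner inner_transpose_mult flip: matrix_vector_mul_assoc
      del: transpose_matrix_vector)

lemma B_form: "(B *v p) \<bullet> p = (\<Sum>i\<in>UNIV. ((matrix_inv (transpose V) *v p) $ i)\<^sup>2 / d i)"
proof -
  let ?w = "matrix_inv (transpose V) *v p"
  have "(B *v p) \<bullet> p = (matrix_inv V *v (diag_mat (\<lambda>i. 1 / d i) *v ?w)) \<bullet> p"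
    by (simp only: B_def matrix_vector_mul_assoc matrix_mul_assoc)
  also have "\<dots> = (diag_mat (\<lambda>i. 1 / d i) *v ?w) \<bullet> ?w"
    using inner_transpose_mult[of "matrix_inv (transpose V)"] transpose_matrix_inv[OF VT]
    by (simp del: transpose_matrix_vector)
  finally show ?thesis
    by (simp add: inner_vec_def power2_eq_square)
qed

lemma A_inv: "matrix_inv A = matrix_inv V ** matrix_inv (transpose V)"
  unfolding A_def by (intro matrix_inv_unique) (simp add: V_cancel VT_cancel flip: matrix_mul_assoc)

lemma B_mult: "B ** (transpose V ** diag_mat d ** V) = mat 1"
proof -
  have "diag_mat (\<lambda>i. 1 / d i) ** (diag_mat d ** M) = M" for M :: "real ^ 'n ^ 'n"
    using d_pos by (simp add: matrix_mul_assoc diag_mat_1 less_imp_neq[symmetric])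
  then show ?thesis
    unfolding B_def by (simp add: V_cancel VT_cancel flip: matrix_mul_assoc)
qed

lemma B_inv: "matrix_inv B = transpose V ** diag_mat d ** V"
  by (rule matrix_inv_unique) (rule B_mult)

lemma B_eq: "matrix_inv (transpose V ** diag_mat d ** V) = B"
  by (rule matrix_inv_unique) (use B_mult in \<open>simp add: matrix_left_right_inverse\<close>)

lemma mem_X: "x \<in> X \<longleftrightarrow> (norm (V *v x))\<^sup>2 \<le> hbar"
  by (simp add: quad_ellipsoid_def A_form)

lemma mem_P: "p \<in> P \<longleftrightarrow> (\<Sum>i\<in>UNIV. ((matrix_inv (transpose V) *v p) $ i)\<^sup>2 / d i) \<le> hbar"
  by (simp add: quad_ellipsoid_def B_form)

text \<open>Turns the hypothesis that the polar dual differs from \<open>P\<close> into the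
  existence of an index with d k \<noteq> 1.\<close>

lemma polar_dual_X_superset:
  assumes "\<And>i. d i = 1"
  shows "P \<subseteq> polar_dual hbar X"
proof
  fix p assume p: "p \<in> P"
  let ?w = "matrix_inv (transpose V) *v p"
  have w: "norm ?w \<le> sqrt hbar"
    using p assms hbar by (simp add: mem_P norm_le_sqrt_iff norm_power2_vec)
  have "p \<bullet> x \<le> hbar" if x: "x \<in> X" for x
  proof -
    have "p \<bullet> x = (transpose V *v ?w) \<bullet> x" by (simp only: VT_cancel)
    also have "\<dots> = ?w \<bullet> (V *v x)" by (rule inner_transpose_mult)
    also have "\<dots> \<le> norm ?w * norm (V *v x)" by (rule norm_cauchy_schwarz)
    also have "\<dots> \<le> sqrt hbar * sqrt hbar"
      using w x hbar by (intro mult_mono) (simp_all add: mem_X norm_le_sqrt_iff)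
    finally show ?thesis using hbar by simp
  qed
  then show "p \<in> polar_dual hbar X" by (simp add: polar_dual_def)
qed

text \<open>The shear with symmetric matrix - s E followed by the scaling (x, p) \<mapsto> (V^{-1}
  x, V^T p). For s^2 = 1 the momentum form becomes V^T (E^2 + I) V = B^{-1}, as the projection onto
  \<open>P\<close> demands. The minus sign matches the phase of \<open>gaussian_state\<close>, whose
  gradient times hbar is - s V^T E V x.\<close>

definition S :: "real \<Rightarrow> real ^ ('n + 'n) ^ ('n + 'n)" where
  "S s = block_matrix (matrix_inv V) 0 (- s *\<^sub>R (transpose V ** E)) (transpose V)"

definition T :: "real \<Rightarrow> real ^ ('n + 'n) ^ ('n + 'n)" where
  "T s = block_matrix V 0 (s *\<^sub>R (E ** V)) (matrix_inv (transpose V))"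

lemma ST: "S s ** T s = mat 1"
  by (simp add: S_def T_def block_matrix_mult mat_1_block matrix_mul_scaleR matrix_mul_zero V_cancel VT_cancel
      matrix_mul_minus flip: matrix_mul_assoc)

lemma S_inv: "matrix_inv (S s) = T s"
  by (rule matrix_inv_unique) (rule ST)

lemma S_invertible: "invertible (S s)"
  using ST by (auto simp: invertible_right_inverse)

lemma S_Sp: "S s \<in> Sp"
proof -
  have ET: "transpose E = E" by (simp add: E_def)
  have "transpose (S s) = block_matrix (matrix_inv (transpose V)) (- s *\<^sub>R (E ** V)) 0 V"
    by (simp add: S_def transpose_block_matrix transpose_inv_V transpose_scalar matrix_transpose_mul ET)
  then show ?thesis
    by (simp add: Sp_def Jmat_def S_def block_matrix_mult matrix_mul_scaleR matrix_mul_zero matrix_mul_minus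
        V_cancel VT_cancel flip: matrix_mul_assoc)
qed

definition blob :: "real \<Rightarrow> (real ^ ('n + 'n)) set" where
  "blob s = (\<lambda>z. S s *v z) ` cball 0 (sqrt hbar)"

lemma mem_blob: "z \<in> blob s \<longleftrightarrow> (norm (T s *v z))\<^sup>2 \<le> hbar"
proof -
  have "z \<in> blob s \<longleftrightarrow> norm (T s *v z) \<le> sqrt hbar"
  proof
    assume "z \<in> blob s"
    then show "norm (T s *v z) \<le> sqrt hbar"
      using matrix_inv_mult_cancel(4)[OF S_invertible] by (auto simp: blob_def S_inv)
  next
    assume "norm (T s *v z) \<le> sqrt hbar"
    moreover have "z = S s *v (T s *v z)"
      using matrix_inv_mult_cancel(3)[OF S_invertible, of s z] by (simp add: S_inv)
    ultimately show "z \<in> blob s" unfolding blob_def by (metis image_eqI mem_cball_0)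
  qed
  then show ?thesis using hbar by (simp add: norm_le_sqrt_iff)
qed

lemma T_proj:
  "xproj (T s *v z) = V *v xproj z"
  "pproj (T s *v z) = s *\<^sub>R (E *v (V *v xproj z)) + matrix_inv (transpose V) *v pproj z"
  by (simp_all add: T_def matrix_vector_scaleR flip: matrix_vector_mul_assoc)

lemma E_nth: "(E *v x) $ i = sqrt (d i - 1) * x $ i"
  by (simp add: E_def)

lemma blob_subset:
  assumes z: "z \<in> blob s" and s: "s\<^sup>2 = 1"
  shows "xproj z \<in> X" "pproj z \<in> P"
proof -
  let ?a = "V *v xproj z" and ?w = "matrix_inv (transpose V) *v pproj z"
  let ?b = "s *\<^sub>R (E *v ?a) + ?w"
  have ab: "(norm ?a)\<^sup>2 + (norm ?b)\<^sup>2 \<le> hbar"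
    using z by (simp add: mem_blob phase_norm_power2 T_proj)
  then show "xproj z \<in> X" unfolding mem_X by (rule order_trans[rotated]) simp
  have "(?w $ i)\<^sup>2 / d i \<le> (?a $ i)\<^sup>2 + (?b $ i)\<^sup>2" for i
  proof -
    define a b e where "a = ?a $ i" and "b = ?b $ i" and "e = s * sqrt (d i - 1)"
    have w: "?w $ i = b - e * a" by (simp add: a_def b_def e_def E_nth)
    have e2: "e\<^sup>2 = d i - 1" using s d[of i] by (simp add: e_def power_mult_distrib)
    \<comment> \<open>The Lagrange identity behind Cauchy-Schwarz for the vectors (-e, 1) and (a,
      b); the factor 1 + e^2 is d i.\<close>
    have "(b - e * a)\<^sup>2 + (a + e * b)\<^sup>2 = (1 + e\<^sup>2) * (a\<^sup>2 + b\<^sup>2)"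
      by (simp add: power2_eq_square algebra_simps)
    moreover have "1 + e\<^sup>2 = d i" by (simp add: e2)
    ultimately have "(b - e * a)\<^sup>2 \<le> d i * (a\<^sup>2 + b\<^sup>2)"
      using zero_le_power2[of "a + e * b"] by (simp only:)
    then show ?thesis
      using d_pos[of i] unfolding w a_def[symmetric] b_def[symmetric]
      by (simp only: divide_le_eq mult.commute if_True)
  qed
  then have "(\<Sum>i\<in>UNIV. (?w $ i)\<^sup>2 / d i) \<le> (\<Sum>i\<in>UNIV. (?a $ i)\<^sup>2 + (?b $ i)\<^sup>2)"
    by (rule sum_mono)
  also have "\<dots> = (norm ?a)\<^sup>2 + (norm ?b)\<^sup>2" by (simp only: norm_power2_vec sum.distrib)
  finally show "pproj z \<in> P" unfolding mem_P using ab by simp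
qed

lemma xproj_blob:
  assumes s: "s\<^sup>2 = 1"
  shows "xproj ` blob s = X"
proof (intro equalityI subsetI)
  show "x \<in> X" if "x \<in> xproj ` blob s" for x
    using that blob_subset[OF _ s] by auto
  fix x assume x: "x \<in> X"
  \<comment> \<open>The momentum is chosen to make the momentum part of \<open>T s *v z\<close>
    vanish.\<close>
  define z where "z = vec_join x (transpose V *v (- s *\<^sub>R (E *v (V *v x))))"
  have "z \<in> blob s"
    using x unfolding mem_blob phase_norm_power2 T_proj
    by (simp add: z_def mem_X VT_cancel del: transpose_matrix_vector)
  moreover have "xproj z = x" by (simp add: z_def)
  ultimately show "x \<in> xproj ` blob s" by blast
qed

lemma pproj_blob:
  assumes s: "s\<^sup>2 = 1"
  shows "pproj ` blob s = P"
proof (intro equalityI subsetI)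
  show "p \<in> P" if "p \<in> pproj ` blob s" for p
    using that blob_subset[OF _ s] by auto
  fix p assume p: "p \<in> P"
  define w where "w = matrix_inv (transpose V) *v p"
  \<comment> \<open>The equality case of the estimate in \<open>blob_subset\<close>: with b = w / d
    and e = s sqrt (d - 1) one needs a = - e b.\<close>
  define a where "a = (\<chi> i. - (s * sqrt (d i - 1) * w $ i / d i))"
  define z where "z = vec_join (matrix_inv V *v a) p"
  have b: "(s *\<^sub>R (E *v a) + w) $ i = w $ i / d i" for i
  proof -
    have "(s *\<^sub>R (E *v a) + w) $ i = w $ i - (s\<^sup>2 * (sqrt (d i - 1))\<^sup>2) * w $ i / d i"
      by (simp add: E_nth a_def power2_eq_square)
    then show ?thesis using s d[of i] by (simp add: field_simps)
  qed
  have "(norm (T s *v z))\<^sup>2 = (\<Sum>i\<in>UNIV. (a $ i)\<^sup>2 + (w $ i / d i)\<^sup>2)"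
    unfolding phase_norm_power2 T_proj norm_power2_vec sum.distrib
    by (simp add: z_def V_cancel b del: vector_add_component flip: w_def)
  also have "\<dots> = (\<Sum>i\<in>UNIV. (w $ i)\<^sup>2 / d i)"
  proof (intro sum.cong refl)
    fix i
    have a2: "(a $ i)\<^sup>2 = (d i - 1) * (w $ i)\<^sup>2 / (d i)\<^sup>2"
      using s d[of i] by (simp add: a_def power_mult_distrib power_divide)
    show "(a $ i)\<^sup>2 + (w $ i / d i)\<^sup>2 = (w $ i)\<^sup>2 / d i"
      unfolding a2 using d_pos[of i] by (simp add: power_divide power2_eq_square field_simps)
  qed
  also have "\<dots> \<le> hbar" using p by (simp add: mem_P w_def)
  finally have "z \<in> blob s" by (simp add: mem_blob)
  moreover have "pproj z = p" by (simp add: z_def)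
  ultimately show "p \<in> pproj ` blob s" by blast
qed

lemma blob_distinct:
  assumes k: "d k \<noteq> 1"
  shows "blob 1 \<noteq> blob (- 1)"
proof
  assume eq: "blob 1 = blob (- 1)"
  \<comment> \<open>Here |a|^2 exhausts the radius, so membership in \<open>blob s\<close> forces
    the transformed momentum to be - s E a. For s = 1 this is the momentum of \<open>z\<close>; for
    s = -1 it would give E a = 0, against d k \<noteq> 1.\<close>
  define a where "a = sqrt hbar *\<^sub>R axis k (1 :: real)"
  define z where "z = vec_join (matrix_inv V *v a) (transpose V *v (- (E *v a)))"
  have a2: "(norm a)\<^sup>2 = hbar" using hbar by (simp add: a_def power_mult_distrib)
  have "z \<in> blob 1"
    unfolding mem_blob phase_norm_power2 T_proj
    by (simp add: z_def V_cancel VT_cancel a2 del: transpose_matrix_vector)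
  with eq have "z \<in> blob (- 1)" by simp
  then have "(norm a)\<^sup>2 + (norm ((- 1) *\<^sub>R (E *v a) + - (E *v a)))\<^sup>2 \<le> hbar"
    unfolding mem_blob phase_norm_power2 T_proj by (simp only: z_def proj_vec_join V_cancel VT_cancel)
  then have "(- 1) *\<^sub>R (E *v a) + - (E *v a) = 0" by (simp add: a2)
  then have "((- 1) *\<^sub>R (E *v a) + - (E *v a)) $ k = 0 $ k" by (simp only:)
  then have "(E *v a) $ k = 0" by simp
  then show False using k hbar by (simp add: E_nth a_def)
qed

subsection \<open>The pure Gaussian states\<close>

abbreviation \<Sigma>XX :: "real ^ 'n ^ 'n" where "\<Sigma>XX \<equiv> (hbar / 2) *\<^sub>R matrix_inv A"

abbreviation \<Sigma>XP :: "real ^ 'n ^ 'n" where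
  "\<Sigma>XP \<equiv> (hbar / 2) *\<^sub>R diag_sqrt (matrix_inv B ** matrix_inv A - mat 1)"

lemma diag_sqrt_BA: "diag_sqrt (matrix_inv B ** matrix_inv A - mat 1) = transpose V ** E ** matrix_inv (transpose V)"
proof -
  let ?W = "matrix_inv (transpose V)"
  have "matrix_inv B ** matrix_inv A = transpose V ** diag_mat d ** ?W"
    unfolding A_inv B_inv by (simp add: V_cancel flip: matrix_mul_assoc)
  moreover have "diag_mat (\<lambda>i. d i - 1) = diag_mat d - (mat 1 :: real ^ 'n ^ 'n)"
    by (simp add: vec_eq_iff mat_def)
  ultimately have "matrix_inv B ** matrix_inv A - mat 1 = transpose V ** diag_mat (\<lambda>i. d i - 1) ** ?W"
    by (simp add: matrix_mul_diff VT_cancel)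
  then show ?thesis
    unfolding E_def using d by (simp add: diag_sqrt_conjugate_diag[OF VT])
qed

lemma \<Sigma>XX_inv: "matrix_inv \<Sigma>XX = (2 / hbar) *\<^sub>R A"
proof (rule matrix_inv_unique)
  have "invertible A" using V by (simp add: A_def invertible_det_nz det_mul)
  then show "\<Sigma>XX ** ((2 / hbar) *\<^sub>R A) = mat 1"
    using hbar by (simp add: matrix_mul_scaleR matrix_inv_mult_cancel)
qed

lemma \<Sigma>XP_\<Sigma>XX_inv: "\<Sigma>XP ** matrix_inv \<Sigma>XX = transpose V ** E ** V"
proof -
  have "diag_sqrt (matrix_inv B ** matrix_inv A - mat 1) ** A = transpose V ** E ** V"
    unfolding diag_sqrt_BA by (simp add: A_def VT_cancel flip: matrix_mul_assoc)
  then show ?thesis using hbar unfolding \<Sigma>XX_inv by (simp add: matrix_mul_scaleR)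
qed

abbreviation \<psi> :: "real \<Rightarrow> real ^ 'n \<Rightarrow> complex" where
  "\<psi> s \<equiv> gaussian_state hbar s \<Sigma>XX \<Sigma>XP"

lemma gaussian_state_prefactor_aux:
  "(1 / (2 * pi)) ^ CARD('n) / ((hbar / 2) ^ CARD('n) / \<bar>det V\<bar>\<^sup>2) = nrm\<^sup>2"
proof -
  have "(sqrt (pi * hbar) ^ CARD('n))\<^sup>2 = (pi * hbar) ^ CARD('n)"
    using hbar by (simp add: power2_eq_square flip: power_mult_distrib)
  moreover have "(1 / (2 * pi)) ^ CARD('n) / (hbar / 2) ^ CARD('n) = 1 / (pi * hbar) ^ CARD('n)"
    unfolding power_divide[symmetric] power_one_over[symmetric] by simp
  ultimately show ?thesis unfolding nrm_def power_divide[of "\<bar>det V\<bar>"] divide_divide_eq_right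
    by (metis mult.commute mult.right_neutral times_divide_eq_right)
qed

text \<open>Both sides are nonnegative, so fourth powers may be compared, which clears the exponents
  n/4 and 1/4.\<close>

lemma gaussian_state_prefactor:
  "(1 / (2 * pi)) powr (real CARD('n) / 4) * det \<Sigma>XX powr (- 1 / 4) = sqrt nrm"
proof -
  have "invertible A" using V by (simp add: A_def invertible_det_nz det_mul)
  then have "det (matrix_inv A) * det A = 1" by (metis det_I det_mul matrix_inv_mult_cancel(2))
  moreover have "det A = \<bar>det V\<bar>\<^sup>2" by (simp add: A_def det_mul power2_eq_square)
  ultimately have detinv: "det (matrix_inv A) = 1 / \<bar>det V\<bar>\<^sup>2"
    using V by (simp add: invertible_det_nz field_simps)
  then have det\<Sigma>: "det \<Sigma>XX = (hbar / 2) ^ CARD('n) / \<bar>det V\<bar>\<^sup>2"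
    by (simp add: det_scaleR_matrix)
  then have pos: "det \<Sigma>XX > 0" using hbar V by (simp add: invertible_det_nz)
  define c where "c = (1 / (2 * pi)) powr (real CARD('n) / 4) * det \<Sigma>XX powr (- 1 / 4)"
  have "c ^ 4 = ((1 / (2 * pi)) powr (real CARD('n) / 4)) ^ 4 * (det \<Sigma>XX powr (- 1 / 4)) ^ 4"
    by (simp add: c_def power_mult_distrib)
  also have "\<dots> = (1 / (2 * pi)) ^ CARD('n) / det \<Sigma>XX"
  proof -
    have "(det \<Sigma>XX powr (- 1 / 4)) ^ 4 = 1 / det \<Sigma>XX"
      using pos powr_power[where z = "det \<Sigma>XX" and n = 4 and u = "- 1 / 4"] powr_neg_one[of "det \<Sigma>XX"] by simp
    then show ?thesis by (simp add: powr_power powr_realpow)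
  qed
  also have "\<dots> = nrm\<^sup>2"
    unfolding det\<Sigma> by (rule gaussian_state_prefactor_aux)
  finally have "c ^ 4 = (sqrt nrm) ^ 4"
    using nrm_pos by (simp add: power4_eq_xxxx power2_eq_square)
  moreover have "c \<ge> 0" by (simp add: c_def)
  ultimately show ?thesis
    using nrm_pos unfolding c_def[symmetric] by (intro power_eq_imp_eq_base[of c 4 "sqrt nrm"]) simp_all
qed

lemma gaussian_state_eq:
  "\<psi> s x = of_real (r x) * exp (\<i> * of_real (- s / (2 * hbar) * ((E *v (V *v x)) \<bullet> (V *v x))))"
proof -
  have "1/4 * ((matrix_inv \<Sigma>XX *v x) \<bullet> x) = (norm (V *v x))\<^sup>2 / (2 * hbar)"
    unfolding \<Sigma>XX_inv by (simp add: matrix_vector_scaleR A_form)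
  moreover have "((\<Sigma>XP ** matrix_inv \<Sigma>XX) *v x) \<bullet> x = (E *v (V *v x)) \<bullet> (V *v x)"
    unfolding \<Sigma>XP_\<Sigma>XX_inv
    by (simp add: inner_transpose_mult flip: matrix_vector_mul_assoc del: transpose_matrix_vector)
  ultimately have "\<psi> s x = of_real (sqrt nrm) *
      exp (of_real (- (norm (V *v x))\<^sup>2 / (2 * hbar)) +
        \<i> * of_real (- s / (2 * hbar) * ((E *v (V *v x)) \<bullet> (V *v x))))"
    unfolding gaussian_state_def gaussian_state_prefactor by (simp add: algebra_simps)
  then show ?thesis
    unfolding exp_add r_def norm_power2_vec by (simp only: of_real_mult exp_of_real mult.assoc)
qed

lemma gaussian_state_measurable: "\<psi> s \<in> borel_measurable borel"
proof -
  have [measurable]: "(\<lambda>x. (E *v (V *v x)) \<bullet> (V *v x)) \<in> borel_measurable borel"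
    by measurable
  show ?thesis unfolding gaussian_state_eq[abs_def] by measurable
qed

lemma cmod_gaussian_state: "cmod (\<psi> s x) = r x"
  unfolding gaussian_state_eq norm_mult norm_exp_i_times using r_nonneg by simp

lemma unit_gaussian_state: "unit_L2 (\<psi> s)"
proof -
  have "\<psi> s \<in> L2"
    using gaussian_state_measurable r_square_integrable by (intro L2_I) (simp_all add: cmod_gaussian_state)
  then show ?thesis
    using has_integral_r_power2
    by (simp add: unit_L2_def L2_norm_def cmod_gaussian_state has_bochner_integral_iff)
qed

text \<open>The phase is a quadratic form, so its difference at x + y/2 and x - y/2 is linear in y
  and merely shifts the momentum, by s V^T E V x. The moduli multiply to a Gaussian in y by the
  parallelogram law. What remains is the Gaussian of a ball in the coordinates
  \<open>T s *v z\<close>.\<close>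

lemma wigner_gaussian_state:
  "wigner hbar (\<psi> s) z =
    of_real (1 / sqrt (pi * hbar) ^ CARD('n + 'n) * exp (- ((norm (T s *v z))\<^sup>2 / hbar)))"
proof -
  define x where "x = xproj z"
  define p where "p = pproj z"
  let ?e = "\<lambda>x. (E *v (V *v x)) \<bullet> (V *v x)"
  define t where "t = transpose V *v (E *v (V *v x))"
  define p' where "p' = (- (1 / hbar)) *\<^sub>R (p + s *\<^sub>R t)"
  have E_sym: "(E *v u) \<bullet> v = (E *v v) \<bullet> u" for u v
    by (simp add: inner_vec_def E_nth mult_ac)
  have e_diff: "?e (x + (1/2) *\<^sub>R y) - ?e (x - (1/2) *\<^sub>R y) = 2 * (t \<bullet> y)" for y
  proof -
    have "?e (x + (1/2) *\<^sub>R y) - ?e (x - (1/2) *\<^sub>R y) = (E *v (V *v x)) \<bullet> (V *v y) + (E *v (V *v y)) \<bullet> (V *v x)"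
      by (simp add: matrix_vector_right_distrib matrix_vector_mult_diff_distrib matrix_vector_mult_scaleR
          inner_add_left inner_add_right inner_diff_left inner_diff_right algebra_simps)
    also have "\<dots> = 2 * ((E *v (V *v x)) \<bullet> (V *v y))"
      using E_sym[of "V *v y" "V *v x"] by simp
    finally show ?thesis by (simp add: t_def inner_transpose_mult del: transpose_matrix_vector)
  qed
  have rr: "r (x + (1/2) *\<^sub>R y) * r (x - (1/2) *\<^sub>R y) =
      (r x)\<^sup>2 * exp (- (\<Sum>i\<in>UNIV. 1 / (4 * hbar) * ((V *v y) $ i)\<^sup>2))" for y
  proof -
    have "- (\<Sum>i\<in>UNIV. ((V *v (x + (1/2) *\<^sub>R y)) $ i)\<^sup>2) / (2 * hbar) +
        - (\<Sum>i\<in>UNIV. ((V *v (x - (1/2) *\<^sub>R y)) $ i)\<^sup>2) / (2 * hbar) =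
        (\<Sum>i\<in>UNIV. - ((V *v (x + (1/2) *\<^sub>R y)) $ i)\<^sup>2 / (2 * hbar) + - ((V *v (x - (1/2) *\<^sub>R y)) $ i)\<^sup>2 / (2 * hbar))"
      by (simp only: sum.distrib sum_divide_distrib[symmetric] sum_negf)
    also have "\<dots> = (\<Sum>i\<in>UNIV. - ((1 / hbar) * ((V *v x) $ i)\<^sup>2) + - (1 / (4 * hbar) * ((V *v y) $ i)\<^sup>2))"
      using hbar
      by (intro sum.cong refl) (simp add: matrix_vector_right_distrib matrix_vector_mult_diff_distrib
          matrix_vector_mult_scaleR power2_eq_square field_simps)
    also have "\<dots> = - (\<Sum>i\<in>UNIV. (1 / hbar) * ((V *v x) $ i)\<^sup>2) + - (\<Sum>i\<in>UNIV. 1 / (4 * hbar) * ((V *v y) $ i)\<^sup>2)"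
      by (simp only: sum.distrib sum_negf)
    finally have expo: "- (\<Sum>i\<in>UNIV. ((V *v (x + (1/2) *\<^sub>R y)) $ i)\<^sup>2) / (2 * hbar) +
        - (\<Sum>i\<in>UNIV. ((V *v (x - (1/2) *\<^sub>R y)) $ i)\<^sup>2) / (2 * hbar) =
        - (\<Sum>i\<in>UNIV. (1 / hbar) * ((V *v x) $ i)\<^sup>2) + - (\<Sum>i\<in>UNIV. 1 / (4 * hbar) * ((V *v y) $ i)\<^sup>2)" .
    have "r (x + (1/2) *\<^sub>R y) * r (x - (1/2) *\<^sub>R y) = nrm *
        (exp (- (\<Sum>i\<in>UNIV. ((V *v (x + (1/2) *\<^sub>R y)) $ i)\<^sup>2) / (2 * hbar)) *
         exp (- (\<Sum>i\<in>UNIV. ((V *v (x - (1/2) *\<^sub>R y)) $ i)\<^sup>2) / (2 * hbar)))"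
      using nrm_pos by (simp add: r_def)
    also have "\<dots> = nrm * (exp (- (\<Sum>i\<in>UNIV. (1 / hbar) * ((V *v x) $ i)\<^sup>2)) *
        exp (- (\<Sum>i\<in>UNIV. 1 / (4 * hbar) * ((V *v y) $ i)\<^sup>2)))"
      unfolding exp_add[symmetric] expo ..
    finally show ?thesis unfolding r_power2 by (simp only: mult.assoc)
  qed
  have "exp (- (\<i> / of_real hbar) * of_real (p \<bullet> y)) * \<psi> s (x + (1/2) *\<^sub>R y) * cnj (\<psi> s (x - (1/2) *\<^sub>R y)) =
      of_real ((r x)\<^sup>2) * (exp (\<i> * of_real (p' \<bullet> y)) *
        of_real (exp (- (\<Sum>i\<in>UNIV. 1 / (4 * hbar) * ((V *v y) $ i)\<^sup>2))))" for y
  proof -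
    have "exp (- (\<i> / of_real hbar) * of_real (p \<bullet> y)) * \<psi> s (x + (1/2) *\<^sub>R y) * cnj (\<psi> s (x - (1/2) *\<^sub>R y)) =
        of_real (r (x + (1/2) *\<^sub>R y) * r (x - (1/2) *\<^sub>R y)) *
        (exp (- (\<i> / of_real hbar) * of_real (p \<bullet> y)) *
         exp (\<i> * of_real (- s / (2 * hbar) * ?e (x + (1/2) *\<^sub>R y))) *
         exp (- (\<i> * of_real (- s / (2 * hbar) * ?e (x - (1/2) *\<^sub>R y)))))"
      unfolding gaussian_state_eq by (simp add: exp_cnj)
    also have "\<dots> = of_real (r (x + (1/2) *\<^sub>R y) * r (x - (1/2) *\<^sub>R y)) * exp (\<i> * of_real (p' \<bullet> y))"
    proof -
      have "- (\<i> / of_real hbar) * of_real (p \<bullet> y) + \<i> * of_real (- s / (2 * hbar) * ?e (x + (1/2) *\<^sub>R y)) +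
          - (\<i> * of_real (- s / (2 * hbar) * ?e (x - (1/2) *\<^sub>R y))) =
          \<i> * of_real (- (1 / hbar) * (p \<bullet> y) - s / (2 * hbar) * (?e (x + (1/2) *\<^sub>R y) - ?e (x - (1/2) *\<^sub>R y)))"
        by (simp add: algebra_simps)
      also have "\<dots> = \<i> * of_real (p' \<bullet> y)"
        unfolding e_diff using hbar by (simp add: p'_def inner_add_left algebra_simps)
      finally show ?thesis unfolding exp_add[symmetric] by simp
    qed
    finally show ?thesis unfolding rr by (simp only: of_real_mult mult_ac)
  qed
  moreover have c: "1 / (4 * hbar) > 0" using hbar by simp
  ultimately have "(LINT y|lborel. exp (- (\<i> / of_real hbar) * of_real (p \<bullet> y)) * \<psi> s (x + (1/2) *\<^sub>R y) * cnj (\<psi> s (x - (1/2) *\<^sub>R y))) =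
      (LINT y|lborel. of_real ((r x)\<^sup>2) * (exp (\<i> * of_real (p' \<bullet> y)) *
        of_real (exp (- (\<Sum>i\<in>UNIV. 1 / (4 * hbar) * ((V *v y) $ i)\<^sup>2)))))"
    by (simp only:)
  also have "\<dots> = of_real ((r x)\<^sup>2) * of_real (sqrt pi ^ CARD('n) / ((\<Prod>i\<in>(UNIV :: 'n set). sqrt (1 / (4 * hbar))) * \<bar>det V\<bar>) *
        exp (- (\<Sum>i\<in>UNIV. ((matrix_inv (transpose V) *v p') $ i)\<^sup>2 / (4 * (1 / (4 * hbar))))))"
    using has_bochner_integral_gaussian_diag(2)[of V "\<lambda>_. 1 / (4 * hbar)" p', OF V c]
    by (simp only: integral_mult_right_zero has_bochner_integral_integral_eq)
  also have "(\<Sum>i\<in>UNIV. ((matrix_inv (transpose V) *v p') $ i)\<^sup>2 / (4 * (1 / (4 * hbar)))) =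
      (norm (pproj (T s *v z)))\<^sup>2 / hbar"
  proof -
    have "matrix_inv (transpose V) *v p' = (- (1 / hbar)) *\<^sub>R pproj (T s *v z)"
      unfolding p'_def t_def T_proj
      by (simp only: matrix_vector_mult_scaleR matrix_vector_right_distrib VT_cancel x_def p_def add.commute)
    then show ?thesis
      unfolding norm_power2_vec sum_divide_distrib using hbar
      by (simp add: power2_eq_square field_simps)
  qed
  finally have int: "(LINT y|lborel. exp (- (\<i> / of_real hbar) * of_real (p \<bullet> y)) * \<psi> s (x + (1/2) *\<^sub>R y) *
      cnj (\<psi> s (x - (1/2) *\<^sub>R y))) = of_real ((r x)\<^sup>2 * (sqrt pi ^ CARD('n) /
      ((\<Prod>i\<in>(UNIV :: 'n set). sqrt (1 / (4 * hbar))) * \<bar>det V\<bar>) * exp (- ((norm (pproj (T s *v z)))\<^sup>2 / hbar))))"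
    by (simp only: of_real_mult)
  have r2: "(r x)\<^sup>2 = nrm * exp (- ((norm (xproj (T s *v z)))\<^sup>2 / hbar))"
    unfolding r_power2 T_proj norm_power2_vec x_def by (simp add: sum_divide_distrib)
  have const: "(1 / (2 * pi * hbar)) ^ CARD('n) * (nrm * (sqrt pi ^ CARD('n) /
      ((\<Prod>i\<in>(UNIV :: 'n set). sqrt (1 / (4 * hbar))) * \<bar>det V\<bar>))) = 1 / sqrt (pi * hbar) ^ CARD('n + 'n)"
  proof -
    have "sqrt (pi * hbar) ^ CARD('n + 'n) = (pi * hbar) ^ CARD('n)"
      using hbar by (simp add: power_add flip: power_mult_distrib)
    moreover have "(\<Prod>i\<in>(UNIV :: 'n set). sqrt (1 / (4 * hbar))) = 1 / (2 * sqrt hbar) ^ CARD('n)"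
      by (simp add: real_sqrt_divide real_sqrt_mult power_divide)
    ultimately show ?thesis
      using V hbar by (simp add: nrm_def invertible_det_nz power_mult_distrib power_divide real_sqrt_mult)
  qed
  have "wigner hbar (\<psi> s) z = of_real ((1 / (2 * pi * hbar)) ^ CARD('n) * ((r x)\<^sup>2 * (sqrt pi ^ CARD('n) /
      ((\<Prod>i\<in>(UNIV :: 'n set). sqrt (1 / (4 * hbar))) * \<bar>det V\<bar>) * exp (- ((norm (pproj (T s *v z)))\<^sup>2 / hbar)))))"
    unfolding wigner_def x_def[symmetric] p_def[symmetric] int by (simp only: of_real_mult)
  also have "(1 / (2 * pi * hbar)) ^ CARD('n) * ((r x)\<^sup>2 * (sqrt pi ^ CARD('n) /
      ((\<Prod>i\<in>(UNIV :: 'n set). sqrt (1 / (4 * hbar))) * \<bar>det V\<bar>) * exp (- ((norm (pproj (T s *v z)))\<^sup>2 / hbar)))) =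
      ((1 / (2 * pi * hbar)) ^ CARD('n) * (nrm * (sqrt pi ^ CARD('n) /
      ((\<Prod>i\<in>(UNIV :: 'n set). sqrt (1 / (4 * hbar))) * \<bar>det V\<bar>)))) *
      (exp (- ((norm (xproj (T s *v z)))\<^sup>2 / hbar)) * exp (- ((norm (pproj (T s *v z)))\<^sup>2 / hbar)))"
    unfolding r2 by (simp only: mult_ac)
  also have "\<dots> = 1 / sqrt (pi * hbar) ^ CARD('n + 'n) * exp (- ((norm (T s *v z))\<^sup>2 / hbar))"
    unfolding const exp_add[symmetric] phase_norm_power2[of "T s *v z"] add_divide_distrib minus_add_distrib ..
  finally show ?thesis .
qed

lemma covariance_ellipsoid_gaussian_state: "has_covariance_ellipsoid hbar (\<psi> s) (blob s)"
  unfolding has_covariance_ellipsoid_def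
proof (intro exI conjI)
  show "has_covariance_matrix (wigner hbar (\<psi> s)) ((hbar / 2) *\<^sub>R (S s ** transpose (S s)))"
    by (rule has_covariance_matrix_gaussian[OF S_invertible abs_det_Sp[OF S_Sp] hbar])
       (simp only: S_inv wigner_gaussian_state)
  show "posdef ((hbar / 2) *\<^sub>R (S s ** transpose (S s)))"
    "blob s = cov_ellipsoid ((hbar / 2) *\<^sub>R (S s ** transpose (S s)))"
    using posdef_scaled_gram[OF S_invertible hbar] by (simp_all add: blob_def)
qed

subsection \<open>The largest ellipsoid\<close>

text \<open>Block diagonal with blocks sqrt hbar V^{-1} and sqrt hbar V^T D^{1/2}: it maps the
  product of two unit balls onto X times P.\<close>

definition S0 :: "real ^ ('n + 'n) ^ ('n + 'n)" where
  "S0 = sqrt hbar *\<^sub>R (S 0 ** block_matrix (mat 1) 0 0 (diag_mat (\<lambda>i. sqrt (d i))))"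

definition T0 :: "real ^ ('n + 'n) ^ ('n + 'n)" where
  "T0 = (1 / sqrt hbar) *\<^sub>R (block_matrix (mat 1) 0 0 (diag_mat (\<lambda>i. 1 / sqrt (d i))) ** T 0)"

lemma S0_T0: "S0 ** T0 = mat 1"
proof -
  have "diag_mat (\<lambda>i. sqrt (d i)) ** diag_mat (\<lambda>i. 1 / sqrt (d i)) = (mat 1 :: real ^ 'n ^ 'n)"
    using d_pos by (simp add: diag_mat_1 less_imp_neq[symmetric])
  then have "block_matrix (mat 1) 0 0 (diag_mat (\<lambda>i. sqrt (d i))) **
      (block_matrix (mat 1) 0 0 (diag_mat (\<lambda>i. 1 / sqrt (d i))) ** T 0) = T 0"
    by (simp only: matrix_mul_assoc block_matrix_mult matrix_mul_zero matrix_mul_lid matrix_mul_rid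
        add_0_left add_0_right mat_1_block[symmetric])
  then show ?thesis
    using hbar ST[of 0] by (simp add: S0_def T0_def matrix_mul_scaleR flip: matrix_mul_assoc)
qed

lemma S0_inv: "matrix_inv S0 = T0"
  by (rule matrix_inv_unique) (rule S0_T0)

lemma S0_invertible: "invertible S0"
  using S0_T0 by (auto simp: invertible_right_inverse)

lemma T0_proj:
  "xproj (T0 *v z) = (1 / sqrt hbar) *\<^sub>R (V *v xproj z)"
  "pproj (T0 *v z) = (1 / sqrt hbar) *\<^sub>R (diag_mat (\<lambda>i. 1 / sqrt (d i)) *v (matrix_inv (transpose V) *v pproj z))"
  by (simp_all add: T0_def matrix_vector_scaleR T_proj flip: matrix_vector_mul_assoc)

lemma T0_proj_norm:
  "(norm (xproj (T0 *v z)))\<^sup>2 = (norm (V *v xproj z))\<^sup>2 / hbar"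
  "(norm (pproj (T0 *v z)))\<^sup>2 = (\<Sum>i\<in>UNIV. ((matrix_inv (transpose V) *v pproj z) $ i)\<^sup>2 / d i) / hbar"
  using hbar d_pos unfolding T0_proj
  by (simp_all add: power_mult_distrib power_divide norm_power2_vec[of "diag_mat _ *v _"] less_imp_le)

lemma T0_xproj_le: "norm (xproj (T0 *v z)) \<le> 1 \<longleftrightarrow> xproj z \<in> X"
  using norm_le_sqrt_iff[of 1 "xproj (T0 *v z)"] hbar by (simp add: T0_proj_norm mem_X divide_le_eq)

lemma T0_pproj_le: "norm (pproj (T0 *v z)) \<le> 1 \<longleftrightarrow> pproj z \<in> P"
  using norm_le_sqrt_iff[of 1 "pproj (T0 *v z)"] hbar by (simp add: T0_proj_norm mem_P divide_le_eq)

lemma mem_S0_ball: "z \<in> (*v) S0 ` cball 0 1 \<longleftrightarrow> norm (T0 *v z) \<le> 1"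
proof
  assume "z \<in> (*v) S0 ` cball 0 1"
  then show "norm (T0 *v z) \<le> 1"
    using matrix_inv_mult_cancel(4)[OF S0_invertible] by (auto simp: S0_inv)
next
  assume "norm (T0 *v z) \<le> 1"
  moreover have "z = S0 *v (T0 *v z)"
    using matrix_inv_mult_cancel(3)[OF S0_invertible, of z] by (simp add: S0_inv)
  ultimately show "z \<in> (*v) S0 ` cball 0 1" by (metis image_eqI mem_cball_0)
qed

lemma norm_T0_le:
  "norm (xproj (T0 *v z)) \<le> norm (T0 *v z)" "norm (pproj (T0 *v z)) \<le> norm (T0 *v z)"
  by (rule power2_le_imp_le, simp add: phase_norm_power2[of "T0 *v z"], simp)+

lemma largest_ellipsoid: "largest_inscribed_ellipsoid X P ((*v) S0 ` cball 0 1)"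
proof (rule largest_ellipsoid_in_product[OF S0_invertible])
  show "phase_prod X P = {z. norm (xproj (matrix_inv S0 *v z)) \<le> 1 \<and> norm (pproj (matrix_inv S0 *v z)) \<le> 1}"
    by (auto simp: phase_prod_def S0_inv T0_xproj_le T0_pproj_le)
  show "xproj ` (*v) S0 ` cball 0 1 = X"
  proof (intro equalityI subsetI)
    fix x assume "x \<in> xproj ` (*v) S0 ` cball 0 1"
    then obtain z where "z \<in> (*v) S0 ` cball 0 1" "x = xproj z" by blast
    then show "x \<in> X" using norm_T0_le(1)[of z] T0_xproj_le[of z] by (simp only: mem_S0_ball) simp
  next
    fix x assume x: "x \<in> X"
    let ?z = "vec_join x 0"
    have "(norm (T0 *v ?z))\<^sup>2 = (norm (xproj (T0 *v ?z)))\<^sup>2"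
      by (simp add: phase_norm_power2[of "T0 *v ?z"] T0_proj(2))
    then have "norm (T0 *v ?z) = norm (xproj (T0 *v ?z))" by simp
    then have "?z \<in> (*v) S0 ` cball 0 1"
      using x T0_xproj_le[of ?z] by (simp only: mem_S0_ball proj_vec_join)
    then show "x \<in> xproj ` (*v) S0 ` cball 0 1" by (metis image_eqI proj_vec_join(1))
  qed
  show "pproj ` (*v) S0 ` cball 0 1 = P"
  proof (intro equalityI subsetI)
    fix p assume "p \<in> pproj ` (*v) S0 ` cball 0 1"
    then obtain z where "z \<in> (*v) S0 ` cball 0 1" "p = pproj z" by blast
    then show "p \<in> P" using norm_T0_le(2)[of z] T0_pproj_le[of z] by (simp only: mem_S0_ball) simp
  next
    fix p assume p: "p \<in> P"
    let ?z = "vec_join 0 p"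
    have "(norm (T0 *v ?z))\<^sup>2 = (norm (pproj (T0 *v ?z)))\<^sup>2"
      by (simp add: phase_norm_power2[of "T0 *v ?z"] T0_proj(1))
    then have "norm (T0 *v ?z) = norm (pproj (T0 *v ?z))" by simp
    then have "?z \<in> (*v) S0 ` cball 0 1"
      using p T0_pproj_le[of ?z] by (simp only: mem_S0_ball proj_vec_join)
    then show "p \<in> pproj ` (*v) S0 ` cball 0 1" by (metis image_eqI proj_vec_join(2))
  qed
qed

text \<open>This is (hbar / 2) (A^{-1} \<oplus> B^{-1}).\<close>

definition \<Sigma>0 :: "real ^ ('n + 'n) ^ ('n + 'n)" where
  "\<Sigma>0 = (1 / 2) *\<^sub>R (S0 ** transpose S0)"

lemma \<Sigma>0: "posdef \<Sigma>0" "largest_inscribed_ellipsoid X P (cov_ellipsoid \<Sigma>0)"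
  using posdef_scaled_gram[OF S0_invertible, of 1] largest_ellipsoid by (simp_all add: \<Sigma>0_def)

text \<open>Two different strict maximizers would each have smaller volume than the other.\<close>

lemma \<Sigma>0_unique:
  assumes "posdef \<Sigma>" "largest_inscribed_ellipsoid X P (cov_ellipsoid \<Sigma>)"
  shows "\<Sigma> = \<Sigma>0"
proof (rule cov_ellipsoid_inject[OF assms(1) \<Sigma>0(1)])
  show "cov_ellipsoid \<Sigma> = cov_ellipsoid \<Sigma>0"
    using assms(2) \<Sigma>0(2) unfolding largest_inscribed_ellipsoid_def by (metis less_asym)
qed

lemma gaussian_density_\<Sigma>0: "gaussian_density \<Sigma>0 z = wig z"
proof -
  have form: "(matrix_inv \<Sigma>0 *v z) \<bullet> z = 2 * (norm (T0 *v z))\<^sup>2"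
    using posdef_scaled_gram(3)[OF S0_invertible, of 1 z] by (simp add: \<Sigma>0_def S0_inv)
  have "block_matrix (mat 1) 0 0 (diag_mat (\<lambda>i. sqrt (d i))) =
      diag_mat (case_sum (\<lambda>_. 1) (\<lambda>i. sqrt (d i)))"
    by (simp add: vec_eq_iff block_matrix_def mat_def split_sum_all)
  then have "\<bar>det S0\<bar> = sqrt hbar ^ CARD('n + 'n) * (\<Prod>i\<in>UNIV. sqrt (d i))"
    using abs_det_Sp[OF S_Sp, of 0] hbar d_pos
    by (simp add: S0_def det_scaleR_matrix det_mul abs_mult prod_UNIV_sum_type abs_prod less_imp_le)
  also have "sqrt hbar ^ CARD('n + 'n) = hbar ^ CARD('n)"
    using hbar by (simp add: power_add flip: power_mult_distrib)
  finally have detS0: "\<bar>det S0\<bar> = hbar ^ CARD('n) * (\<Prod>i\<in>UNIV. sqrt (d i))" .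
  have P: "(\<Prod>i\<in>UNIV. sqrt (d i)) > 0" using d_pos by (simp add: prod_pos)
  have "det \<Sigma>0 = ((1 / 2) ^ CARD('n) * \<bar>det S0\<bar>)\<^sup>2"
    by (simp add: \<Sigma>0_def det_scaleR_matrix det_mul power2_eq_square power_add)
  then have "det \<Sigma>0 powr (- 1 / 2) = 1 / ((1 / 2) ^ CARD('n) * \<bar>det S0\<bar>)"
    using S0_invertible by (simp add: powr_minus_divide powr_half_sqrt invertible_det_nz abs_mult)
  then have const: "(1 / (2 * pi)) ^ CARD('n) * det \<Sigma>0 powr (- 1 / 2) =
      (1 / (pi * hbar)) ^ CARD('n) / (\<Prod>i\<in>UNIV. sqrt (d i))"
    using hbar P unfolding detS0 by (simp add: power_mult_distrib power_divide)
  have "(norm (T0 *v z))\<^sup>2 = ((\<Sum>i\<in>UNIV. ((V *v xproj z) $ i)\<^sup>2) +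
      (\<Sum>i\<in>UNIV. ((matrix_inv (transpose V) *v pproj z) $ i)\<^sup>2 / d i)) / hbar"
    unfolding phase_norm_power2[of "T0 *v z"] T0_proj_norm norm_power2_vec[of "V *v _"] by (simp add: add_divide_distrib)
  moreover have "- 1 / 2 * (2 * x) = - x" for x :: real by simp
  ultimately show ?thesis
    by (simp only: gaussian_density_def form const wig_def minus_divide_left)
qed

text \<open>A B = V^T D^{-1} V^{-T} is similar to D^{-1}, and similar matrices have the same
  characteristic polynomial.\<close>

lemma eigenvalues_AB: "eigenvalues_with_mult (A ** B) (\<lambda>i. 1 / d i)"
  unfolding eigenvalues_with_mult_def
proof
  fix t
  let ?W = "matrix_inv (transpose V)"
  have "A ** B = transpose V ** diag_mat (\<lambda>i. 1 / d i) ** ?W"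
    unfolding A_def B_def by (simp add: V_cancel flip: matrix_mul_assoc)
  moreover have "diag_mat (\<lambda>i. t - 1 / d i) = t *\<^sub>R mat 1 - (diag_mat (\<lambda>i. 1 / d i) :: real ^ 'n ^ 'n)"
    by (simp add: vec_eq_iff mat_def)
  moreover have "mat t = t *\<^sub>R (mat 1 :: real ^ 'n ^ 'n)"
    by (simp add: vec_eq_iff mat_def)
  ultimately have "mat t - A ** B = transpose V ** diag_mat (\<lambda>i. t - 1 / d i) ** ?W"
    by (simp add: matrix_mul_diff VT_cancel matrix_mul_scaleR)
  moreover have "det (transpose V) * det ?W = 1"
    by (metis VT_cancel(1) det_I det_mul)
  ultimately show "det (mat t - A ** B) = (\<Prod>i\<in>UNIV. t - 1 / d i)"
    by (simp add: det_mul mult.left_commute mult.commute)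
qed

text \<open>Every d i is at least 1, so an eigenvalue 1 / d i that is not below one equals one and
  contributes the factor 1.\<close>

lemma purity_eq: "(\<Prod>i | 1 / d i < 1. sqrt (1 / d i)) = hilbert_schmidt"
  unfolding hilbert_schmidt_K
proof (rule prod.mono_neutral_cong_left)
  show "\<forall>i\<in>UNIV - {i. 1 / d i < 1}. 1 / sqrt (d i) = 1"
  proof
    fix i assume "i \<in> UNIV - {i. 1 / d i < 1}"
    then have "d i = 1" using d[of i] by (auto simp: not_less le_divide_eq)
    then show "1 / sqrt (d i) = 1" by simp
  qed
qed (auto simp: real_sqrt_divide)

end

text \<open>Test the inclusion at sqrt hbar q with q = V^T e_i. This point lies in the polar dual
  because q . x is the i-th coordinate of V x. With u = V^{-1} e_i one has B^{-1} u = d i q, hence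
  (B q) . q = 1 / d i, and membership in the ellipsoid of B reads 1 / d i <= 1.\<close>

lemma polar_dual_subset_imp_ge_1:
  fixes V :: "real ^ 'n ^ 'n"
  assumes h: "hbar > 0" and V: "invertible V" and A: "A = transpose V ** V"
    and B: "posdef B" and C: "matrix_inv B = transpose V ** diag_mat d ** V"
    and sub: "polar_dual hbar (quad_ellipsoid A hbar) \<subseteq> quad_ellipsoid B hbar"
  shows "d i \<ge> 1"
proof -
  let ?e = "axis i 1 :: real ^ 'n"
  define u where "u = matrix_inv V *v ?e"
  define q where "q = transpose V *v ?e"
  have Vu: "V *v u = ?e" using V by (simp add: u_def matrix_inv_mult_cancel)
  have "diag_mat d *v ?e = d i *\<^sub>R ?e" by (simp add: vec_eq_iff axis_def)
  then have "transpose V *v (diag_mat d *v (V *v u)) = d i *\<^sub>R q"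
    by (simp only: Vu matrix_vector_mult_scaleR q_def)
  then have Cu: "matrix_inv B *v u = d i *\<^sub>R q"
    by (simp only: C matrix_vector_mul_assoc matrix_mul_assoc)
  have qu: "q \<bullet> u = 1"
    by (simp add: q_def inner_transpose_mult Vu inner_axis_axis del: transpose_matrix_vector)
  have "u \<noteq> 0" using qu by auto
  with posdef_matrix_inv[OF B] have "(matrix_inv B *v u) \<bullet> u > 0" by (simp add: posdef_def)
  then have d: "d i > 0" by (simp add: Cu qu)
  have "B *v (d i *\<^sub>R q) = u"
    using matrix_inv_mult_cancel(3)[OF posdef_invertible[OF B], of u] by (simp add: Cu)
  then have "d i *\<^sub>R (B *v q) = u" by (simp only: matrix_vector_mult_scaleR)
  then have "(d i *\<^sub>R (B *v q)) \<bullet> q = 1" using qu by (simp add: inner_commute)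
  then have Bq: "(B *v q) \<bullet> q = 1 / d i" using d by (simp add: field_simps)
  have "sqrt hbar *\<^sub>R q \<in> polar_dual hbar (quad_ellipsoid A hbar)"
    unfolding polar_dual_def
  proof (intro CollectI ballI)
    fix x assume "x \<in> quad_ellipsoid A hbar"
    then have "(norm (V *v x))\<^sup>2 \<le> hbar"
      by (simp add: quad_ellipsoid_def A power2_norm_eq_inner inner_transpose_mult
          flip: matrix_vector_mul_assoc del: transpose_matrix_vector)
    then have x: "norm (V *v x) \<le> sqrt hbar" using h by (simp add: norm_le_sqrt_iff)
    have "q \<bullet> x = ?e \<bullet> (V *v x)" unfolding q_def by (rule inner_transpose_mult)
    also have "\<dots> \<le> norm ?e * norm (V *v x)" by (rule norm_cauchy_schwarz)
    finally have "q \<bullet> x \<le> sqrt hbar" using x by simp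
    then have "sqrt hbar * (q \<bullet> x) \<le> sqrt hbar * sqrt hbar"
      using h by (intro mult_left_mono) simp_all
    then show "(sqrt hbar *\<^sub>R q) \<bullet> x \<le> hbar" using h by simp
  qed
  with sub have "sqrt hbar *\<^sub>R q \<in> quad_ellipsoid B hbar" by blast
  then have "(sqrt hbar * sqrt hbar) * ((B *v q) \<bullet> q) \<le> hbar"
    by (simp only: quad_ellipsoid_def mem_Collect_eq matrix_vector_mult_scaleR inner_scaleR_left
        inner_scaleR_right mult.assoc)
  then have "hbar * (1 / d i) \<le> hbar * 1" using h by (simp add: Bq)
  then have "1 / d i \<le> 1" using h by (simp only: mult_le_cancel_left_pos)
  then show ?thesis using d by (simp add: divide_le_eq)
qed

theorem theorem13:
  fixes hbar :: real
    and A B :: "real ^ 'n ^ 'n"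
    and X P :: "(real ^ 'n) set"
    and \<Sigma>XX \<Sigma>XP :: "real ^ 'n ^ 'n"
  assumes "hbar > 0"
    and "posdef A" and "posdef B"
    and "X = quad_ellipsoid A hbar" and "P = quad_ellipsoid B hbar"
    and "polar_dual hbar X \<subseteq> P" and "polar_dual hbar X \<noteq> P"
    and "\<Sigma>XX = (hbar / 2) *\<^sub>R matrix_inv A"
    and "\<Sigma>XP = (hbar / 2) *\<^sub>R diag_sqrt (matrix_inv B ** matrix_inv A - mat 1)"
  shows
    "(\<exists>\<Omega>p \<Omega>m.
        \<Omega>p \<noteq> \<Omega>m \<and>
        (\<forall>(s, \<Omega>) \<in> {(1, \<Omega>p), (- 1, \<Omega>m)}.
           quantum_blob hbar \<Omega> \<and>
           \<Omega> \<subseteq> phase_prod X P \<and> xproj ` \<Omega> = X \<and> pproj ` \<Omega> = P \<and>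
           unit_L2 (gaussian_state hbar s \<Sigma>XX \<Sigma>XP) \<and>
           has_covariance_ellipsoid hbar (gaussian_state hbar s \<Sigma>XX \<Sigma>XP) \<Omega>)) \<and>
     (\<exists>\<Sigma>. posdef \<Sigma> \<and> largest_inscribed_ellipsoid X P (cov_ellipsoid \<Sigma>)) \<and>
     (\<exists>ev. eigenvalues_with_mult (A ** B) ev \<and>
       (\<forall>\<Sigma>. posdef \<Sigma> \<and> largest_inscribed_ellipsoid X P (cov_ellipsoid \<Sigma>) \<longrightarrow>
          (\<exists>\<rho>. quantum_state \<rho> \<and>
                has_wigner_distribution hbar \<rho> (\<lambda>z. of_real (gaussian_density \<Sigma> z))) \<and>
          (\<forall>\<rho>. quantum_state \<rho> \<and>
                has_wigner_distribution hbar \<rho> (\<lambda>z. of_real (gaussian_density \<Sigma> z)) \<longrightarrow>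
                mixed_state \<rho> \<and> has_purity \<rho> (\<Prod>i | ev i < 1. sqrt (ev i)))))"
proof -
  have "transpose (matrix_inv B) = matrix_inv B"
    using posdef_matrix_inv[OF assms(3)] by (simp add: posdef_def)
  then obtain V :: "real ^ 'n ^ 'n" and d where
    V: "invertible V" "A = transpose V ** V" "matrix_inv B = transpose V ** diag_mat d ** V"
    by (rule simultaneous_diagonalization[OF assms(2)])
  have d1: "d i \<ge> 1" for i
    using polar_dual_subset_imp_ge_1[OF assms(1) V(1,2) assms(3) V(3)] assms(4-6) by blast
  interpret G: gaussian_kernel hbar V d
    by standard (fact assms(1) V(1) d1)+
  have GA: "G.A = A" by (simp add: G.A_def V(2))
  have GB: "G.B = B"
    using G.B_eq V(3) matrix_inv_matrix_inv[OF posdef_invertible[OF assms(3)]] by simp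
  \<comment> \<open>Oriented so that unfolding expresses all given objects by those of the
    locale.\<close>
  note G = assms(4,5,8,9) GA[symmetric] GB[symmetric]
  \<comment> \<open>Strictness of the inclusion; this index makes the two blobs distinct and the
    purity less than one.\<close>
  obtain k where k: "d k \<noteq> 1"
    using G.polar_dual_X_superset assms(6,7) unfolding G by blast
  have blob: "quantum_blob hbar (G.blob s) \<and> G.blob s \<subseteq> phase_prod X P \<and>
      xproj ` G.blob s = X \<and> pproj ` G.blob s = P \<and>
      unit_L2 (gaussian_state hbar s \<Sigma>XX \<Sigma>XP) \<and>
      has_covariance_ellipsoid hbar (gaussian_state hbar s \<Sigma>XX \<Sigma>XP) (G.blob s)" if "s\<^sup>2 = 1" for s
    unfolding G quantum_blob_def phase_prod_def
    using G.blob_subset[OF _ that] G.xproj_blob[OF that] G.pproj_blob[OF that] G.S_Sp[of s]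
      G.unit_gaussian_state[of s] G.covariance_ellipsoid_gaussian_state[of s]
    by (auto simp: G.blob_def)
  have "\<exists>\<Omega>p \<Omega>m. \<Omega>p \<noteq> \<Omega>m \<and> (\<forall>(s, \<Omega>) \<in> {(1, \<Omega>p), (- 1, \<Omega>m)}.
      quantum_blob hbar \<Omega> \<and> \<Omega> \<subseteq> phase_prod X P \<and> xproj ` \<Omega> = X \<and> pproj ` \<Omega> = P \<and>
      unit_L2 (gaussian_state hbar s \<Sigma>XX \<Sigma>XP) \<and>
      has_covariance_ellipsoid hbar (gaussian_state hbar s \<Sigma>XX \<Sigma>XP) \<Omega>)"
    using G.blob_distinct[OF k] blob[of 1] blob[of "- 1"]
    by (intro exI[of _ "G.blob 1"] exI[of _ "G.blob (- 1)"]) simp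
  moreover have "\<exists>\<Sigma>. posdef \<Sigma> \<and> largest_inscribed_ellipsoid X P (cov_ellipsoid \<Sigma>)"
    unfolding G using G.\<Sigma>0 by blast
  moreover have "(\<exists>\<rho>. quantum_state \<rho> \<and> has_wigner_distribution hbar \<rho> (\<lambda>z. of_real (gaussian_density \<Sigma> z))) \<and>
      (\<forall>\<rho>. quantum_state \<rho> \<and> has_wigner_distribution hbar \<rho> (\<lambda>z. of_real (gaussian_density \<Sigma> z)) \<longrightarrow>
        mixed_state \<rho> \<and> has_purity \<rho> (\<Prod>i | 1 / d i < 1. sqrt (1 / d i)))"
    if "posdef \<Sigma> \<and> largest_inscribed_ellipsoid X P (cov_ellipsoid \<Sigma>)" for \<Sigma>
  proof -
    have \<Sigma>: "\<Sigma> = G.\<Sigma>0" using that unfolding G by (intro G.\<Sigma>0_unique) auto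
    have "mixed_state \<rho> \<and> has_purity \<rho> G.hilbert_schmidt"
      if q: "quantum_state \<rho>" and w: "has_wigner_distribution hbar \<rho> (\<lambda>z. of_real (G.wig z))" for \<rho>
    proof -
      have "L2_operator \<rho>" using q by (simp add: quantum_state_def possemidef_operator_def)
      then show ?thesis
        using G.mixed_state_of_kernel[OF q _ G.hilbert_schmidt_lt_1[OF k]] G.has_purity_of_kernel
          G.state_of_wigner_unique[OF q w] by blast
    qed
    then show ?thesis
      unfolding \<Sigma> G.gaussian_density_\<Sigma>0 G.purity_eq using G.gaussian_state_exists by blast
  qed
  moreover have "eigenvalues_with_mult (A ** B) (\<lambda>i. 1 / d i)"
    using G.eigenvalues_AB by (simp add: GA GB)
  ultimately show ?thesis by blast
qed

end
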